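(* Let $X$ be a linear diffusion on $(0,+\infty[$ as described in the context, such that $0$ is an entrance-not-exit boundary point and $X$ is transient with $X_t\to+\infty$ a.s. as $t\to+\infty$. Let $h:[0,+\infty[\to\,]0,+\infty[$ be a bounded function of class $\mathcal{C}^1$ with bounded derivative, and let $f:[0,+\infty[\to\,]0,+\infty[$ be the (continuous) function defined by $$\int_0^{+\infty}h(t+u)\,q(u,f(t),0)\,du=1\qquad(t\ge 0).$$ Then the density of $G_f$ is given by $$\mathbb{P}_x(G_f\in dt)=-\frac{q(t,x,f(t))}{s'(f(t))}\left(\int_0^{+\infty}h(u+t)\,\frac{\partial q(u,y,0)}{\partial y}\Big|_{y=f(t)}\,du\right)dt\qquad(t>0).$$
   Context: Setting: $(X_t,t\ge 0)$ is a linear regular conservative (infinite life-time) diffusion with values in $I=(0,+\infty[$ (left endpoint $\ell=0$), with $+\infty$ a natural boundary; $\mathbb{P}_x$ is its law started from $x$. Its speed measure is $m(dx)=\rho(x)dx$ (absolutely continuous), its scale function $s$ is of class $\mathcal{C}^2$, and its generator is $\mathcal{G}=\frac{1}{\rho(x)}\frac{\partial}{\partial x}\left(\frac{1}{s'(x)}\frac{\partial}{\partial x}\right)$. $X$ has a transition density $q(t,x,y)$ with respect to $m$, jointly continuous, symmetric in $(x,y)$, assumed of class $\mathcal{C}^{1,2,2}$ on $]0,+\infty[\times I\times I$; in particular $\mathcal{G}q=\partial q/\partial t$ in the variables $(t,x)$. Known facts: for $x>0$, $\lim_{t\to 0}q(t,x,0)=0$; for every $t>0$, $y\mapsto q(t,y,0)$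 is decreasing and tends to $0$ as $y\to+\infty$. Since $0$ is entrance-not-exit, for every $t\ge0$ the function $y\mapsto\int_0^{+\infty}h(t+u)q(u,y,0)du$ decreases from $+\infty$ to $0$ on $]0,+\infty[$, so $f$ is well defined. Last passage time: $G_f:=\sup\{t\ge 0: X_t=f(t)\}$, with $G_f=0$ if this set is empty. *)

theory Defs
  imports "HOL-Probability.Probability"
begin

text \<open>
  Diffusions live on the open half-line \<open>I = ]0, \<infinity>[\<close>, i.e. on the set \<open>{0<..}\<close>. Times are reals, and
  only times \<open>t \<ge> 0\<close> matter. A family \<open>P\<close> of laws on one measurable space \<open>M\<close> (whose own measure
  plays no role) is indexed by the starting point; only \<open>P x\<close> with \<open>x > 0\<close> matters.
\<close>

subsection \<open>Linear regular conservative diffusions on the half-line\<close>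

definition natural_filtration :: "'w measure \<Rightarrow> (real \<Rightarrow> 'w \<Rightarrow> real) \<Rightarrow> real \<Rightarrow> 'w measure" where
  "natural_filtration M X t =
     sigma (space M) {X r -` B \<inter> space M | r B. 0 \<le> r \<and> r \<le> t \<and> B \<in> sets borel}"

lemma filtration_natural_filtration: "filtration (space M) (natural_filtration M X)"
proof
  show "space (natural_filtration M X i) = space M" for i
    unfolding natural_filtration_def by (rule space_measure_of) auto
  show "sets (natural_filtration M X i) \<subseteq> sets (natural_filtration M X j)" if "i \<le> j" for i j
    unfolding natural_filtration_def using that
    by (subst (1 2) sets_measure_of) (auto intro!: sigma_sets_mono' | force)+
qed

text \<open>
  The lifetime is infinite since every path stays in \<open>{0<..}\<close> for all times. The strong Markov
  property is required at everywhere finite stopping times; applied to \<open>T \<and> n\<close> on \<open>{T \<le> n}\<close> it gives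
  the usual form on \<open>{T < \<infinity>}\<close> for stopping times with values in \<open>[0, \<infinity>]\<close>.
\<close>

locale linear_diffusion =
  fixes M :: "'w measure" and P :: "real \<Rightarrow> 'w measure" and X :: "real \<Rightarrow> 'w \<Rightarrow> real"
  assumes prob_P: "0 < x \<Longrightarrow> prob_space (P x)"
    and sets_P: "0 < x \<Longrightarrow> sets (P x) = sets M"
    and measurable_X: "0 \<le> t \<Longrightarrow> X t \<in> borel_measurable M"
    and continuous_paths: "\<omega> \<in> space M \<Longrightarrow> continuous_on {0..} (\<lambda>t. X t \<omega>)"
    and positive_paths: "\<omega> \<in> space M \<Longrightarrow> 0 \<le> t \<Longrightarrow> 0 < X t \<omega>"
    and start: "0 < x \<Longrightarrow> AE \<omega> in P x. X 0 \<omega> = x"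
    and measurable_P: "0 \<le> t \<Longrightarrow> B \<in> sets borel \<Longrightarrow>
      (\<lambda>x. emeasure (P x) {\<omega> \<in> space M. X t \<omega> \<in> B}) \<in> borel_measurable (restrict_space borel {0<..})"
    and strong_markov:
      "0 < x \<Longrightarrow> stopping_time (natural_filtration M X) T \<Longrightarrow> (\<And>\<omega>. \<omega> \<in> space M \<Longrightarrow> 0 \<le> T \<omega>) \<Longrightarrow>
       A \<in> sets (filtration.pre_sigma (space M) (natural_filtration M X) T) \<Longrightarrow>
       0 \<le> t \<Longrightarrow> B \<in> sets borel \<Longrightarrow>
       emeasure (P x) {\<omega> \<in> A. X (T \<omega> + t) \<omega> \<in> B} =
         (\<integral>\<^sup>+\<omega>\<in>A. emeasure (P (X (T \<omega>) \<omega>)) {\<omega>' \<in> space M. X t \<omega>' \<in> B} \<partial>P x)"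
    and regular:
      "0 < x \<Longrightarrow> 0 < y \<Longrightarrow> 0 < measure (P x) {\<omega> \<in> space M. \<exists>t\<ge>0. X t \<omega> = y}"

definition transient :: "'w measure \<Rightarrow> (real \<Rightarrow> 'w measure) \<Rightarrow> (real \<Rightarrow> 'w \<Rightarrow> real) \<Rightarrow> bool" where
  "transient M P X \<longleftrightarrow>
     (\<exists>x>0. \<exists>y>0. measure (P x) {\<omega> \<in> space M. \<exists>t\<ge>0. X t \<omega> = y} < 1)"

subsection \<open>Scale function, speed measure, generator\<close>

definition scale_function ::
  "'w measure \<Rightarrow> (real \<Rightarrow> 'w measure) \<Rightarrow> (real \<Rightarrow> 'w \<Rightarrow> real) \<Rightarrow> (real \<Rightarrow> real) \<Rightarrow> bool" where
  "scale_function M P X s \<longleftrightarrow>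
     continuous_on {0<..} s \<and> strict_mono_on {0<..} s \<and>
     (\<forall>a x b. 0 < a \<and> a < x \<and> x < b \<longrightarrow>
        measure (P x) {\<omega> \<in> space M. \<exists>t\<ge>0. X t \<omega> = b \<and> (\<forall>r\<in>{0..t}. X r \<omega> \<noteq> a)} =
          (s x - s a) / (s b - s a))"

definition exit_time :: "(real \<Rightarrow> 'w \<Rightarrow> real) \<Rightarrow> real \<Rightarrow> real \<Rightarrow> 'w \<Rightarrow> ennreal" where
  "exit_time X a b \<omega> = (INF t\<in>{t. 0 \<le> t \<and> X t \<omega> \<notin> {a<..<b}}. ennreal t)"

text \<open>
  The speed measure is normalised so that the generator is \<open>d/dm d/ds\<close>, without a factor \<open>1/2\<close>: the
  mean exit time \<open>v\<close> from \<open>]a, b[\<close> solves \<open>d/dm d/ds v = -1\<close>, \<open>v(a) = v(b) = 0\<close>, so that the kernel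
  below is the Green function of \<open>-d\<^sup>2/ds\<^sup>2\<close>, also without a factor \<open>2\<close>.
\<close>

definition speed_measure ::
  "'w measure \<Rightarrow> (real \<Rightarrow> 'w measure) \<Rightarrow> (real \<Rightarrow> 'w \<Rightarrow> real) \<Rightarrow> (real \<Rightarrow> real) \<Rightarrow> real measure \<Rightarrow> bool" where
  "speed_measure M P X s m \<longleftrightarrow>
     sets m = sets borel \<and> emeasure m {..0} = 0 \<and>
     (\<forall>a b. 0 < a \<and> a < b \<longrightarrow> 0 < emeasure m {a<..<b} \<and> emeasure m {a..b} < \<infinity>) \<and>
     (\<forall>a x b. 0 < a \<and> a < x \<and> x < b \<longrightarrow>
        (\<integral>\<^sup>+\<omega>. exit_time X a b \<omega> \<partial>P x) =
        (\<integral>\<^sup>+y\<in>{a<..<b}. ennreal ((s (min x y) - s a) * (s b - s (max x y)) / (s b - s a)) \<partial>m))"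

definition halfline_measure :: "(real \<Rightarrow> real) \<Rightarrow> real measure" where
  "halfline_measure \<rho> = density lborel (\<lambda>x. ennreal (\<rho> x) * indicator {0<..} x)"

definition generator :: "(real \<Rightarrow> real) \<Rightarrow> (real \<Rightarrow> real) \<Rightarrow> (real \<Rightarrow> real) \<Rightarrow> real \<Rightarrow> real" where
  "generator \<rho> s g x = 1 / \<rho> x * deriv (\<lambda>z. 1 / deriv s z * deriv g z) x"

subsection \<open>Feller's classification of the end points\<close>

text \<open>
  Here \<open>s(da) = s'(a) da\<close>. For a locally finite \<open>m\<close> the choice of the reference point \<open>z\<close> is
  immaterial.
\<close>

definition exit_at_0 :: "(real \<Rightarrow> real) \<Rightarrow> real measure \<Rightarrow> bool" where
  "exit_at_0 s m \<longleftrightarrow>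
     (\<exists>z>0. (\<integral>\<^sup>+a\<in>{0<..<z}. emeasure m {a<..<z} * ennreal (deriv s a) \<partial>lborel) < \<infinity>)"

definition entrance_at_0 :: "(real \<Rightarrow> real) \<Rightarrow> real measure \<Rightarrow> bool" where
  "entrance_at_0 s m \<longleftrightarrow> (\<exists>z>0. (\<integral>\<^sup>+a\<in>{0<..<z}. ennreal (s z - s a) \<partial>m) < \<infinity>)"

definition exit_at_infinity :: "(real \<Rightarrow> real) \<Rightarrow> real measure \<Rightarrow> bool" where
  "exit_at_infinity s m \<longleftrightarrow>
     (\<exists>z>0. (\<integral>\<^sup>+a\<in>{z<..}. emeasure m {z<..<a} * ennreal (deriv s a) \<partial>lborel) < \<infinity>)"

definition entrance_at_infinity :: "(real \<Rightarrow> real) \<Rightarrow> real measure \<Rightarrow> bool" where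
  "entrance_at_infinity s m \<longleftrightarrow> (\<exists>z>0. (\<integral>\<^sup>+a\<in>{z<..}. ennreal (s a - s z) \<partial>m) < \<infinity>)"

definition natural_at_infinity :: "(real \<Rightarrow> real) \<Rightarrow> real measure \<Rightarrow> bool" where
  "natural_at_infinity s m \<longleftrightarrow> \<not> exit_at_infinity s m \<and> \<not> entrance_at_infinity s m"

subsection \<open>Transition densities and regularity classes\<close>

text \<open>
  The state \<open>0\<close> is not reached, but when it is an entrance boundary the density extends continuously
  to it; \<open>q t x 0\<close> denotes this extension, which is pinned down by the joint continuity on
  \<open>{0<..} \<times> {0..} \<times> {0..}\<close>.
\<close>

definition transition_density ::
  "'w measure \<Rightarrow> (real \<Rightarrow> 'w measure) \<Rightarrow> (real \<Rightarrow> 'w \<Rightarrow> real) \<Rightarrow> real measure \<Rightarrow>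
   (real \<Rightarrow> real \<Rightarrow> real \<Rightarrow> real) \<Rightarrow> bool" where
  "transition_density M P X m q \<longleftrightarrow>
     (\<forall>t>0. \<forall>x\<ge>0. \<forall>y\<ge>0. 0 \<le> q t x y \<and> q t x y = q t y x) \<and>
     continuous_on ({0<..} \<times> {0..} \<times> {0..}) (\<lambda>(t, x, y). q t x y) \<and>
     (\<forall>t>0. \<forall>x>0. \<forall>B\<in>sets borel.
        emeasure (P x) {\<omega> \<in> space M. X t \<omega> \<in> B} = (\<integral>\<^sup>+y\<in>B. ennreal (q t x y) \<partial>m))"

text \<open>
  The classes below are those on \<open>{0<..}\<close> and its powers, in the library's total \<^const>\<open>deriv\<close>. The
  values \<open>q t x 0\<close> are therefore not covered by \<open>C122 q\<close>.
\<close>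

definition C2 :: "(real \<Rightarrow> real) \<Rightarrow> bool" where
  "C2 g \<longleftrightarrow>
     (\<forall>x>0. g field_differentiable at x \<and> deriv g field_differentiable at x) \<and>
     continuous_on {0<..} (deriv (deriv g))"

definition C12 :: "(real \<Rightarrow> real \<Rightarrow> real) \<Rightarrow> bool" where
  "C12 u \<longleftrightarrow>
     (\<forall>t>0. \<forall>x>0. (\<lambda>r. u r x) field_differentiable at t \<and>
        u t field_differentiable at x \<and> deriv (u t) field_differentiable at x) \<and>
     continuous_on ({0<..} \<times> {0<..}) (\<lambda>(t, x). deriv (\<lambda>r. u r x) t) \<and>
     continuous_on ({0<..} \<times> {0<..}) (\<lambda>(t, x). deriv (u t) x) \<and>
     continuous_on ({0<..} \<times> {0<..}) (\<lambda>(t, x). deriv (deriv (u t)) x)"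

definition C122 :: "(real \<Rightarrow> real \<Rightarrow> real \<Rightarrow> real) \<Rightarrow> bool" where
  "C122 q \<longleftrightarrow>
     (\<forall>t>0. \<forall>x>0. \<forall>y>0. (\<lambda>r. q r x y) field_differentiable at t \<and>
        (\<lambda>z. q t z y) field_differentiable at x \<and> deriv (\<lambda>z. q t z y) field_differentiable at x \<and>
        q t x field_differentiable at y \<and> deriv (q t x) field_differentiable at y) \<and>
     continuous_on ({0<..} \<times> {0<..} \<times> {0<..}) (\<lambda>(t, x, y). deriv (\<lambda>r. q r x y) t) \<and>
     continuous_on ({0<..} \<times> {0<..} \<times> {0<..}) (\<lambda>(t, x, y). deriv (\<lambda>z. q t z y) x) \<and>
     continuous_on ({0<..} \<times> {0<..} \<times> {0<..}) (\<lambda>(t, x, y). deriv (deriv (\<lambda>z. q t z y)) x) \<and>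
     continuous_on ({0<..} \<times> {0<..} \<times> {0<..}) (\<lambda>(t, x, y). deriv (q t x) y) \<and>
     continuous_on ({0<..} \<times> {0<..} \<times> {0<..}) (\<lambda>(t, x, y). deriv (deriv (q t x)) y)"

subsection \<open>Last passage times\<close>

text \<open>In \<^typ>\<open>ennreal\<close> the supremum of the empty set is \<open>0\<close> and that of an unbounded set is \<open>\<infinity>\<close>.\<close>

definition last_passage :: "(real \<Rightarrow> 'w \<Rightarrow> real) \<Rightarrow> (real \<Rightarrow> real) \<Rightarrow> 'w \<Rightarrow> ennreal" where
  "last_passage X f \<omega> = Sup (ennreal ` {t. 0 \<le> t \<and> X t \<omega> = f t})"

text \<open>
  \<open>Q(Z \<in> dt) = g(t) dt\<close> for \<open>t > 0\<close>; nothing is said about atoms of \<open>Z\<close> at \<open>0\<close> and \<open>\<infinity>\<close>. The sign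
  condition matters because \<^const>\<open>ennreal\<close> would clip negative values of \<open>g\<close>.
\<close>

definition has_density_on_positive :: "'w measure \<Rightarrow> ('w \<Rightarrow> ennreal) \<Rightarrow> (real \<Rightarrow> real) \<Rightarrow> bool" where
  "has_density_on_positive Q Z g \<longleftrightarrow>
     Z \<in> borel_measurable Q \<and> set_borel_measurable borel {0<..} g \<and> (\<forall>t>0. 0 \<le> g t) \<and>
     (\<forall>B\<in>sets borel. B \<subseteq> {0<..} \<longrightarrow>
        emeasure Q {\<omega> \<in> space Q. Z \<omega> \<in> ennreal ` B} = (\<integral>\<^sup>+t\<in>B. ennreal (g t) \<partial>lborel))"

end

theory Submission
  imports Defs
begin

text \<open>
  Put \<open>H t y = \<integral> h(t + u) q(u, y, 0) du\<close>. Since \<open>q(v - t, X\<^sub>t, 0)\<close> is a martingale on \<open>[0, v[\<close>, the process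
  \<open>H t (X t)\<close> is a positive local martingale, and it lies below, at or above \<open>1\<close> according as \<open>X\<^sub>t\<close> lies
  above, at or below \<open>f t\<close>; Doob's maximal identity suggests \<open>P\<^sub>x(G\<^sub>f \<ge> t) = E\<^sub>x(min 1 (H t (X t)))\<close>.
  This is proved without martingale theory: on \<open>X\<^sub>t > f t\<close>, the weighted occupation
  \<open>E\<^sub>x(\<integral> h(v) q(d, X\<^sub>v, 0) dv)\<close>, \<open>v \<ge> t\<close>, is computed by the Markov property both at time \<open>t\<close> and at the
  first later passage on the curve \<open>f\<close>; as \<open>d \<rightarrow> 0\<close>, the time before that passage contributes nothing.

  For the derivative in \<open>t\<close>, Green's formula is applied below a fixed level, where the boundary
  terms at \<open>0\<close> vanish because \<open>s\<close> tends to \<open>-\<infinity>\<close>. Above the level, \<open>H\<close> is resolved into the kernels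
  \<open>q(v - t, y, 0)\<close>, whose total expectation does not depend on \<open>t\<close>. The level may follow the curve
  because \<open>1 - H\<close> vanishes there.
\<close>

text \<open>Behind the maximal identity stands the fact that a positive local martingale which tends
  to \<open>0\<close> and now has a value of at most \<open>1\<close> reaches \<open>1\<close> with
  probability equal to that value. The occupation argument sees this from the entrance point
  \<open>0\<close>: as \<open>d \<rightarrow> 0\<close>, the kernel \<open>q(d, y, 0)\<close>
  vanishes for every \<open>y > 0\<close>, uniformly away from \<open>0\<close> by monotonicity in
  \<open>y\<close>, and up to the contact the path stays above a positive level. What remains is the
  occupation after the contact, where \<open>H = 1\<close>.

  Two obstacles shape the differentiation. The curve is merely continuous, and smoothness of
  \<open>H\<close> in \<open>y\<close> is never established; hence the tail is differentiated at a
  frozen level and the displacement of the level is estimated by itself. Moreover, no bound on space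
  derivatives of \<open>q\<close> near \<open>0\<close> is at hand: Green's formula has to live on
  bounded solutions, one of them nonincreasing in \<open>y\<close>. A mass above a level is always
  the constant total minus the mass below, so Green's formula acts on bounded intervals only and no
  boundary term at infinity arises.\<close>

section \<open>Auxiliary facts on integrals, zeros of continuous functions and convolutions\<close>

lemma (in prob_space) nn_integral_le_add_const:
  assumes "g \<in> borel_measurable M" "\<And>\<omega>. k \<omega> \<le> g \<omega> + c"
  shows "(\<integral>\<^sup>+\<omega>. k \<omega> \<partial>M) \<le> (\<integral>\<^sup>+\<omega>. g \<omega> \<partial>M) + c"
proof -
  have "(\<integral>\<^sup>+\<omega>. k \<omega> \<partial>M) \<le> (\<integral>\<^sup>+\<omega>. g \<omega> + c \<partial>M)"
    by (intro nn_integral_mono assms(2))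
  also have "\<dots> = (\<integral>\<^sup>+\<omega>. g \<omega> \<partial>M) + c"
    using assms(1) by (subst nn_integral_add) (simp_all add: emeasure_space_1)
  finally show ?thesis .
qed

text \<open>By compactness, a continuous function with arbitrarily small values on a dense set has a
  zero; this writes a hitting event with countably many times. The rational parameter
  \<open>p\<close> runs through \<open>[0, 1]\<close> and not through the interval itself, which may
  contain no rational when \<open>a = b\<close>.\<close>

lemma zero_in_Icc_iff:
  fixes g :: "real \<Rightarrow> real"
  assumes g: "continuous_on {a..b} g" and ab: "a \<le> b"
  shows "(\<exists>u\<in>{a..b}. g u = 0) \<longleftrightarrow> (\<forall>n. \<exists>p\<in>{p. p \<in> \<rat> \<and> 0 \<le> p \<and> p \<le> 1}. \<bar>g (a + (b - a) * p)\<bar> < 1 / real (Suc n))"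
proof
  define k where "k p = \<bar>g (a + (b - a) * p)\<bar>" for p
  have kc: "continuous_on {0..1} k"
  proof -
    have "(b - a) * p \<le> (b - a) * 1" "0 \<le> (b - a) * p" if "0 \<le> p" "p \<le> 1" for p
      using that ab by (intro mult_left_mono mult_nonneg_nonneg; simp)+
    then show ?thesis unfolding k_def
      by (intro continuous_intros continuous_on_compose2[OF g]) force
  qed
  assume "\<exists>u\<in>{a..b}. g u = 0"
  then obtain u where u: "u \<in> {a..b}" "g u = 0" by auto
  obtain p where p: "0 \<le> p" "p \<le> 1" "k p = 0"
  proof (cases "a = b")
    case True
    then show ?thesis using that[of 0] u by (auto simp: k_def)
  next
    case False
    then have "a + (b - a) * ((u - a) / (b - a)) = u" "0 \<le> (u - a) / (b - a)" "(u - a) / (b - a) \<le> 1"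
      using u ab by (simp_all add: divide_le_eq)
    then show ?thesis using that[of "(u - a) / (b - a)"] u by (simp add: k_def)
  qed
  show "\<forall>n. \<exists>p\<in>{p. p \<in> \<rat> \<and> 0 \<le> p \<and> p \<le> 1}. \<bar>g (a + (b - a) * p)\<bar> < 1 / real (Suc n)"
  proof
    fix n
    have "\<exists>d>0. \<forall>p'\<in>{0..1}. dist p' p < d \<longrightarrow> dist (k p') (k p) < 1 / real (Suc n)"
      using kc[unfolded continuous_on_iff, rule_format, of p "1 / real (Suc n)"] p by simp
    then obtain d where d: "0 < d" "\<And>p'. p' \<in> {0..1} \<Longrightarrow> dist p' p < d \<Longrightarrow> dist (k p') (k p) < 1 / real (Suc n)"
      by blast
    have "\<exists>p'\<in>\<rat>. 0 \<le> p' \<and> p' \<le> 1 \<and> \<bar>p' - p\<bar> < d"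
    proof (cases "p < 1")
      case True
      then obtain r where "r \<in> \<rat>" "p < r" "r < min 1 (p + d)"
        using Rats_dense_in_real[of p "min 1 (p + d)"] d(1) by auto
      then show ?thesis using p by (intro bexI[of _ r]) auto
    next
      case False
      then show ?thesis using p d(1) by (intro bexI[of _ 1]) auto
    qed
    then obtain p' where p': "p' \<in> \<rat>" "0 \<le> p'" "p' \<le> 1" "\<bar>p' - p\<bar> < d" by auto
    then have "k p' < 1 / real (Suc n)"
      using d(2)[of p'] p(3) by (simp add: dist_real_def k_def)
    then show "\<exists>p\<in>{p. p \<in> \<rat> \<and> 0 \<le> p \<and> p \<le> 1}. \<bar>g (a + (b - a) * p)\<bar> < 1 / real (Suc n)"
      using p' by (auto simp: k_def)
  qed
next
  assume *: "\<forall>n. \<exists>p\<in>{p. p \<in> \<rat> \<and> 0 \<le> p \<and> p \<le> 1}. \<bar>g (a + (b - a) * p)\<bar> < 1 / real (Suc n)"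
  have "\<exists>u\<in>{a..b}. \<forall>v\<in>{a..b}. \<bar>g u\<bar> \<le> \<bar>g v\<bar>"
    by (rule continuous_attains_inf) (use ab g in \<open>auto intro!: continuous_intros\<close>)
  then obtain u where u: "u \<in> {a..b}" "\<And>v. v \<in> {a..b} \<Longrightarrow> \<bar>g u\<bar> \<le> \<bar>g v\<bar>" by blast
  have "\<bar>g u\<bar> < 1 / real (Suc n)" for n
  proof -
    obtain p where p: "0 \<le> p" "p \<le> 1" "\<bar>g (a + (b - a) * p)\<bar> < 1 / real (Suc n)" using * by blast
    have "(b - a) * p \<le> (b - a) * 1" "0 \<le> (b - a) * p"
      using p ab by (intro mult_left_mono mult_nonneg_nonneg; simp)+
    then show ?thesis using u(2)[of "a + (b - a) * p"] p(3) by auto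
  qed
  then have "\<not> 0 < \<bar>g u\<bar>"
    using reals_Archimedean[of "\<bar>g u\<bar>"] by (auto simp: inverse_eq_divide dest: less_asym)
  then show "\<exists>u\<in>{a..b}. g u = 0" using u(1) by (intro bexI[of _ u]) auto
qed

lemma ennreal_le_add_tendsto_0:
  fixes a b :: ennreal
  assumes "\<And>n. a \<le> b + ennreal (e n)" "e \<longlonglongrightarrow> 0"
  shows "a \<le> b"
proof -
  have "(\<lambda>n. b + ennreal (e n)) \<longlonglongrightarrow> b + ennreal 0"
    by (intro tendsto_add tendsto_const tendsto_ennrealI assms)
  then show ?thesis using LIMSEQ_le_const[of _ "b + ennreal 0" a] assms(1) by auto
qed

lemma continuous_on_slice:
  assumes "continuous_on (A \<times> B) (\<lambda>(t, y). g t y)"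
  shows "y \<in> B \<Longrightarrow> continuous_on A (\<lambda>t. g t y)" "t \<in> A \<Longrightarrow> continuous_on B (g t)"
proof -
  show "continuous_on A (\<lambda>t. g t y)" if "y \<in> B"
  proof -
    have "continuous_on A (\<lambda>t. case (t, y) of (t, y) \<Rightarrow> g t y)"
      by (rule continuous_on_compose2[OF assms]) (use that in \<open>auto intro!: continuous_intros\<close>)
    then show ?thesis by simp
  qed
  show "continuous_on B (g t)" if "t \<in> A"
  proof -
    have "continuous_on B (\<lambda>y. case (t, y) of (t, y) \<Rightarrow> g t y)"
      by (rule continuous_on_compose2[OF assms]) (use that in \<open>auto intro!: continuous_intros\<close>)
    then show ?thesis by simp
  qed
qed

text \<open>Fatou's lemma along compact intervals that exhaust the positive half-line. Green's
  formula reaches only compact intervals of positive times; a uniform bound passes to all times in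
  this way.\<close>

lemma nn_integral_le_exhaustion:
  fixes g :: "real \<Rightarrow> ennreal"
  assumes [measurable]: "g \<in> borel_measurable borel"
    and "\<And>t. t \<le> 0 \<Longrightarrow> g t = 0" "\<And>n. (\<integral>\<^sup>+t\<in>{1 / real (Suc n)..real (Suc n)}. g t \<partial>lborel) \<le> C"
  shows "(\<integral>\<^sup>+t. g t \<partial>lborel) \<le> C"
proof -
  have "g t \<le> liminf (\<lambda>n. g t * indicator {1 / real (Suc n)..real (Suc n)} t)" for t
  proof (cases "0 < t")
    case True
    have "eventually (\<lambda>n. 1 / real (Suc n) < t) sequentially"
      using order_tendstoD(2)[OF LIMSEQ_Suc[OF lim_1_over_n] True] by simp
    moreover have "eventually (\<lambda>n. t \<le> real (Suc n)) sequentially"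
      using filterlim_compose[OF filterlim_real_sequentially filterlim_Suc] by (auto simp: filterlim_at_top)
    ultimately have "eventually (\<lambda>n. g t \<le> g t * indicator {1 / real (Suc n)..real (Suc n)} t) sequentially"
      by eventually_elim simp
    then show ?thesis by (rule Liminf_bounded)
  qed (use assms(2) in auto)
  then have "(\<integral>\<^sup>+t. g t \<partial>lborel) \<le> (\<integral>\<^sup>+t. liminf (\<lambda>n. g t * indicator {1 / real (Suc n)..real (Suc n)} t) \<partial>lborel)"
    by (intro nn_integral_mono)
  also have "\<dots> \<le> liminf (\<lambda>n. \<integral>\<^sup>+t. g t * indicator {1 / real (Suc n)..real (Suc n)} t \<partial>lborel)"
    by (intro nn_integral_liminf) measurable
  also have "\<dots> \<le> liminf (\<lambda>n. C)"
    by (intro Liminf_mono always_eventually allI assms)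
  finally show ?thesis by (simp add: Liminf_const)
qed

lemma continuous_on_if_lipschitz:
  fixes g :: "real \<Rightarrow> real"
  assumes "\<And>t t'. \<bar>g t - g t'\<bar> \<le> L * \<bar>t - t'\<bar>"
  shows "continuous_on S g"
proof -
  have "0 \<le> L" using assms[of 1 0] by simp
  then have "L-lipschitz_on S g" using assms by (intro lipschitz_onI) (auto simp: dist_real_def)
  then show ?thesis by (rule lipschitz_on_continuous_on)
qed

lemma integrable_bounded_mult:
  fixes g k :: "real \<Rightarrow> real"
  assumes "integrable lborel g" "k \<in> borel_measurable borel" "\<And>u. \<bar>k u\<bar> \<le> C"
  shows "integrable lborel (\<lambda>u. k u * g u)"
proof (rule Bochner_Integration.integrable_bound[of _ "\<lambda>u. C * g u"])
  have "\<bar>k u * g u\<bar> \<le> \<bar>C * g u\<bar>" for u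
    using assms(3)[of u] by (auto simp: abs_mult intro!: mult_right_mono)
  then show "AE u in lborel. norm (k u * g u) \<le> norm (C * g u)" by simp
qed (use assms borel_measurable_integrable[OF assms(1)] in auto)

text \<open>\<open>A\<close> is bounded on the compact interval, so a multiple of a reflected
  translate of \<open>G\<close> dominates the product, even when \<open>G\<close> is
  unbounded.\<close>

lemma set_integrable_convolution:
  fixes A G :: "real \<Rightarrow> real"
  assumes A: "continuous_on {a..b} A" and G: "integrable lborel G"
  shows "set_integrable lborel {a..b} (\<lambda>t. A t * G (v - t))"
proof -
  have "compact (A ` {a..b})" by (intro compact_continuous_image A) simp
  then have "bounded (A ` {a..b})" by (rule compact_imp_bounded)
  then obtain C where "\<forall>y\<in>A ` {a..b}. norm y \<le> C" using bounded_iff by blast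
  then have C: "\<And>t. t \<in> {a..b} \<Longrightarrow> \<bar>A t\<bar> \<le> C" by auto
  have shift: "integrable lborel (\<lambda>t. G (v - t))"
    using lborel_integrable_real_affine[OF G, of "-1" v] by simp
  note [measurable] = borel_measurable_integrable[OF G]
  have [measurable]: "(\<lambda>t. indicator {a..b} t * A t) \<in> borel_measurable borel"
    using borel_measurable_continuous_on_indicator[OF _ A] by simp
  have "integrable lborel (\<lambda>t. (indicator {a..b} t * A t) * G (v - t))"
  proof (rule Bochner_Integration.integrable_bound[OF integrable_mult_right[OF shift, of C]])
    have "\<bar>(indicator {a..b} t * A t) * G (v - t)\<bar> \<le> \<bar>C * G (v - t)\<bar>" for t
      using C[of t] by (auto simp: indicator_def abs_mult intro!: mult_right_mono)
    then show "AE t in lborel. norm ((indicator {a..b} t * A t) * G (v - t)) \<le> norm (C * G (v - t))" by simp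
  qed measurable
  then show ?thesis by (simp add: set_integrable_def mult_ac)
qed

subsection \<open>Hitting times of curves\<close>

context linear_diffusion
begin

sublocale F: filtration "space M" "natural_filtration M X"
  by (rule filtration_natural_filtration)

lemma sets_natural_filtration:
  "sets (natural_filtration M X t) =
     sigma_sets (space M) {X r -` B \<inter> space M | r B. 0 \<le> r \<and> r \<le> t \<and> B \<in> sets borel}"
  unfolding natural_filtration_def by (rule sets_measure_of) auto

lemma sets_natural_filtration_subset: "sets (natural_filtration M X t) \<subseteq> sets M"
  unfolding sets_natural_filtration
  by (rule sets.sigma_sets_subset) (use measurable_X in \<open>auto intro: measurable_sets\<close>)

lemma measurable_natural_filtration:
  assumes "0 \<le> r" "r \<le> t"
  shows "X r \<in> borel_measurable (natural_filtration M X t)"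
proof (rule measurableI)
  fix B :: "real set" assume "B \<in> sets borel"
  then show "X r -` B \<inter> space (natural_filtration M X t) \<in> sets (natural_filtration M X t)"
    using assms unfolding sets_natural_filtration F.space_F by (intro sigma_sets.Basic) auto
qed simp

definition hits :: "(real \<Rightarrow> real) \<Rightarrow> real \<Rightarrow> real \<Rightarrow> 'w set" where
  "hits g a b = {\<omega> \<in> space M. \<exists>u\<in>{a..b}. X u \<omega> = g u}"

lemma continuous_X: "\<omega> \<in> space M \<Longrightarrow> 0 \<le> a \<Longrightarrow> continuous_on {a..b} (\<lambda>t. X t \<omega>)"
  using continuous_paths[of \<omega>] by (rule continuous_on_subset) auto

text \<open>Contact with a continuous curve during \<open>[a, b]\<close> is a closed condition on a
  continuous path, hence decided by countably many times up to \<open>b\<close>. The natural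
  filtration can therefore be used as it is, neither completed nor made right-continuous.\<close>

lemma hits_in_filtration:
  assumes a: "0 \<le> a" and g: "continuous_on {a..b} g"
  shows "hits g a b \<in> sets (natural_filtration M X b)"
proof (cases "a \<le> b")
  case True
  let ?D = "{p :: real. p \<in> \<rat> \<and> 0 \<le> p \<and> p \<le> 1}"
  have D: "countable ?D" by (rule countable_subset[OF _ countable_rat]) auto
  have iff: "(\<exists>u\<in>{a..b}. X u \<omega> = g u) \<longleftrightarrow>
     (\<forall>n. \<exists>p\<in>?D. \<bar>X (a + (b - a) * p) \<omega> - g (a + (b - a) * p)\<bar> < 1 / real (Suc n))" if "\<omega> \<in> space M" for \<omega>
    using zero_in_Icc_iff[of a b "\<lambda>u. X u \<omega> - g u"] continuous_X[OF that a] g True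
    by (simp add: continuous_on_diff)
  have eq: "hits g a b = (\<Inter>n. \<Union>p\<in>?D. {\<omega> \<in> space (natural_filtration M X b). \<bar>X (a + (b - a) * p) \<omega> - g (a + (b - a) * p)\<bar> < 1 / real (Suc n)})"
  proof (rule set_eqI)
    fix \<omega>
    have "\<omega> \<in> hits g a b \<longleftrightarrow> \<omega> \<in> space M \<and>
       (\<forall>n. \<exists>p\<in>?D. \<bar>X (a + (b - a) * p) \<omega> - g (a + (b - a) * p)\<bar> < 1 / real (Suc n))"
      unfolding hits_def mem_Collect_eq using iff by (rule conj_cong[OF refl])
    also have "\<dots> \<longleftrightarrow> \<omega> \<in> (\<Inter>n. \<Union>p\<in>?D. {\<omega> \<in> space (natural_filtration M X b). \<bar>X (a + (b - a) * p) \<omega> - g (a + (b - a) * p)\<bar> < 1 / real (Suc n)})"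
      unfolding F.space_F by (simp only: INT_iff UN_iff mem_Collect_eq) blast
    finally show "\<omega> \<in> hits g a b \<longleftrightarrow> \<omega> \<in> (\<Inter>n. \<Union>p\<in>?D. {\<omega> \<in> space (natural_filtration M X b). \<bar>X (a + (b - a) * p) \<omega> - g (a + (b - a) * p)\<bar> < 1 / real (Suc n)})" .
  qed
  have "{\<omega> \<in> space (natural_filtration M X b). \<bar>X (a + (b - a) * p) \<omega> - g (a + (b - a) * p)\<bar> < 1 / real (Suc n)} \<in> sets (natural_filtration M X b)"
    if "p \<in> ?D" for p n
  proof -
    have "(b - a) * p \<le> (b - a) * 1" "0 \<le> (b - a) * p"
      using that True by (intro mult_left_mono mult_nonneg_nonneg; simp)+
    then have [measurable]: "X (a + (b - a) * p) \<in> borel_measurable (natural_filtration M X b)"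
      using a by (intro measurable_natural_filtration) auto
    show ?thesis by measurable
  qed
  then show ?thesis
    unfolding eq using D by (intro sets.countable_INT' sets.countable_UN') auto
next
  case False
  then have "hits g a b = {}" by (auto simp: hits_def)
  then show ?thesis by simp
qed

lemma hits_measurable: "0 \<le> a \<Longrightarrow> continuous_on {a..b} g \<Longrightarrow> hits g a b \<in> sets M"
  using hits_in_filtration sets_natural_filtration_subset by blast

lemma hits_from_eq: "{\<omega> \<in> space M. \<exists>u\<ge>a. X u \<omega> = g u} = (\<Union>n. hits g a (real n))"
proof (intro set_eqI iffI)
  fix \<omega> assume "\<omega> \<in> {\<omega> \<in> space M. \<exists>u\<ge>a. X u \<omega> = g u}"
  then obtain u where "\<omega> \<in> space M" "a \<le> u" "X u \<omega> = g u" by auto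
  moreover obtain n where "u \<le> real n" using real_arch_simple by blast
  ultimately show "\<omega> \<in> (\<Union>n. hits g a (real n))"
    by (auto simp: hits_def intro!: exI[of _ n] bexI[of _ u])
qed (auto simp: hits_def)

lemma hits_from_measurable:
  assumes "0 \<le> a" "continuous_on {a..} g"
  shows "{\<omega> \<in> space M. \<exists>u\<ge>a. X u \<omega> = g u} \<in> sets M"
proof -
  have "hits g a (real n) \<in> sets M" for n
    by (rule hits_measurable[OF assms(1) continuous_on_subset[OF assms(2)]]) auto
  then show ?thesis unfolding hits_from_eq by (intro sets.countable_UN) auto
qed

lemma space_P: "0 < x \<Longrightarrow> space (P x) = space M"
  using sets_P sets_eq_imp_space_eq by metis

lemma hits_if_eventually_above:
  assumes \<omega>: "\<omega> \<in> space M" "filterlim (\<lambda>t. X t \<omega>) at_top at_top"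
    and g: "continuous_on {a..} g" "\<And>u. a \<le> u \<Longrightarrow> g u \<le> K" and a: "0 \<le> a" "X a \<omega> \<le> g a"
  shows "\<exists>u\<ge>a. X u \<omega> = g u"
proof -
  have "eventually (\<lambda>t. K \<le> X t \<omega> \<and> a \<le> t) at_top"
    using \<omega>(2) eventually_ge_at_top[of a] by (auto simp: filterlim_at_top intro: eventually_conj)
  then obtain t where t: "K \<le> X t \<omega>" "a \<le> t" by (auto dest: eventually_happens)
  have "\<exists>u. a \<le> u \<and> u \<le> t \<and> X u \<omega> - g u = 0"
  proof (rule IVT')
    show "continuous_on {a..t} (\<lambda>u. X u \<omega> - g u)"
      by (intro continuous_intros continuous_X \<omega> a continuous_on_subset[OF g(1)]) auto
  qed (use t g(2)[of t] a in auto)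
  then show ?thesis by auto
qed

text \<open>Continuity of the paths makes \<open>X\<close> a limit of its values at the grid times
  below \<open>t\<close>, of which there are countably many for each mesh. The \<open>max 0\<close>
  avoids negative times, about which nothing is assumed.\<close>

lemma X_joint_measurable:
  "(\<lambda>p. X (max 0 (fst p)) (snd p)) \<in> borel_measurable (borel \<Otimes>\<^sub>M M)"
proof (rule borel_measurable_LIMSEQ_real)
  define k :: "nat \<Rightarrow> real \<Rightarrow> real" where "k n t = real_of_int \<lfloor>real (Suc n) * t\<rfloor> / real (Suc n)" for n t
  have k: "(\<lambda>n. k n t) \<longlonglongrightarrow> t" for t
  proof (rule tendsto_sandwich)
    show "eventually (\<lambda>n. t - 1 / real (Suc n) \<le> k n t) sequentially"
    proof (intro always_eventually allI)
      fix n
      have "real (Suc n) * t - 1 \<le> real_of_int \<lfloor>real (Suc n) * t\<rfloor>" by linarith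
      then have "(real (Suc n) * t - 1) / real (Suc n) \<le> k n t"
        unfolding k_def by (intro divide_right_mono) auto
      then show "t - 1 / real (Suc n) \<le> k n t" by (simp add: diff_divide_distrib)
    qed
    show "eventually (\<lambda>n. k n t \<le> t) sequentially"
    proof (intro always_eventually allI)
      fix n
      have "real_of_int \<lfloor>real (Suc n) * t\<rfloor> / real (Suc n) \<le> (real (Suc n) * t) / real (Suc n)"
        by (intro divide_right_mono of_int_floor_le) auto
      then show "k n t \<le> t" by (simp add: k_def)
    qed
    have "(\<lambda>n. t - 1 / real (Suc n)) \<longlonglongrightarrow> t - 0"
      by (intro tendsto_intros LIMSEQ_Suc[OF lim_1_over_n])
    then show "(\<lambda>n. t - 1 / real (Suc n)) \<longlonglongrightarrow> t" by simp
  qed simp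
  show "(\<lambda>p. X (max 0 (k n (fst p))) (snd p)) \<in> borel_measurable (borel \<Otimes>\<^sub>M M)" for n
  proof -
    have "(\<lambda>p. X (max 0 (real_of_int i / real (Suc n))) (snd p)) \<in> borel_measurable (borel \<Otimes>\<^sub>M M)" for i
      by (rule measurable_compose[OF measurable_snd measurable_X]) simp
    moreover have "(\<lambda>p. \<lfloor>real (Suc n) * fst p\<rfloor>) \<in> measurable (borel \<Otimes>\<^sub>M M) (count_space UNIV)"
      by measurable
    ultimately show ?thesis
      unfolding k_def by (rule measurable_compose_countable)
  qed
  show "(\<lambda>n. X (max 0 (k n (fst p))) (snd p)) \<longlonglongrightarrow> X (max 0 (fst p)) (snd p)"
    if "p \<in> space (borel \<Otimes>\<^sub>M M)" for p
  proof (rule continuous_on_tendsto_compose[OF continuous_paths])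
    show "snd p \<in> space M" using that by (auto simp: space_pair_measure)
    show "(\<lambda>n. max 0 (k n (fst p))) \<longlonglongrightarrow> max 0 (fst p)"
      by (intro tendsto_intros k)
  qed auto
qed

lemma X_measurable_compose:
  assumes "f \<in> borel_measurable N" "g \<in> measurable N M" "\<And>a. a \<in> space N \<Longrightarrow> 0 \<le> f a"
  shows "(\<lambda>a. X (f a) (g a)) \<in> borel_measurable N"
proof -
  have "(\<lambda>a. (f a, g a)) \<in> N \<rightarrow>\<^sub>M borel \<Otimes>\<^sub>M M" using assms by simp
  from measurable_compose[OF this X_joint_measurable]
  have "(\<lambda>a. X (max 0 (f a)) (g a)) \<in> borel_measurable N" by simp
  then show ?thesis
    by (rule measurable_cong[THEN iffD1, rotated]) (use assms(3) in simp)
qed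

lemma stopping_time_measurable:
  "stopping_time (natural_filtration M X) T \<Longrightarrow> T \<in> borel_measurable M"
  by (rule measurable_stopping_time[where F = "natural_filtration M X"]) (auto simp: F.space_F intro: subsetD[OF sets_natural_filtration_subset])

lemma pre_sigma_subset:
  assumes T: "stopping_time (natural_filtration M X) T" and A: "A \<in> sets (F.pre_sigma T)"
  shows "A \<in> sets M"
proof -
  have "A = (\<Union>n. {\<omega> \<in> A. T \<omega> \<le> real n})" using real_arch_simple by fast
  moreover have "{\<omega> \<in> A. T \<omega> \<le> real n} \<in> sets M" for n
    using F.sets_pre_sigmaD[OF T A] sets_natural_filtration_subset by blast
  ultimately show ?thesis by (metis (no_types, lifting) sets.countable_UN image_subset_iff)
qed

text \<open>Capped at the horizon \<open>b\<close>, because the strong Markov property is assumed at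
  finite stopping times. The value \<open>b\<close> alone does not tell whether there was a contact;
  membership in \<open>hits\<close> records that.\<close>

definition first_hit :: "(real \<Rightarrow> real) \<Rightarrow> real \<Rightarrow> real \<Rightarrow> 'w \<Rightarrow> real" where
  "first_hit g a b \<omega> = (if \<omega> \<in> hits g a b then Inf {u \<in> {a..b}. X u \<omega> = g u} else b)"

lemma first_hit_attained:
  assumes a: "0 \<le> a" and g: "continuous_on {a..b} g" and \<omega>: "\<omega> \<in> hits g a b"
  shows "first_hit g a b \<omega> \<in> {a..b}" "X (first_hit g a b \<omega>) \<omega> = g (first_hit g a b \<omega>)"
    and "\<And>u. u \<in> {a..b} \<Longrightarrow> X u \<omega> = g u \<Longrightarrow> first_hit g a b \<omega> \<le> u"
proof -
  let ?S = "{u \<in> {a..b}. X u \<omega> = g u}"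
  have "\<omega> \<in> space M" using \<omega> by (simp add: hits_def)
  then have "continuous_on {a..b} (\<lambda>u. X u \<omega> - g u)"
    by (intro continuous_intros continuous_X a g)
  then have "closed {u \<in> {a..b}. X u \<omega> - g u = 0}"
    by (rule continuous_closed_preimage_constant) simp
  then have cl: "closed ?S" by simp
  have ne: "?S \<noteq> {}" using \<omega> by (auto simp: hits_def)
  have bd: "bdd_below ?S" by (rule bdd_belowI[of _ a]) auto
  have eq: "first_hit g a b \<omega> = Inf ?S" using \<omega> by (simp add: first_hit_def)
  have "Inf ?S \<in> ?S" by (rule closed_contains_Inf[OF ne bd cl])
  then show "first_hit g a b \<omega> \<in> {a..b}" "X (first_hit g a b \<omega>) \<omega> = g (first_hit g a b \<omega>)"
    by (simp_all add: eq)
  show "first_hit g a b \<omega> \<le> u" if "u \<in> {a..b}" "X u \<omega> = g u" for u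
    unfolding eq using that by (intro cInf_lower bd) auto
qed

lemma first_hit_bounds:
  assumes "0 \<le> a" "a \<le> b" "continuous_on {a..b} g"
  shows "a \<le> first_hit g a b \<omega>" "first_hit g a b \<omega> \<le> b"
  using first_hit_attained(1)[OF assms(1,3), of \<omega>] assms(2) by (auto simp: first_hit_def)

text \<open>The contact times form a closed set, so the infimum is attained. The bound
  \<open>u < b\<close> keeps the default value \<open>b\<close> out.\<close>

lemma first_hit_le_iff:
  assumes a: "0 \<le> a" and g: "continuous_on {a..b} g" and u: "u < b"
  shows "first_hit g a b \<omega> \<le> u \<longleftrightarrow> \<omega> \<in> hits g a u"
proof
  assume le: "first_hit g a b \<omega> \<le> u"
  then have \<omega>: "\<omega> \<in> hits g a b" using u by (auto simp: first_hit_def split: if_splits)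
  then show "\<omega> \<in> hits g a u"
    using first_hit_attained(1,2)[OF a g \<omega>] le by (auto simp: hits_def)
next
  assume "\<omega> \<in> hits g a u"
  then obtain v where v: "\<omega> \<in> space M" "v \<in> {a..u}" "X v \<omega> = g v" by (auto simp: hits_def)
  then have "\<omega> \<in> hits g a b" using u by (auto simp: hits_def)
  from first_hit_attained(3)[OF a g this, of v] show "first_hit g a b \<omega> \<le> u" using v u by auto
qed

lemma stopping_time_first_hit:
  assumes a: "0 \<le> a" "a \<le> b" and g: "continuous_on {a..b} g"
  shows "stopping_time (natural_filtration M X) (first_hit g a b)"
proof
  fix u
  show "Measurable.pred (natural_filtration M X u) (\<lambda>\<omega>. first_hit g a b \<omega> \<le> u)"
  proof (cases "u < b")
    case True
    have "{\<omega> \<in> space (natural_filtration M X u). first_hit g a b \<omega> \<le> u} = hits g a u"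
      unfolding first_hit_le_iff[OF a(1) g True] F.space_F by (auto simp: hits_def)
    also have "\<dots> \<in> sets (natural_filtration M X u)"
      by (rule hits_in_filtration[OF a(1)]) (rule continuous_on_subset[OF g], use True in auto)
    finally show ?thesis by (simp add: pred_def)
  next
    case False
    then have "first_hit g a b \<omega> \<le> u" for \<omega>
      using first_hit_bounds(2)[OF a g, of \<omega>] by simp
    then show ?thesis by simp
  qed
qed

text \<open>To get below the curve the path has to meet it. Such a contact is not earlier than the
  first one, so it would take place at \<open>v\<close> itself, where the path is assumed to be
  strictly below.\<close>

lemma above_before_first_hit:
  assumes a: "0 \<le> a" "a \<le> b" and g: "continuous_on {a..b} g" and \<omega>: "\<omega> \<in> space M" "g a < X a \<omega>"
    and v: "a \<le> v" "v \<le> first_hit g a b \<omega>"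
  shows "g v \<le> X v \<omega>"
proof (rule ccontr)
  assume "\<not> g v \<le> X v \<omega>"
  then have lt: "X v \<omega> < g v" by simp
  have vb: "v \<le> b" using v first_hit_bounds(2)[OF a g, of \<omega>] by simp
  have "\<exists>u. a \<le> u \<and> u \<le> v \<and> g u - X u \<omega> = 0"
  proof (rule IVT')
    show "continuous_on {a..v} (\<lambda>u. g u - X u \<omega>)"
      by (intro continuous_intros continuous_X \<omega> a continuous_on_subset[OF g]) (use vb in auto)
  qed (use lt \<omega> v in auto)
  then obtain u where u: "a \<le> u" "u \<le> v" "X u \<omega> = g u" by auto
  have h: "\<omega> \<in> hits g a b" using u vb \<omega> by (auto simp: hits_def)
  have "first_hit g a b \<omega> \<le> u" using first_hit_attained(3)[OF a(1) g h, of u] u vb by auto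
  then have "u = v" using u v by simp
  then show False using u lt by simp
qed

text \<open>With \<open>B\<close> the half-line above the curve, this is the event on which the
  strong Markov property is used at the first contact. From time \<open>b\<close> on, the default
  value makes the condition on \<open>first_hit\<close> void, which is the third case.\<close>

lemma first_hit_pre_sigma:
  assumes a: "0 \<le> a" "a \<le> b" and g: "continuous_on {a..b} g" and B: "B \<in> sets borel"
  shows "{\<omega> \<in> hits g a b. X a \<omega> \<in> B} \<in> sets (F.pre_sigma (first_hit g a b))"
proof (rule F.sets_pre_sigmaI[OF stopping_time_first_hit[OF a g]])
  fix u
  have Xa: "{\<omega> \<in> space (natural_filtration M X c). X a \<omega> \<in> B} \<in> sets (natural_filtration M X c)" if "a \<le> c" for c
    using measurable_natural_filtration[OF a(1) that] B by measurable
  consider "u < a" | "a \<le> u" "u < b" | "b \<le> u" by linarith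
  then show "{\<omega> \<in> {\<omega> \<in> hits g a b. X a \<omega> \<in> B}. first_hit g a b \<omega> \<le> u} \<in> sets (natural_filtration M X u)"
  proof cases
    case 1
    then have "\<not> first_hit g a b \<omega> \<le> u" for \<omega>
      using first_hit_bounds(1)[OF a g, of \<omega>] by simp
    then have "{\<omega> \<in> {\<omega> \<in> hits g a b. X a \<omega> \<in> B}. first_hit g a b \<omega> \<le> u} = {}" by simp
    then show ?thesis by (simp only: sets.empty_sets)
  next
    case 2
    then have "{\<omega> \<in> {\<omega> \<in> hits g a b. X a \<omega> \<in> B}. first_hit g a b \<omega> \<le> u}
       = hits g a u \<inter> {\<omega> \<in> space (natural_filtration M X u). X a \<omega> \<in> B}"
      unfolding first_hit_le_iff[OF a(1) g 2(2)] F.space_F by (auto simp: hits_def)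
    also have "\<dots> \<in> sets (natural_filtration M X u)"
      by (intro sets.Int Xa hits_in_filtration a 2 continuous_on_subset[OF g]) (use 2 in auto)
    finally show ?thesis .
  next
    case 3
    then have "{\<omega> \<in> {\<omega> \<in> hits g a b. X a \<omega> \<in> B}. first_hit g a b \<omega> \<le> u}
       = hits g a b \<inter> {\<omega> \<in> space (natural_filtration M X u). X a \<omega> \<in> B}"
      using first_hit_bounds(2)[OF a g] unfolding F.space_F by (auto simp: hits_def intro: order_trans)
    also have "\<dots> \<in> sets (natural_filtration M X u)"
      using hits_in_filtration[OF a(1) g] F.sets_F_mono[OF 3] a 3 by (intro sets.Int Xa) auto
    finally show ?thesis .
  qed
qed

lemma const_pre_sigma:
  assumes "0 \<le> a" and B: "B \<in> sets borel"
  shows "{\<omega> \<in> space M. X a \<omega> \<in> B} \<in> sets (F.pre_sigma (\<lambda>_. a))"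
proof (rule F.sets_pre_sigmaI[OF stopping_time_const])
  fix u
  show "{\<omega> \<in> {\<omega> \<in> space M. X a \<omega> \<in> B}. a \<le> u} \<in> sets (natural_filtration M X u)"
  proof (cases "a \<le> u")
    case True
    have "{\<omega> \<in> space (natural_filtration M X u). X a \<omega> \<in> B} \<in> sets (natural_filtration M X u)"
      using measurable_natural_filtration[OF assms(1) True] B by measurable
    then show ?thesis using True by (simp add: F.space_F)
  qed simp
qed

end

subsection \<open>Speed measure and scale near \<open>0\<close>\<close>

locale entrance_diffusion = linear_diffusion M P X
  for M :: "'w measure" and P :: "real \<Rightarrow> 'w measure" and X :: "real \<Rightarrow> 'w \<Rightarrow> real" +
  fixes s \<rho> :: "real \<Rightarrow> real" and q :: "real \<Rightarrow> real \<Rightarrow> real \<Rightarrow> real"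
  assumes scale: "scale_function M P X s" "C2 s" "\<And>y. 0 < y \<Longrightarrow> 0 < deriv s y"
    and rho: "set_borel_measurable borel {0<..} \<rho>" "\<And>y. 0 < y \<Longrightarrow> 0 < \<rho> y"
    and speed: "speed_measure M P X s (halfline_measure \<rho>)"
    and entrance_not_exit_0: "entrance_at_0 s (halfline_measure \<rho>)"
      "\<not> exit_at_0 s (halfline_measure \<rho>)"
    and transience: "transient M P X"
      "\<And>y. 0 < y \<Longrightarrow> AE \<omega> in P y. filterlim (\<lambda>t. X t \<omega>) at_top at_top"
    and density: "transition_density M P X (halfline_measure \<rho>) q"
    and smooth: "C122 q" "C12 (\<lambda>t y. q t y 0)"
    and kolmogorov: "\<And>t y z. 0 < t \<Longrightarrow> 0 < y \<Longrightarrow> 0 \<le> z \<Longrightarrow>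
      generator \<rho> s (\<lambda>v. q t v z) y = deriv (\<lambda>r. q r y z) t"
    and q_small_time: "\<And>y. 0 < y \<Longrightarrow> ((\<lambda>t. q t y 0) \<longlongrightarrow> 0) (at_right 0)"
    and q_decreasing: "\<And>t. 0 < t \<Longrightarrow> antimono_on {0<..} (\<lambda>y. q t y 0)"
    and q_vanishing: "\<And>t. 0 < t \<Longrightarrow> ((\<lambda>y. q t y 0) \<longlongrightarrow> 0) at_top"
begin

abbreviation m :: "real measure" where "m \<equiv> halfline_measure \<rho>"

lemma scale_has_derivative: "0 < y \<Longrightarrow> (s has_real_derivative deriv s y) (at y)"
  using scale(2) by (auto simp: C2_def intro: DERIV_deriv_iff_field_differentiable[THEN iffD2])

lemma deriv_scale_has_derivative: "0 < y \<Longrightarrow> (deriv s has_real_derivative deriv (deriv s) y) (at y)"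
  using scale(2) by (auto simp: C2_def intro: DERIV_deriv_iff_field_differentiable[THEN iffD2])

lemma continuous_deriv_scale: "continuous_on {0<..} (deriv s)"
  by (intro continuous_at_imp_continuous_on) (auto intro!: DERIV_isCont deriv_scale_has_derivative)

lemma continuous_deriv2_scale: "continuous_on {0<..} (deriv (deriv s))"
  using scale(2) by (simp add: C2_def)

lemma scale_less: "0 < x \<Longrightarrow> x < y \<Longrightarrow> s x < s y"
  using scale(1) by (auto simp: scale_function_def strict_mono_on_def)

lemma scale_le: "0 < x \<Longrightarrow> x \<le> y \<Longrightarrow> s x \<le> s y"
  using scale_less[of x y] by (cases "x = y") auto

text \<open>\<open>\<rho>\<close> is measurable on the half-line only; cutting it off gives a Borel
  density of \<open>m\<close> on the whole line.\<close>

definition rho_pos :: "real \<Rightarrow> real" where "rho_pos y = indicator {0<..} y * \<rho> y"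

lemma rho_pos_measurable [measurable]: "rho_pos \<in> borel_measurable borel"
  using rho(1) unfolding set_borel_measurable_def rho_pos_def[abs_def] by simp

lemma rho_pos_nonneg: "0 \<le> rho_pos y"
  using rho(2) by (auto simp: rho_pos_def indicator_def less_imp_le)

lemma m_eq: "m = density lborel (\<lambda>y. ennreal (rho_pos y))"
  unfolding halfline_measure_def rho_pos_def
  by (intro arg_cong[where f = "density lborel"]) (auto simp: indicator_def fun_eq_iff)

lemma sets_m [simp, measurable_cong]: "sets m = sets borel"
  by (simp add: m_eq)

lemma space_m [simp]: "space m = UNIV"
  by (simp add: m_eq)

lemma nn_integral_m:
  "g \<in> borel_measurable borel \<Longrightarrow> (\<integral>\<^sup>+y. g y \<partial>m) = (\<integral>\<^sup>+y. ennreal (rho_pos y) * g y \<partial>lborel)"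
  unfolding m_eq by (subst nn_integral_density) auto

lemma sigma_finite_m: "sigma_finite_measure m"
  unfolding m_eq by (subst sigma_finite_measure.sigma_finite_iff_density_finite[OF sigma_finite_lborel]) auto

sublocale m: sigma_finite_measure m
  by (rule sigma_finite_m)

lemma AE_m_pos: "AE y in m. 0 < y"
proof -
  have "AE y in lborel. 0 < ennreal (rho_pos y) \<longrightarrow> 0 < y"
    by (auto simp: rho_pos_def split: split_indicator_asm)
  then show ?thesis unfolding m_eq by (subst AE_density) auto
qed

text \<open>The entrance condition makes \<open>s z - s a\<close> integrable near \<open>0\<close>,
  and this function is bounded away from \<open>0\<close> for \<open>a \<le> z/2\<close>. Away from
  \<open>0\<close>, \<open>m\<close> is locally finite.\<close>

lemma emeasure_m_Ioc_finite: "emeasure m {0<..y} < \<infinity>"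
proof (cases "0 < y")
  case True
  obtain z where z: "0 < z" "(\<integral>\<^sup>+a\<in>{0<..<z}. ennreal (s z - s a) \<partial>m) < \<infinity>"
    using entrance_not_exit_0(1) by (auto simp: entrance_at_0_def)
  define c where "c = s z - s (z/2)"
  have c: "0 < c" using scale_less[of "z/2" z] z by (simp add: c_def)
  have "ennreal c * emeasure m {0<..z/2} = (\<integral>\<^sup>+a. ennreal c * indicator {0<..z/2} a \<partial>m)"
    by (simp add: nn_integral_cmult)
  also have "\<dots> \<le> (\<integral>\<^sup>+a\<in>{0<..<z}. ennreal (s z - s a) \<partial>m)"
    using z scale_le[of _ "z/2"]
    by (intro nn_integral_mono) (auto simp: indicator_def c_def intro!: ennreal_leI)
  finally have "ennreal c * emeasure m {0<..z/2} < \<infinity>" using z(2) by order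
  then have fin: "emeasure m {0<..z/2} < \<infinity>"
    using c by (auto simp: ennreal_mult_less_top)
  have fin2: "emeasure m {z/2..max z y} < \<infinity>"
    using speed z(1) by (auto simp: speed_measure_def)
  have "emeasure m {0<..y} \<le> emeasure m ({0<..z/2} \<union> {z/2..max z y})"
    by (intro emeasure_mono) auto
  also have "\<dots> \<le> emeasure m {0<..z/2} + emeasure m {z/2..max z y}"
    by (intro emeasure_subadditive) auto
  also have "\<dots> < \<infinity>" using fin fin2 by simp
  finally show ?thesis .
next
  case False
  then have "{0<..y} = {}" by auto
  then show ?thesis by simp
qed

text \<open>If \<open>s\<close> were bounded below, the measure \<open>s'(a) da\<close> would be
  finite near \<open>0\<close>. As \<open>m\<close> is finite there too, Feller's exit integral
  would converge.\<close>

lemma scale_unbounded_below: "\<exists>y>0. s y < K"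
proof (rule ccontr)
  assume "\<not> ?thesis"
  then have K: "\<And>y. 0 < y \<Longrightarrow> K \<le> s y" by force
  define d where "d a = indicator {0<..} a *\<^sub>R deriv s a" for a
  have d_meas [measurable]: "d \<in> borel_measurable borel"
    unfolding d_def by (rule borel_measurable_continuous_on_indicator) (auto simp: continuous_deriv_scale)
  have lim: "ennreal (d a) * indicator {0<..<1} a
      \<le> liminf (\<lambda>n. ennreal (d a) * indicator {1/real (Suc n)..1} a)" for a
  proof (cases "0 < a \<and> a < 1")
    case True
    have "(\<lambda>n. 1 / real (Suc n)) \<longlonglongrightarrow> 0" by (rule LIMSEQ_Suc[OF lim_1_over_n])
    then have "eventually (\<lambda>n. 1 / real (Suc n) < a) sequentially"
      using True by (auto dest: order_tendstoD)
    then have "eventually (\<lambda>n. ennreal (d a) * indicator {0<..<1} a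
      \<le> ennreal (d a) * indicator {1/real (Suc n)..1} a) sequentially"
      by (rule eventually_mono) (use True in simp)
    then show ?thesis by (rule Liminf_bounded)
  qed simp
  have bd: "(\<integral>\<^sup>+a. ennreal (d a) * indicator {1/real (Suc n)..1} a \<partial>lborel) \<le> ennreal (s 1 - K)" for n
  proof -
    have p: "0 < 1 / real (Suc n)" by simp
    have "(\<integral>\<^sup>+a. ennreal (d a) * indicator {1/real (Suc n)..1} a \<partial>lborel) = ennreal (s 1 - s (1 / real (Suc n)))"
    proof (rule nn_integral_FTC_Icc)
      fix x assume "x \<in> {1/real (Suc n)..1}"
      then have "0 < x" using less_le_trans[OF p, of x] by simp
      then show "(s has_real_derivative d x) (at x)" "0 \<le> d x"
        using scale(3)[of x] by (auto simp: d_def intro!: scale_has_derivative)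
    qed (simp_all add: d_meas)
    also have "\<dots> \<le> ennreal (s 1 - K)" using K[OF p] by (intro ennreal_leI) auto
    finally show ?thesis .
  qed
  have "(\<integral>\<^sup>+a. ennreal (d a) * indicator {0<..<1} a \<partial>lborel)
      \<le> (\<integral>\<^sup>+a. liminf (\<lambda>n. ennreal (d a) * indicator {1/real (Suc n)..1} a) \<partial>lborel)"
    by (intro nn_integral_mono lim)
  also have "\<dots> \<le> liminf (\<lambda>n. \<integral>\<^sup>+a. ennreal (d a) * indicator {1/real (Suc n)..1} a \<partial>lborel)"
    by (intro nn_integral_liminf) measurable
  also have "\<dots> \<le> liminf (\<lambda>n. ennreal (s 1 - K))"
    by (intro Liminf_mono always_eventually allI bd)
  finally have fin: "(\<integral>\<^sup>+a. ennreal (d a) * indicator {0<..<1} a \<partial>lborel) \<le> ennreal (s 1 - K)"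
    by (simp add: Liminf_const)
  have "(\<integral>\<^sup>+a\<in>{0<..<1}. emeasure m {a<..<1} * ennreal (deriv s a) \<partial>lborel)
     \<le> (\<integral>\<^sup>+a. emeasure m {0<..1} * (ennreal (d a) * indicator {0<..<1} a) \<partial>lborel)"
    by (intro nn_integral_mono) (auto simp: indicator_def d_def intro!: mult_right_mono emeasure_mono)
  also have "\<dots> = emeasure m {0<..1} * (\<integral>\<^sup>+a. ennreal (d a) * indicator {0<..<1} a \<partial>lborel)"
    by (intro nn_integral_cmult) measurable
  also have "\<dots> < \<infinity>"
    using fin emeasure_m_Ioc_finite[of 1] by (auto simp: ennreal_mult_less_top intro: le_less_trans)
  finally have "exit_at_0 s m"
    unfolding exit_at_0_def by (intro exI[of _ 1]) auto
  with entrance_not_exit_0(2) show False by simp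
qed

subsection \<open>Green's formula\<close>

text \<open>\<open>k = 1\<close> is the forward equation, in which the time derivative equals the
  generator, and \<open>k = -1\<close> the backward one. Time derivatives are one-sided at the end
  points. Continuity is demanded of \<open>\<rho> y * ut t y\<close>, because \<open>\<rho>\<close>
  is merely measurable and only the product enters the equation.\<close>

definition parabolic ::
  "real \<Rightarrow> real \<Rightarrow> real \<Rightarrow> (real \<Rightarrow> real \<Rightarrow> real) \<Rightarrow> (real \<Rightarrow> real \<Rightarrow> real) \<Rightarrow> (real \<Rightarrow> real \<Rightarrow> real) \<Rightarrow> bool"
where
  "parabolic k a b u ut uy \<longleftrightarrow>
     (\<forall>t\<in>{a..b}. \<forall>y>0. ((\<lambda>r. u r y) has_real_derivative ut t y) (at t within {a..b}) \<and>
        (u t has_real_derivative uy t y) (at y) \<and>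
        ((\<lambda>z. uy t z / deriv s z) has_real_derivative \<rho> y * (k * ut t y)) (at y)) \<and>
     continuous_on ({a..b} \<times> {0<..}) (\<lambda>(t, y). u t y) \<and>
     continuous_on ({a..b} \<times> {0<..}) (\<lambda>(t, y). uy t y) \<and>
     continuous_on ({a..b} \<times> {0<..}) (\<lambda>(t, y). \<rho> y * ut t y)"

text \<open>The Wronskian of the two functions with respect to the scale \<open>s\<close>.\<close>

definition flux where
  "flux u uy v vy t y = (uy t y * v t y - u t y * vy t y) / deriv s y"

lemma parabolicD:
  assumes "parabolic k a b u ut uy"
  shows "t \<in> {a..b} \<Longrightarrow> 0 < y \<Longrightarrow> ((\<lambda>r. u r y) has_real_derivative ut t y) (at t within {a..b})"
    and "t \<in> {a..b} \<Longrightarrow> 0 < y \<Longrightarrow> (u t has_real_derivative uy t y) (at y)"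
    and "t \<in> {a..b} \<Longrightarrow> 0 < y \<Longrightarrow> ((\<lambda>z. uy t z / deriv s z) has_real_derivative \<rho> y * (k * ut t y)) (at y)"
    and "continuous_on ({a..b} \<times> {0<..}) (\<lambda>(t, y). u t y)"
    and "continuous_on ({a..b} \<times> {0<..}) (\<lambda>(t, y). uy t y)"
    and "continuous_on ({a..b} \<times> {0<..}) (\<lambda>(t, y). \<rho> y * ut t y)"
  using assms unfolding parabolic_def by blast+

text \<open>When \<open>u\<close> solves the forward and \<open>v\<close> the backward equation,
  \<open>D\<close> is both the time derivative of \<open>\<rho> u v\<close> and the space derivative
  of the flux. The rectangle is integrated in either order.\<close>

lemma green_box:
  assumes u: "parabolic 1 a b u ut uy" and v: "parabolic (-1) a b v vt vy"
    and ab: "a \<le> b" and y: "0 < y0" "y0 \<le> y1"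
  shows "continuous_on {y0..y1} (\<lambda>y. \<rho> y * (u b y * v b y - u a y * v a y))" (is ?th1)
    and "integral {y0..y1} (\<lambda>y. \<rho> y * (u b y * v b y - u a y * v a y)) =
      integral {a..b} (\<lambda>t. flux u uy v vy t y1) - integral {a..b} (\<lambda>t. flux u uy v vy t y0)" (is ?th2)
proof -
  note ud = parabolicD[OF u] and vd = parabolicD[OF v]
  define D where "D t y = (\<rho> y * ut t y) * v t y + u t y * (\<rho> y * vt t y)" for t y
  have ycont: "continuous_on ({a..b} \<times> {0<..}) (\<lambda>(t, y). D t y)"
  proof -
    have "continuous_on ({a..b} \<times> {0<..}) (\<lambda>p. (case p of (t, y) \<Rightarrow> \<rho> y * ut t y) * (case p of (t, y) \<Rightarrow> v t y)
         + (case p of (t, y) \<Rightarrow> u t y) * (case p of (t, y) \<Rightarrow> \<rho> y * vt t y))"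
      by (intro continuous_intros ud vd)
    then show ?thesis by (simp add: D_def split_beta)
  qed
  have box: "continuous_on (cbox (y0, a) (y1, b)) (\<lambda>(y, t). D t y)"
  proof -
    have "continuous_on (cbox (y0, a) (y1, b)) (\<lambda>p. case (snd p, fst p) of (t, y) \<Rightarrow> D t y)"
      by (rule continuous_on_compose2[OF ycont]) (use y in \<open>auto intro!: continuous_intros\<close>)
    then show ?thesis by (simp add: split_beta)
  qed
  have tint: "integral {a..b} (\<lambda>t. D t y) = \<rho> y * (u b y * v b y - u a y * v a y)" if "0 < y" for y
  proof -
    have "((\<lambda>t. D t y) has_integral \<rho> y * (u b y * v b y) - \<rho> y * (u a y * v a y)) {a..b}"
    proof (rule fundamental_theorem_of_calculus[OF ab])
      fix t assume "t \<in> {a..b}"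
      then show "((\<lambda>t. \<rho> y * (u t y * v t y)) has_vector_derivative D t y) (at t within {a..b})"
        unfolding D_def has_real_derivative_iff_has_vector_derivative[symmetric] using that
        by (intro DERIV_cong[OF DERIV_cmult[OF DERIV_mult[OF ud(1) vd(1)]]]) (simp_all add: algebra_simps)
    qed
    then show ?thesis by (simp add: integral_unique algebra_simps)
  qed
  have "continuous_on {y0..y1} (\<lambda>y. integral (cbox a b) (\<lambda>t. D t y))"
    by (rule integral_continuous_on_param)
       (use box in \<open>simp add: cbox_Pair_eq\<close>)
  moreover have "integral (cbox a b) (\<lambda>t. D t y) = \<rho> y * (u b y * v b y - u a y * v a y)"
    if "y \<in> {y0..y1}" for y using tint[of y] that y by simp
  ultimately show ?th1 by (metis (no_types, lifting) continuous_on_cong)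
  have yint: "((\<lambda>y. D t y) has_integral flux u uy v vy t y1 - flux u uy v vy t y0) {y0..y1}" if t: "t \<in> {a..b}" for t
  proof (rule fundamental_theorem_of_calculus)
    fix y assume "y \<in> {y0..y1}"
    then have yp: "0 < y" using y by simp
    have "((\<lambda>y. (uy t y / deriv s y) * v t y - u t y * (vy t y / deriv s y)) has_real_derivative D t y) (at y)"
    proof (rule DERIV_cong[OF DERIV_diff[OF DERIV_mult DERIV_mult]])
      show "((\<lambda>z. uy t z / deriv s z) has_real_derivative \<rho> y * ut t y) (at y)"
           "(v t has_real_derivative vy t y) (at y)" "(u t has_real_derivative uy t y) (at y)"
           "((\<lambda>z. vy t z / deriv s z) has_real_derivative - (\<rho> y * vt t y)) (at y)"
        using ud(3)[OF t yp] vd(2)[OF t yp] ud(2)[OF t yp] vd(3)[OF t yp] by simp_all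
    qed (simp add: D_def algebra_simps)
    then show "(flux u uy v vy t has_vector_derivative D t y) (at y within {y0..y1})"
      unfolding has_real_derivative_iff_has_vector_derivative[symmetric]
      by (simp add: flux_def[abs_def] diff_divide_distrib has_field_derivative_at_within)
  qed (use y in simp)
  have fint: "(\<lambda>t. flux u uy v vy t y) integrable_on {a..b}" if "0 < y" for y
  proof -
    have "continuous_on {a..b} (\<lambda>t. flux u uy v vy t y)"
      unfolding flux_def using that scale(3)[OF that]
      by (intro continuous_intros continuous_on_slice(1)[OF ud(4)] continuous_on_slice(1)[OF ud(5)]
           continuous_on_slice(1)[OF vd(4)] continuous_on_slice(1)[OF vd(5)]) auto
    then show ?thesis by (rule integrable_continuous_interval)
  qed
  have "integral {y0..y1} (\<lambda>y. \<rho> y * (u b y * v b y - u a y * v a y)) = integral {y0..y1} (\<lambda>y. integral {a..b} (\<lambda>t. D t y))"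
    by (rule integral_cong) (use tint y in auto)
  also have "\<dots> = integral {a..b} (\<lambda>t. integral {y0..y1} (D t))"
    using integral_swap_continuous[OF box] by simp
  also have "\<dots> = integral {a..b} (\<lambda>t. flux u uy v vy t y1 - flux u uy v vy t y0)"
    by (rule integral_cong) (use yint in \<open>auto intro: integral_unique\<close>)
  also have "\<dots> = integral {a..b} (\<lambda>t. flux u uy v vy t y1) - integral {a..b} (\<lambda>t. flux u uy v vy t y0)"
    using y by (intro integral_diff fint) auto
  finally show ?th2 .
qed

lemma m_Ioc_tendsto_0: "((\<lambda>n. measure m {0<..1 / real (Suc n)}) \<longlongrightarrow> 0) sequentially"
proof -
  have "(\<lambda>n. measure m {0<..1 / real (Suc n)}) \<longlonglongrightarrow> measure m (\<Inter>n. {0<..1 / real (Suc n)})"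
  proof (rule Lim_measure_decseq)
    show "decseq (\<lambda>n. {0<..1 / real (Suc n)})"
      unfolding decseq_def
    proof (intro allI impI)
      fix i j :: nat assume "i \<le> j"
      then have "1 / real (Suc j) \<le> 1 / real (Suc i)" by (simp add: frac_le)
      then show "{0<..1 / real (Suc j)} \<subseteq> {0<..1 / real (Suc i)}" by auto
    qed
    show "emeasure m {0<..1 / real (Suc i)} \<noteq> \<infinity>" for i
      using emeasure_m_Ioc_finite[of "1 / real (Suc i)"] by auto
  qed auto
  also have "(\<Inter>n. {0<..1 / real (Suc n)}) = {}"
  proof -
    have "\<exists>n. \<not> x \<le> 1 / real (Suc n)" if "0 < x" for x
      using reals_Archimedean[OF that] by (auto simp: inverse_eq_divide not_le)
    then show ?thesis by fastforce
  qed
  finally show ?thesis by simp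
qed

lemma set_integrable_m_bounded:
  assumes "continuous_on {0<..} g" "\<And>z. 0 < z \<Longrightarrow> z \<le> y \<Longrightarrow> \<bar>g z\<bar> \<le> (C :: real)" "A \<subseteq> {0<..y}" "A \<in> sets borel"
  shows "set_integrable m A g"
proof -
  have "(\<lambda>z. indicator A z *\<^sub>R g z) \<in> borel_measurable borel"
    using assms by (intro borel_measurable_continuous_on_indicator continuous_on_subset[OF assms(1)]) auto
  moreover have "AE z\<in>{0<..y} in m. norm (indicator A z *\<^sub>R g z) \<le> \<bar>C\<bar>"
    using assms by (intro AE_I2) (auto simp: indicator_def intro: order_trans[OF assms(2)])
  ultimately have "integrable m (\<lambda>z. indicator {0<..y} z *\<^sub>R (indicator A z *\<^sub>R g z))"
    using emeasure_m_Ioc_finite[of y]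
    by (intro integrableI_bounded_set_indicator[where B = "\<bar>C\<bar>"]) auto
  moreover have "(\<lambda>z. indicator {0<..y} z *\<^sub>R (indicator A z *\<^sub>R g z)) = (\<lambda>z. indicator A z *\<^sub>R g z)"
    using assms(3) by (auto simp: fun_eq_iff indicator_def)
  ultimately show ?thesis by (simp add: set_integrable_def)
qed

lemma set_integral_m_eq:
  assumes "continuous_on {0<..} g" "continuous_on {y0..y1} (\<lambda>y. \<rho> y * g y)" "0 < y0"
  shows "(LINT y:{y0<..y1}|m. g y) = integral {y0..y1} (\<lambda>y. \<rho> y * g y)"
proof -
  have meas: "(\<lambda>y. indicator {y0<..y1} y *\<^sub>R g y) \<in> borel_measurable borel"
    using assms by (intro borel_measurable_continuous_on_indicator continuous_on_subset[OF assms(1)]) auto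
  have "(LINT y:{y0<..y1}|m. g y) = (LINT y|lborel. rho_pos y *\<^sub>R (indicator {y0<..y1} y *\<^sub>R g y))"
    unfolding set_lebesgue_integral_def m_eq
    by (intro integral_density) (use meas rho_pos_nonneg in auto)
  also have "\<dots> = (LINT y:{y0<..y1}|lborel. \<rho> y * g y)"
    unfolding set_lebesgue_integral_def
    by (intro Bochner_Integration.integral_cong) (use assms(3) in \<open>auto simp: rho_pos_def indicator_def\<close>)
  also have "\<dots> = (LINT y:{y0..y1}|lborel. \<rho> y * g y)"
  proof (rule set_integral_cong_set)
    show "set_borel_measurable lborel {y0..y1} (\<lambda>y. \<rho> y * g y)"
      unfolding set_borel_measurable_def using borel_measurable_continuous_on_indicator[OF _ assms(2)] by simp
    show "set_borel_measurable lborel {y0<..y1} (\<lambda>y. \<rho> y * g y)"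
    proof -
      have "continuous_on {y0<..y1} (\<lambda>y. \<rho> y * g y)" by (rule continuous_on_subset[OF assms(2)]) auto
      from borel_measurable_continuous_on_indicator[OF _ this] show ?thesis
        by (simp add: set_borel_measurable_def)
    qed
    show "AE y in lborel. (y \<in> {y0..y1}) = (y \<in> {y0<..y1})"
      using AE_lborel_singleton[of y0] by eventually_elim auto
  qed
  also have "\<dots> = integral {y0..y1} (\<lambda>y. \<rho> y * g y)"
    by (intro set_borel_integral_eq_integral borel_integrable_atLeastAtMost' assms)
  finally show ?thesis .
qed

lemma flux_continuous:
  assumes u: "parabolic k a b u ut uy" and v: "parabolic l a b v vt vy"
  shows "continuous_on ({a..b} \<times> {0<..}) (\<lambda>(t, y). flux u uy v vy t y)"
proof -
  have "continuous_on ({a..b} \<times> {0<..}) (\<lambda>p. deriv s (snd p))"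
    by (rule continuous_on_compose2[OF continuous_deriv_scale]) (auto intro!: continuous_intros)
  then have "continuous_on ({a..b} \<times> {0<..}) (\<lambda>p. ((case p of (t, y) \<Rightarrow> uy t y) * (case p of (t, y) \<Rightarrow> v t y)
       - (case p of (t, y) \<Rightarrow> u t y) * (case p of (t, y) \<Rightarrow> vy t y)) / deriv s (snd p))"
    by (intro continuous_intros parabolicD(4,5)[OF u] parabolicD(4,5)[OF v])
       (auto dest: scale(3) simp: less_imp_neq)
  then show ?thesis by (simp add: flux_def split_beta)
qed

text \<open>
  Green's identity without a boundary term at \<open>0\<close>: by \<open>green_box\<close> the defect in the identity is a
  constant \<open>\<kappa>\<close> independent of the upper end point; if \<open>\<kappa> \<noteq> 0\<close>, integrating the flux against the scale
  would be unbounded near \<open>0\<close>, where \<open>s\<close> tends to \<open>-\<infinity>\<close>.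
\<close>

lemma green_from_0:
  assumes u: "parabolic 1 a b u ut uy" and v: "parabolic (-1) a b v vt vy"
    and ab: "a \<le> b" and y1: "0 < y1"
    and bu: "\<And>t y. t \<in> {a..b} \<Longrightarrow> 0 < y \<Longrightarrow> y \<le> y1 \<Longrightarrow> \<bar>u t y\<bar> \<le> A"
    and bv: "\<And>t y. t \<in> {a..b} \<Longrightarrow> 0 < y \<Longrightarrow> y \<le> y1 \<Longrightarrow> \<bar>v t y\<bar> \<le> B"
    and vy: "\<And>t y. t \<in> {a..b} \<Longrightarrow> 0 < y \<Longrightarrow> y \<le> y1 \<Longrightarrow> vy t y \<le> 0"
  shows "(LINT y:{0<..y1}|m. u b y * v b y - u a y * v a y) = integral {a..b} (\<lambda>t. flux u uy v vy t y1)"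
proof -
  define g where "g y = u b y * v b y - u a y * v a y" for y
  define G where "G y = (LINT z:{0<..y}|m. g z)" for y
  define I where "I y = integral {a..b} (\<lambda>t. flux u uy v vy t y)" for y
  have A: "0 \<le> A" and B: "0 \<le> B" using bu[of a y1] bv[of a y1] ab y1 by auto
  have uvb: "\<bar>u t y * v t y\<bar> \<le> A * B" if "t \<in> {a..b}" "0 < y" "y \<le> y1" for t y
    using mult_mono[OF bu[OF that] bv[OF that] A] by (simp add: abs_mult)
  have gcont: "continuous_on {0<..} g"
    unfolding g_def using ab
    by (intro continuous_intros continuous_on_slice(2)[OF parabolicD(4)[OF u]]
        continuous_on_slice(2)[OF parabolicD(4)[OF v]]) auto
  have gb: "\<bar>g y\<bar> \<le> 2 * A * B" if "0 < y" "y \<le> y1" for y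
    using uvb[of a y] uvb[of b y] ab that by (auto simp: g_def)
  have gint: "set_integrable m S g" if "S \<subseteq> {0<..y1}" "S \<in> sets borel" for S
    by (rule set_integrable_m_bounded[OF gcont gb that])
  have GI: "I y1 - I y = G y1 - G y" if "0 < y" "y \<le> y1" for y
  proof -
    have "G y1 = G y + (LINT z:{y<..y1}|m. g z)"
    proof -
      have "{0<..y1} = {0<..y} \<union> {y<..y1}" using that by auto
      then show ?thesis unfolding G_def
        by (simp only:) (intro set_integral_Un gint, use that in auto)
    qed
    also have "(LINT z:{y<..y1}|m. g z) = I y1 - I y"
      unfolding I_def using green_box[OF u v ab that]
      by (subst set_integral_m_eq[OF gcont _ that(1)]) (simp_all add: g_def)
    finally show ?thesis by simp
  qed
  have Gb: "\<bar>G y\<bar> \<le> 2 * A * B * measure m {0<..y}" if "0 < y" "y \<le> y1" for y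
  proof -
    have "\<bar>G y\<bar> \<le> (LINT z:{0<..y}|m. \<bar>g z\<bar>)"
    proof -
      have "{0<..y} \<subseteq> {0<..y1}" using that by auto
      from set_integral_norm_bound[OF gint[OF this]] show ?thesis by (simp add: G_def)
    qed
    also have "\<dots> \<le> (LINT z:{0<..y}|m. 2 * A * B)"
    proof (rule set_integral_mono)
      show "set_integrable m {0<..y} (\<lambda>z. \<bar>g z\<bar>)"
        using that by (intro set_integrable_abs gint) auto
      show "set_integrable m {0<..y} (\<lambda>z. 2 * A * B)"
        by (rule set_integrable_m_bounded[where C = "\<bar>2 * A * B\<bar>"]) auto
    qed (use gb that in auto)
    also have "\<dots> = 2 * A * B * measure m {0<..y}"
      by (subst set_integral_const) (use emeasure_m_Ioc_finite[of y] in auto)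
    finally show ?thesis .
  qed
  \<comment> \<open>By \<open>GI\<close> the difference \<open>I y - G y\<close> is the same for all
    \<open>y\<close>, and \<open>G y\<close> tends to \<open>0\<close> with the mass of
    \<open>{0<..y}\<close>; so \<open>\<kappa>\<close> is the limit at \<open>0\<close> of the flux
    integral \<open>I\<close>.\<close>
  define \<kappa> where "\<kappa> = I y1 - G y1"
  have "\<kappa> = 0"
  proof (rule ccontr)
    assume k: "\<kappa> \<noteq> 0"
    have "(\<lambda>n. 2 * A * B * measure m {0<..1 / real (Suc n)}) \<longlonglongrightarrow> 2 * A * B * 0"
      by (intro tendsto_intros m_Ioc_tendsto_0)
    then have "eventually (\<lambda>n. 2 * A * B * measure m {0<..1 / real (Suc n)} < \<bar>\<kappa>\<bar> / 2) sequentially"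
      by (rule order_tendstoD(2)) (use k in simp)
    moreover have "eventually (\<lambda>n. 1 / real (Suc n) < y1) sequentially"
      using order_tendstoD(2)[OF LIMSEQ_Suc[OF lim_1_over_n] y1] by simp
    ultimately have "eventually (\<lambda>n. 2 * A * B * measure m {0<..1 / real (Suc n)} < \<bar>\<kappa>\<bar> / 2 \<and> 1 / real (Suc n) < y1) sequentially"
      by (rule eventually_conj)
    then obtain n where n: "2 * A * B * measure m {0<..1 / real (Suc n)} < \<bar>\<kappa>\<bar> / 2" "1 / real (Suc n) < y1"
      by (auto dest: eventually_happens)
    define e where "e = 1 / real (Suc n)"
    have e: "0 < e" "e < y1" using n by (auto simp: e_def)
    have Ib: "\<bar>I y - \<kappa>\<bar> \<le> \<bar>\<kappa>\<bar> / 2" if "0 < y" "y \<le> e" for y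
    proof -
      have "I y - \<kappa> = G y" using GI[of y] that e by (simp add: \<kappa>_def)
      moreover have "2 * A * B * measure m {0<..y} \<le> 2 * A * B * measure m {0<..e}"
        using that emeasure_m_Ioc_finite[of e] A B
        by (intro mult_left_mono measure_mono_fmeasurable) (auto simp: fmeasurable_def)
      ultimately show ?thesis using Gb[of y] that e n(1) by (simp add: e_def)
    qed
    \<comment> \<open>Up to \<open>e\<close>, \<open>I\<close> has the sign of
      \<open>\<kappa>\<close> and at least half its size, so its integral against \<open>s'\<close>
      over \<open>{y..e}\<close> is at least \<open>\<bar>\<kappa>\<bar> / 2 * (s e - s y)\<close>
      in absolute value. The same integral is at most \<open>6 * A * B * (b - a)\<close>; the
      quotient of the two gives the \<open>12\<close>.\<close>
    have sb: "s e - s y \<le> 12 * A * B * (b - a) / \<bar>\<kappa>\<bar>" if y: "0 < y" "y < e" for y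
    proof -
      have box: "continuous_on (cbox (y, a) (e, b)) (\<lambda>(z, t). deriv s z * flux u uy v vy t z)"
      proof -
        have "continuous_on (cbox (y, a) (e, b)) (\<lambda>p. deriv s (fst p) * (case (snd p, fst p) of (t, z) \<Rightarrow> flux u uy v vy t z))"
          by (intro continuous_intros continuous_on_compose2[OF flux_continuous[OF u v]]
              continuous_on_compose2[OF continuous_deriv_scale]) (use y in \<open>auto intro!: continuous_intros\<close>)
        then show ?thesis by (simp add: split_beta)
      qed
      define \<sigma> where "\<sigma> = sgn \<kappa>"
      have sg: "\<bar>\<sigma>\<bar> = 1" "\<sigma> * \<kappa> = \<bar>\<kappa>\<bar>" using k by (auto simp: \<sigma>_def sgn_if)
      have Icont: "continuous_on {y..e} (\<lambda>z. deriv s z * I z)"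
      proof -
        have "continuous_on {y..e} (\<lambda>z. integral (cbox a b) (\<lambda>t. flux u uy v vy t z))"
        proof (rule integral_continuous_on_param)
          have "continuous_on ({y..e} \<times> cbox a b) (\<lambda>p. case (snd p, fst p) of (t, z) \<Rightarrow> flux u uy v vy t z)"
            by (rule continuous_on_compose2[OF flux_continuous[OF u v]]) (use y in \<open>auto intro!: continuous_intros\<close>)
          then show "continuous_on ({y..e} \<times> cbox a b) (\<lambda>(z, t). flux u uy v vy t z)"
            by (simp add: split_beta)
        qed
        then show ?thesis unfolding I_def
          by (intro continuous_intros continuous_on_subset[OF continuous_deriv_scale]) (use y in auto)
      qed
      have sint: "((\<lambda>z. deriv s z) has_integral (s e - s y)) {y..e}"
        by (rule fundamental_theorem_of_calculus)
           (use y in \<open>auto simp: has_real_derivative_iff_has_vector_derivative[symmetric]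
             intro!: has_field_derivative_at_within scale_has_derivative\<close>)
      have "\<bar>\<kappa>\<bar> / 2 * (s e - s y) = integral {y..e} (\<lambda>z. \<bar>\<kappa>\<bar> / 2 * deriv s z)"
        using integral_unique[OF sint] by simp
      also have "\<dots> \<le> integral {y..e} (\<lambda>z. \<sigma> * (deriv s z * I z))"
      proof (rule integral_le)
        show "(\<lambda>z. \<bar>\<kappa>\<bar> / 2 * deriv s z) integrable_on {y..e}"
          by (rule has_integral_integrable[OF has_integral_mult_right[OF sint]])
        show "(\<lambda>z. \<sigma> * (deriv s z * I z)) integrable_on {y..e}"
          using Icont by (intro integrable_on_mult_right integrable_continuous_interval)
        fix z assume z: "z \<in> {y..e}"
        have "\<bar>\<kappa>\<bar> / 2 \<le> \<sigma> * I z"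
          using Ib[of z] z y sg k by (auto simp: \<sigma>_def sgn_if abs_if split: if_splits)
        then have "\<bar>\<kappa>\<bar> / 2 * deriv s z \<le> (\<sigma> * I z) * deriv s z"
          using z y scale(3)[of z] by (intro mult_right_mono) auto
        then show "\<bar>\<kappa>\<bar> / 2 * deriv s z \<le> \<sigma> * (deriv s z * I z)" by (simp add: algebra_simps)
      qed
      also have "\<dots> = \<sigma> * integral {y..e} (\<lambda>z. integral {a..b} (\<lambda>t. deriv s z * flux u uy v vy t z))"
        by (simp add: I_def)
      also have "\<dots> = \<sigma> * integral {a..b} (\<lambda>t. integral {y..e} (\<lambda>z. deriv s z * flux u uy v vy t z))"
        using integral_swap_continuous[OF box] by simp
      also have "\<dots> \<le> \<bar>integral {a..b} (\<lambda>t. integral {y..e} (\<lambda>z. deriv s z * flux u uy v vy t z))\<bar>"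
        by (rule order_trans[OF abs_ge_self]) (simp add: abs_mult sg(1))
      also have "\<dots> \<le> 6 * A * B * (b - a)"
      proof -
        \<comment> \<open>\<open>s'\<close> times the flux is \<open>(u v)' - 2 u vy\<close>, so no
          derivative of \<open>u\<close> has to be bounded. The first term integrates to at most
          \<open>2 A B\<close>; since \<open>vy \<le> 0\<close>, the total variation of
          \<open>v\<close> is at most \<open>2 B\<close>, and the second term contributes at most
          \<open>4 A B\<close>.\<close>
        have bd: "norm (integral {y..e} (\<lambda>z. deriv s z * flux u uy v vy t z)) \<le> 6 * A * B" if t: "t \<in> {a..b}" for t
        proof -
          note du = parabolicD(2)[OF u t] and dv = parabolicD(2)[OF v t]
          have uc: "continuous_on {y..e} (u t)" and vyc: "continuous_on {y..e} (vy t)"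
            using continuous_on_slice(2)[OF parabolicD(4)[OF u] t] continuous_on_slice(2)[OF parabolicD(5)[OF v] t] y
            by (auto elim!: continuous_on_subset)
          have i1: "((\<lambda>z. uy t z * v t z + u t z * vy t z) has_integral (u t e * v t e - u t y * v t y)) {y..e}"
          proof (rule fundamental_theorem_of_calculus)
            fix z assume "z \<in> {y..e}"
            then have z: "0 < z" using y by simp
            have "((\<lambda>z. u t z * v t z) has_real_derivative uy t z * v t z + u t z * vy t z) (at z)"
              by (rule DERIV_cong[OF DERIV_mult[OF du[OF z] dv[OF z]]]) (simp add: algebra_simps)
            then show "((\<lambda>z. u t z * v t z) has_vector_derivative uy t z * v t z + u t z * vy t z) (at z within {y..e})"
              unfolding has_real_derivative_iff_has_vector_derivative[symmetric]
              by (rule has_field_derivative_at_within)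
          qed (use y in simp)
          have i2: "((\<lambda>z. - vy t z) has_integral (v t y - v t e)) {y..e}"
          proof -
            have "((\<lambda>z. - vy t z) has_integral (- v t e - - v t y)) {y..e}"
            proof (rule fundamental_theorem_of_calculus)
              fix z assume "z \<in> {y..e}"
              then have z: "0 < z" using y by simp
              show "((\<lambda>z. - v t z) has_vector_derivative - vy t z) (at z within {y..e})"
                unfolding has_real_derivative_iff_has_vector_derivative[symmetric]
                by (rule has_field_derivative_at_within[OF DERIV_minus[OF dv[OF z]]])
            qed (use y in simp)
            then show ?thesis by simp
          qed
          have i3: "(\<lambda>z. u t z * vy t z) integrable_on {y..e}"
            by (intro integrable_continuous_interval continuous_intros uc vyc)
          have "norm (integral {y..e} (\<lambda>z. u t z * vy t z)) \<le> integral {y..e} (\<lambda>z. A * (- vy t z))"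
          proof (rule integral_norm_bound_integral[OF i3])
            show "(\<lambda>z. A * (- vy t z)) integrable_on {y..e}"
              by (rule has_integral_integrable[OF has_integral_mult_right[OF i2]])
            fix z assume "z \<in> {y..e}"
            then have z: "0 < z" "z \<le> y1" using y e by auto
            show "norm (u t z * vy t z) \<le> A * (- vy t z)"
              using mult_right_mono[OF bu[OF t z], of "- vy t z"] vy[OF t z] by (simp add: abs_mult)
          qed
          also have "\<dots> = A * (v t y - v t e)"
            using integral_unique[OF has_integral_mult_right[OF i2, of A]] .
          also have "\<dots> \<le> A * (2 * B)"
            using bv[OF t, of y] bv[OF t, of e] y e A by (intro mult_left_mono) auto
          finally have i4: "\<bar>integral {y..e} (\<lambda>z. u t z * vy t z)\<bar> \<le> 2 * A * B" by simp
          have "integral {y..e} (\<lambda>z. deriv s z * flux u uy v vy t z)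
             = integral {y..e} (\<lambda>z. (uy t z * v t z + u t z * vy t z) - 2 * (u t z * vy t z))"
          proof (rule integral_cong)
            fix z assume "z \<in> {y..e}"
            then have "deriv s z \<noteq> 0" using scale(3)[of z] y by auto
            then show "deriv s z * flux u uy v vy t z = (uy t z * v t z + u t z * vy t z) - 2 * (u t z * vy t z)"
              by (simp add: flux_def)
          qed
          also have "\<dots> = (u t e * v t e - u t y * v t y) - 2 * integral {y..e} (\<lambda>z. u t z * vy t z)"
            using i1 i3 by (subst integral_diff) (auto simp: integral_unique)
          finally show ?thesis
            using i4 uvb[OF t, of e] uvb[OF t, of y] y e by simp
        qed
        have "norm (integral {a..b} (\<lambda>t. integral {y..e} (\<lambda>z. deriv s z * flux u uy v vy t z))) \<le> 6 * A * B * (b - a)"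
        proof (rule integral_bound[OF ab])
          have "continuous_on (cbox a b) (\<lambda>t. integral (cbox y e) (\<lambda>z. deriv s z * flux u uy v vy t z))"
          proof (rule integral_continuous_on_param)
            have "continuous_on (cbox a b \<times> cbox y e) (\<lambda>p. case (snd p, fst p) of (z, t) \<Rightarrow> deriv s z * flux u uy v vy t z)"
              by (rule continuous_on_compose2[OF box]) (auto intro!: continuous_intros)
            then show "continuous_on (cbox a b \<times> cbox y e) (\<lambda>(t, z). deriv s z * flux u uy v vy t z)"
              by (simp add: split_beta)
          qed
          then show "continuous_on {a..b} (\<lambda>t. integral {y..e} (\<lambda>z. deriv s z * flux u uy v vy t z))" by simp
        qed (use bd in auto)
        then show ?thesis by simp
      qed
      finally show ?thesis using k by (simp add: field_simps)
    qed
    obtain y where y: "0 < y" "s y < min (s e) (s e - 12 * A * B * (b - a) / \<bar>\<kappa>\<bar>)"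
      using scale_unbounded_below by blast
    have "y < e"
      using y scale_le[of e y] e by (cases "y < e") auto
    then show False using sb[of y] y by simp
  qed
  then show ?thesis by (simp add: \<kappa>_def I_def G_def g_def)
qed

section \<open>Transition densities as solutions of the forward and backward equations\<close>

lemma parabolicI:
  assumes u: "C12 u" "continuous_on ({0<..} \<times> {0<..}) (\<lambda>(t, y). u t y)"
    and pde: "\<And>t y. 0 < t \<Longrightarrow> 0 < y \<Longrightarrow> generator \<rho> s (u t) y = deriv (\<lambda>r. u r y) t"
    and a: "0 < a"
  shows "parabolic 1 a b u (\<lambda>t y. deriv (\<lambda>r. u r y) t) (\<lambda>t. deriv (u t))"
proof -
  \<comment> \<open>The quotient rule for \<open>u_y / s'\<close>. This expression is visibly
    continuous, and the equation identifies it with \<open>\<rho>\<close> times the time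
    derivative.\<close>
  define E where "E t y = (deriv (deriv (u t)) y * deriv s y - deriv (u t) y * deriv (deriv s) y) / (deriv s y * deriv s y)" for t y
  have dE: "((\<lambda>z. deriv (u t) z / deriv s z) has_real_derivative E t y) (at y)" if "0 < t" "0 < y" for t y
    unfolding E_def
  proof (rule DERIV_divide)
    show "(deriv (u t) has_real_derivative deriv (deriv (u t)) y) (at y)"
      using u(1) that unfolding C12_def by (intro DERIV_deriv_iff_field_differentiable[THEN iffD2]) auto
    show "(deriv s has_real_derivative deriv (deriv s) y) (at y)"
      using that by (rule_tac deriv_scale_has_derivative)
    show "deriv s y \<noteq> 0" using scale(3)[OF that(2)] by simp
  qed
  have E: "E t y = \<rho> y * deriv (\<lambda>r. u r y) t" if "0 < t" "0 < y" for t y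
  proof -
    have "(\<lambda>z. 1 / deriv s z * deriv (u t) z) = (\<lambda>z. deriv (u t) z / deriv s z)" by simp
    then show ?thesis
      using pde[OF that] DERIV_imp_deriv[OF dE[OF that]] rho(2)[OF that(2)]
      by (simp add: generator_def field_simps)
  qed
  have "continuous_on ({0<..} \<times> {0<..}) (\<lambda>(t, y). E t y)"
  proof -
    have "continuous_on ({0<..} \<times> {0<..}) (\<lambda>p::real\<times>real. deriv s (snd p))"
         "continuous_on ({0<..} \<times> {0<..}) (\<lambda>p::real\<times>real. deriv (deriv s) (snd p))"
      by (rule continuous_on_compose2[OF continuous_deriv_scale] continuous_on_compose2[OF continuous_deriv2_scale];
          auto intro!: continuous_intros)+
    then have "continuous_on ({0<..} \<times> {0<..}) (\<lambda>p. ((case p of (t, y) \<Rightarrow> deriv (deriv (u t)) y) * deriv s (snd p)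
        - (case p of (t, y) \<Rightarrow> deriv (u t) y) * deriv (deriv s) (snd p)) / (deriv s (snd p) * deriv s (snd p)))"
      using u(1) by (intro continuous_intros) (auto simp: C12_def dest: scale(3))
    then show ?thesis by (simp add: E_def split_beta)
  qed
  then have Ec: "continuous_on ({a..b} \<times> {0<..}) (\<lambda>(t, y). E t y)"
    using a by (rule_tac continuous_on_subset) auto
  have "continuous_on ({a..b} \<times> {0<..}) (\<lambda>(t, y). \<rho> y * deriv (\<lambda>r. u r y) t)"
    using Ec by (rule continuous_on_cong[THEN iffD1, rotated -1]) (use E a in auto)
  moreover have "continuous_on ({a..b} \<times> {0<..}) (\<lambda>(t, y). u t y)"
       "continuous_on ({a..b} \<times> {0<..}) (\<lambda>(t, y). deriv (u t) y)"
    using u a unfolding C12_def by (auto elim!: continuous_on_subset)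
  moreover have "((\<lambda>r. u r y) has_real_derivative deriv (\<lambda>r. u r y) t) (at t within {a..b})"
     "(u t has_real_derivative deriv (u t) y) (at y)" if "t \<in> {a..b}" "0 < y" for t y
    using u(1) a that unfolding C12_def
    by (auto intro!: has_field_derivative_at_within DERIV_deriv_iff_field_differentiable[THEN iffD2])
  moreover have "((\<lambda>z. deriv (u t) z / deriv s z) has_real_derivative \<rho> y * (1 * deriv (\<lambda>r. u r y) t)) (at y)"
    if "t \<in> {a..b}" "0 < y" for t y
    using dE[of t y] E[of t y] a that by auto
  ultimately show ?thesis unfolding parabolic_def by blast
qed

text \<open>It supplies the backward partner \<open>q(v - t, y, 0)\<close> of a forward solution in
  Green's formula.\<close>

lemma parabolic_time_reversal:
  assumes "parabolic 1 (v - b) (v - a) u ut uy"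
  shows "parabolic (-1) a b (\<lambda>t. u (v - t)) (\<lambda>t y. - ut (v - t) y) (\<lambda>t. uy (v - t))"
proof -
  note d = parabolicD[OF assms]
  have cont: "continuous_on ({a..b} \<times> {0<..}) (\<lambda>(t, y). g (v - t) y)"
    if "continuous_on ({v - b..v - a} \<times> {0<..}) (\<lambda>(t, y). g t y)" for g :: "real \<Rightarrow> real \<Rightarrow> real"
  proof -
    have "continuous_on ({a..b} \<times> {0<..}) (\<lambda>p. case (v - fst p, snd p) of (t, y) \<Rightarrow> g t y)"
      by (rule continuous_on_compose2[OF that]) (auto intro!: continuous_intros)
    then show ?thesis by (simp add: split_beta)
  qed
  have "continuous_on ({a..b} \<times> {0<..}) (\<lambda>(t, y). - (\<rho> y * ut (v - t) y))"
    using continuous_on_minus[OF cont[OF d(6)]] by (simp add: split_beta)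
  moreover have "((\<lambda>r. u (v - r) y) has_real_derivative - ut (v - t) y) (at t within {a..b})"
    if "t \<in> {a..b}" "0 < y" for t y
  proof -
    have "((\<lambda>r. u r y) \<circ> (\<lambda>r. v - r) has_real_derivative ut (v - t) y * (-1)) (at t within {a..b})"
    proof (rule DERIV_image_chain)
      show "((\<lambda>r. u r y) has_real_derivative ut (v - t) y) (at (v - t) within (\<lambda>r. v - r) ` {a..b})"
        using d(1)[of "v - t" y] that by simp
      show "((\<lambda>r. v - r) has_real_derivative - 1) (at t within {a..b})"
        by (auto intro!: derivative_eq_intros)
    qed
    then show ?thesis by (simp add: o_def)
  qed
  moreover have "(u (v - t) has_real_derivative uy (v - t) y) (at y)"
     "((\<lambda>z. uy (v - t) z / deriv s z) has_real_derivative \<rho> y * (- 1 * - ut (v - t) y)) (at y)"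
    if "t \<in> {a..b}" "0 < y" for t y
    using d(2)[of "v - t" y] d(3)[of "v - t" y] that by simp_all
  ultimately show ?thesis
    unfolding parabolic_def using cont[OF d(4)] cont[OF d(5)] by simp
qed

text \<open>With this partner Green's formula becomes the balance of mass below a level.\<close>

lemma parabolic_one: "parabolic (-1) a b (\<lambda>_ _. 1) (\<lambda>_ _. 0) (\<lambda>_ _. 0)"
  unfolding parabolic_def by auto

lemma q_nonneg: "0 < t \<Longrightarrow> 0 \<le> x \<Longrightarrow> 0 \<le> y \<Longrightarrow> 0 \<le> q t x y"
  using density unfolding transition_density_def by auto

lemma q_sym: "0 < t \<Longrightarrow> 0 \<le> x \<Longrightarrow> 0 \<le> y \<Longrightarrow> q t x y = q t y x"
  using density unfolding transition_density_def by auto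

lemma q_continuous: "continuous_on ({0<..} \<times> {0..} \<times> {0..}) (\<lambda>(t, x, y). q t x y)"
  using density unfolding transition_density_def by auto

lemma parabolic_q:
  assumes "0 \<le> z" "0 < a"
  shows "parabolic 1 a b (\<lambda>t y. q t y z) (\<lambda>t y. deriv (\<lambda>r. q r y z) t) (\<lambda>t. deriv (\<lambda>y. q t y z))"
proof (rule parabolicI)
  show "C12 (\<lambda>t y. q t y z)"
  \<comment> \<open>\<open>C122\<close> covers positive states only; at the pole \<open>0\<close>
    the regularity of \<open>q t y 0\<close> is an assumption of its own.\<close>
  proof (cases "z = 0")
    case False
    then have z: "0 < z" using assms by simp
    have c: "continuous_on ({0<..} \<times> {0<..}) (\<lambda>(t, x). g t x z)"
      if "continuous_on ({0<..} \<times> {0<..} \<times> {0<..}) (\<lambda>(t, x, y). g t x y)" for g :: "real \<Rightarrow> real \<Rightarrow> real \<Rightarrow> real"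
    proof -
      have "continuous_on ({0<..} \<times> {0<..}) (\<lambda>p. case (fst p, snd p, z) of (t, x, y) \<Rightarrow> g t x y)"
        by (rule continuous_on_compose2[OF that]) (use z in \<open>auto intro!: continuous_intros\<close>)
      then show ?thesis by (simp add: split_beta)
    qed
    show ?thesis
      using smooth(1) z unfolding C122_def C12_def by (intro conjI allI impI c) auto
  qed (use smooth(2) in simp)
  have "continuous_on ({0<..} \<times> {0<..}) (\<lambda>p. case (fst p, snd p, z) of (t, x, y) \<Rightarrow> q t x y)"
    by (rule continuous_on_compose2[OF q_continuous]) (use assms in \<open>auto intro!: continuous_intros\<close>)
  then show "continuous_on ({0<..} \<times> {0<..}) (\<lambda>(t, y). q t y z)" by (simp add: split_beta)
qed (use kolmogorov assms in auto)

text \<open>\<open>q\<close> is continuous up to the state \<open>0\<close>, so compactness gives a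
  bound that is uniform down to \<open>y = 0\<close>, as \<open>green_from_0\<close> asks
  for.\<close>

lemma q_bounded:
  assumes "0 < a" "0 \<le> z"
  obtains A where "\<And>t y. t \<in> {a..b} \<Longrightarrow> 0 \<le> y \<Longrightarrow> y \<le> y1 \<Longrightarrow> \<bar>q t y z\<bar> \<le> A"
proof -
  have "compact ((\<lambda>(t, x, y). q t x y) ` ({a..b} \<times> {0..y1} \<times> {z}))"
    by (intro compact_continuous_image continuous_on_subset[OF q_continuous] compact_Times) (use assms in auto)
  then obtain A where "\<forall>v\<in>(\<lambda>(t, x, y). q t x y) ` ({a..b} \<times> {0..y1} \<times> {z}). norm v \<le> A"
    using compact_imp_bounded bounded_iff by blast
  then have "\<bar>q t y z\<bar> \<le> A" if "t \<in> {a..b}" "0 \<le> y" "y \<le> y1" for t y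
    using that by (force simp: image_iff)
  with that show ?thesis by blast
qed

subsection \<open>The density started at \<open>0\<close>\<close>

text \<open>Clamping the states at \<open>0\<close> makes the density continuous on all of the plane
  of states, without changing it where \<open>m\<close> lives or at the pole
  \<open>0\<close>.\<close>

definition Q :: "real \<Rightarrow> real \<Rightarrow> real \<Rightarrow> real" where "Q t x y = q t (max 0 x) (max 0 y)"

lemma Q_eq: "0 \<le> x \<Longrightarrow> 0 \<le> y \<Longrightarrow> Q t x y = q t x y"
  by (simp add: Q_def)

lemma Q_nonneg: "0 < t \<Longrightarrow> 0 \<le> Q t x y"
  by (simp add: Q_def q_nonneg)

lemma Q_sym: "0 < t \<Longrightarrow> Q t x y = Q t y x"
  by (simp add: Q_def q_sym)

lemma Q_continuous: "continuous_on ({0<..} \<times> UNIV \<times> UNIV) (\<lambda>(t, x, y). Q t x y)"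
proof -
  have "continuous_on ({0<..} \<times> UNIV \<times> UNIV) (\<lambda>p. case (fst p, max 0 (fst (snd p)), max 0 (snd (snd p))) of (t, x, y) \<Rightarrow> q t x y)"
    by (rule continuous_on_compose2[OF q_continuous]) (auto intro!: continuous_intros)
  then show ?thesis by (simp add: split_beta Q_def)
qed

lemma Q_continuous_compose:
  assumes "continuous_on A f" "continuous_on A g" "continuous_on A k" "\<And>a. a \<in> A \<Longrightarrow> 0 < f a"
  shows "continuous_on A (\<lambda>a. Q (f a) (g a) (k a))"
proof -
  have "continuous_on A (\<lambda>a. case (f a, g a, k a) of (t, x, y) \<Rightarrow> Q t x y)"
    by (rule continuous_on_compose2[OF Q_continuous]) (use assms in \<open>auto intro!: continuous_intros\<close>)
  then show ?thesis by simp
qed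

lemma Q_tendsto:
  assumes "(f \<longlongrightarrow> t) F" "(g \<longlongrightarrow> x) F" "(k \<longlongrightarrow> y) F" "0 < t"
  shows "((\<lambda>a. Q (f a) (g a) (k a)) \<longlongrightarrow> Q t x y) F"
proof -
  have "isCont (\<lambda>(t, x, y). Q t x y) (t, x, y)"
    using Q_continuous by (rule continuous_on_interior) (use assms(4) in \<open>simp add: interior_open open_Times\<close>)
  then have "((\<lambda>a. case (f a, g a, k a) of (t, x, y) \<Rightarrow> Q t x y) \<longlongrightarrow> (case (t, x, y) of (t, x, y) \<Rightarrow> Q t x y)) F"
    by (rule isCont_tendsto_compose) (intro tendsto_intros assms)
  then show ?thesis by simp
qed

lemma Q_measurable2: "0 < t \<Longrightarrow> (\<lambda>p. Q t (fst p) (snd p)) \<in> borel_measurable (borel \<Otimes>\<^sub>M borel)"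
  unfolding borel_prod by (intro borel_measurable_continuous_onI Q_continuous_compose continuous_intros) auto

lemma Q_measurable [measurable (raw)]:
  assumes "0 < t" "f \<in> borel_measurable N" "g \<in> borel_measurable N"
  shows "(\<lambda>a. Q t (f a) (g a)) \<in> borel_measurable N"
proof -
  have "(\<lambda>a. (f a, g a)) \<in> N \<rightarrow>\<^sub>M borel \<Otimes>\<^sub>M borel" using assms by simp
  from measurable_compose[OF this Q_measurable2[OF assms(1)]] show ?thesis by simp
qed

lemma emeasure_P:
  assumes "0 < t" "0 < x" "B \<in> sets borel"
  shows "emeasure (P x) {\<omega> \<in> space M. X t \<omega> \<in> B} = (\<integral>\<^sup>+y\<in>B. ennreal (Q t x y) \<partial>m)"
proof -
  have "(\<integral>\<^sup>+y\<in>B. ennreal (q t x y) \<partial>m) = (\<integral>\<^sup>+y\<in>B. ennreal (Q t x y) \<partial>m)"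
    by (rule nn_integral_cong_AE) (use AE_m_pos assms in \<open>auto simp: Q_eq\<close>)
  moreover have "emeasure (P x) {\<omega> \<in> space M. X t \<omega> \<in> B} = (\<integral>\<^sup>+y\<in>B. ennreal (q t x y) \<partial>m)"
    using density assms unfolding transition_density_def by blast
  ultimately show ?thesis by simp
qed

text \<open>For \<open>z > 0\<close> the integral is the total mass of a law; Fatou's lemma along
  starting points decreasing to \<open>z\<close> covers \<open>z = 0\<close>, where no law
  \<open>P z\<close> is given.\<close>

lemma Q_mass: assumes "0 < t" "0 \<le> z" shows "(\<integral>\<^sup>+y. ennreal (Q t z y) \<partial>m) \<le> 1"
proof -
  have pos: "(\<integral>\<^sup>+y. ennreal (Q t z y) \<partial>m) \<le> 1" if "0 < z" for z
  proof -
    interpret prob_space "P z" by (rule prob_P[OF that])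
    have "(\<integral>\<^sup>+y. ennreal (Q t z y) \<partial>m) = emeasure (P z) {\<omega> \<in> space M. X t \<omega> \<in> UNIV}"
      using emeasure_P[OF assms(1) that, of UNIV] by simp
    then show ?thesis using emeasure_le_1 by simp
  qed
  have "(\<integral>\<^sup>+y. ennreal (Q t z y) \<partial>m) = (\<integral>\<^sup>+y. liminf (\<lambda>n. ennreal (Q t (z + 1 / real (Suc n)) y)) \<partial>m)"
  proof (intro nn_integral_cong)
    fix y
    have "(\<lambda>n. z + 1 / real (Suc n)) \<longlonglongrightarrow> z + 0"
      by (intro tendsto_intros LIMSEQ_Suc[OF lim_1_over_n])
    then have "(\<lambda>n. ennreal (Q t (z + 1 / real (Suc n)) y)) \<longlonglongrightarrow> ennreal (Q t z y)"
      using assms by (intro tendsto_ennrealI Q_tendsto) auto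
    then show "ennreal (Q t z y) = liminf (\<lambda>n. ennreal (Q t (z + 1 / real (Suc n)) y))"
      by (rule lim_imp_Liminf[symmetric, rotated]) simp
  qed
  also have "\<dots> \<le> liminf (\<lambda>n. \<integral>\<^sup>+y. ennreal (Q t (z + 1 / real (Suc n)) y) \<partial>m)"
    using assms by (intro nn_integral_liminf) measurable
  also have "\<dots> \<le> liminf (\<lambda>n. 1 :: ennreal)"
    using assms by (intro Liminf_mono always_eventually allI pos) (auto intro: add_nonneg_pos)
  finally show ?thesis by (simp add: Liminf_const)
qed

section \<open>The kernel with pole \<open>0\<close>, its space derivative and its potential\<close>

text \<open>The extension by \<open>0\<close> to nonpositive times makes \<open>R (v - t) y\<close>
  vanish once \<open>t\<close> reaches \<open>v\<close>, so that convolutions in time run over the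
  whole line.\<close>

definition R :: "real \<Rightarrow> real \<Rightarrow> real" where
  "R t y = indicator ({0<..} \<times> {0<..}) (t, y) * q t y 0"

definition R' :: "real \<Rightarrow> real \<Rightarrow> real" where
  "R' t y = indicator ({0<..} \<times> {0<..}) (t, y) * deriv (\<lambda>y. q t y 0) y"

lemma R_eq: "0 < t \<Longrightarrow> 0 < y \<Longrightarrow> R t y = q t y 0" "0 < t \<Longrightarrow> 0 < y \<Longrightarrow> R t y = Q t y 0"
  by (simp_all add: R_def Q_def)

lemma R'_eq: "0 < t \<Longrightarrow> 0 < y \<Longrightarrow> R' t y = deriv (\<lambda>y. q t y 0) y"
  by (simp add: R'_def)

lemma R_0: "t \<le> 0 \<Longrightarrow> R t y = 0" "t \<le> 0 \<Longrightarrow> R' t y = 0"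
  by (simp_all add: R_def R'_def)

lemma R_nonneg: "0 \<le> R t y"
  by (auto simp: R_def indicator_def q_nonneg)

lemma R_measurable2: "(\<lambda>p. R (fst p) (snd p)) \<in> borel_measurable (borel \<Otimes>\<^sub>M borel)"
proof -
  have "continuous_on ({0<..} \<times> {0<..}) (\<lambda>p::real\<times>real. Q (fst p) (snd p) 0)"
    by (intro Q_continuous_compose continuous_intros) auto
  from borel_measurable_continuous_on_indicator[OF _ this]
  have "(\<lambda>p::real\<times>real. indicator ({0<..} \<times> {0<..}) p *\<^sub>R Q (fst p) (snd p) 0) \<in> borel_measurable borel"
    by (simp add: open_Times)
  moreover have "(\<lambda>p::real\<times>real. indicator ({0<..} \<times> {0<..}) p *\<^sub>R Q (fst p) (snd p) 0) = (\<lambda>p. R (fst p) (snd p))"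
    by (auto simp: R_def Q_def indicator_def fun_eq_iff)
  ultimately show ?thesis by (simp add: borel_prod)
qed

lemma R'_measurable2: "(\<lambda>p. R' (fst p) (snd p)) \<in> borel_measurable (borel \<Otimes>\<^sub>M borel)"
proof -
  have "continuous_on ({0<..} \<times> {0<..}) (\<lambda>(t, y). deriv (\<lambda>y. q t y 0) y)"
    using smooth(2) by (simp add: C12_def)
  from borel_measurable_continuous_on_indicator[OF _ this]
  have "(\<lambda>p::real\<times>real. indicator ({0<..} \<times> {0<..}) p *\<^sub>R (case p of (t, y) \<Rightarrow> deriv (\<lambda>y. q t y 0) y)) \<in> borel_measurable borel"
    by (simp add: open_Times)
  moreover have "(\<lambda>p::real\<times>real. indicator ({0<..} \<times> {0<..}) p *\<^sub>R (case p of (t, y) \<Rightarrow> deriv (\<lambda>y. q t y 0) y)) = (\<lambda>p. R' (fst p) (snd p))"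
    by (simp add: R'_def fun_eq_iff)
  ultimately show ?thesis by (simp only: borel_prod)
qed

lemma R_measurable [measurable (raw)]:
  assumes "f \<in> borel_measurable N" "g \<in> borel_measurable N"
  shows "(\<lambda>a. R (f a) (g a)) \<in> borel_measurable N"
  using measurable_compose[OF measurable_Pair[OF assms] R_measurable2] by simp

lemma R'_measurable [measurable (raw)]:
  assumes "f \<in> borel_measurable N" "g \<in> borel_measurable N"
  shows "(\<lambda>a. R' (f a) (g a)) \<in> borel_measurable N"
  using measurable_compose[OF measurable_Pair[OF assms] R'_measurable2] by simp

lemma R_antimono: "0 < y \<Longrightarrow> y \<le> z \<Longrightarrow> R t z \<le> R t y"
  using q_decreasing[of t] by (cases "0 < t") (auto simp: R_eq R_0 monotone_on_def)

lemma q0_has_derivative: "0 < t \<Longrightarrow> 0 < y \<Longrightarrow> ((\<lambda>y. q t y 0) has_real_derivative R' t y) (at y)"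
  using smooth(2) unfolding C12_def
  by (auto simp: R'_eq intro!: DERIV_deriv_iff_field_differentiable[THEN iffD2])

lemma R'_nonpos: "R' t y \<le> 0"
proof (cases "0 < t \<and> 0 < y")
  case True
  show ?thesis
  proof (rule ccontr)
    assume "\<not> R' t y \<le> 0"
    then obtain d where d: "0 < d" "\<And>e. 0 < e \<Longrightarrow> e < d \<Longrightarrow> q t y 0 < q t (y + e) 0"
      using DERIV_pos_inc_right[OF q0_has_derivative] True by (metis not_le)
    show False using d(2)[of "d/2"] d(1) R_antimono[of y "y + d/2" t] True by (simp add: R_eq)
  qed
qed (auto simp: R'_def)

text \<open>
  The mass carried by \<open>{0<..y}\<close> decreases at rate \<open>- \<partial>\<^sub>y q(u, y, 0) / s'(y)\<close> and never exceeds \<open>1\<close>.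
\<close>

lemma nn_integral_R'_le:
  assumes y: "0 < y"
  shows "(\<integral>\<^sup>+u. ennreal (- R' u y) \<partial>lborel) \<le> ennreal (deriv s y)"
proof (rule nn_integral_le_exhaustion)
  fix n
  define a b where "a = 1 / real (Suc n)" and "b = real (Suc n)"
  have ab: "0 < a" "a \<le> b" by (auto simp: a_def b_def field_simps)
  obtain A where A: "\<And>t y'. t \<in> {a..b} \<Longrightarrow> 0 \<le> y' \<Longrightarrow> y' \<le> y \<Longrightarrow> \<bar>q t y' 0\<bar> \<le> A"
    using q_bounded[OF ab(1), of 0 b y] by blast
  note pq = parabolic_q[of 0, OF _ ab(1), of b]
  have "(LINT y':{0<..y}|m. q b y' 0 * 1 - q a y' 0 * 1) =
     integral {a..b} (\<lambda>t. flux (\<lambda>t y. q t y 0) (\<lambda>t. deriv (\<lambda>y. q t y 0)) (\<lambda>_ _. 1) (\<lambda>_ _. 0) t y)"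
    by (rule green_from_0[OF pq parabolic_one ab(2) y, of A 1]) (use A in auto)
  also have "\<dots> = integral {a..b} (\<lambda>t. (1 / deriv s y) * R' t y)"
    by (rule integral_cong) (use ab y in \<open>auto simp: flux_def R'_eq\<close>)
  also have "\<dots> = integral {a..b} (\<lambda>t. R' t y) / deriv s y"
    by simp
  finally have eq: "(LINT y':{0<..y}|m. q b y' 0 * 1 - q a y' 0 * 1) = integral {a..b} (\<lambda>t. R' t y) / deriv s y" .
  have qi: "set_integrable m {0<..y} (\<lambda>y'. q t y' 0)" if "t \<in> {a..b}" for t
  proof (rule set_integrable_m_bounded)
    show "continuous_on {0<..} (\<lambda>y'. q t y' 0)"
      using continuous_on_slice(2)[OF parabolicD(4)[OF pq] that] by simp
    show "\<bar>q t z 0\<bar> \<le> A" if "0 < z" "z \<le> y" for z using A \<open>t \<in> {a..b}\<close> that by auto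
  qed auto
  \<comment> \<open>Between the times \<open>a\<close> and \<open>b\<close> the set
    \<open>{0<..y}\<close> loses at most what it holds at \<open>a\<close>, which is at most
    \<open>1\<close>.\<close>
  have "-1 \<le> - (LINT y':{0<..y}|m. q a y' 0)"
  proof -
    have "ennreal (LINT y':{0<..y}|m. q a y' 0) = (\<integral>\<^sup>+y'. ennreal (indicator {0<..y} y' *\<^sub>R q a y' 0) \<partial>m)"
      unfolding set_lebesgue_integral_def
      by (rule nn_integral_eq_integral[symmetric])
         (use qi[of a] ab in \<open>auto simp: set_integrable_def indicator_def q_nonneg\<close>)
    also have "\<dots> \<le> (\<integral>\<^sup>+y'. ennreal (Q a 0 y') \<partial>m)"
      by (rule nn_integral_mono) (use ab in \<open>auto simp: indicator_def Q_nonneg Q_eq q_sym[of a 0]\<close>)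
    also have "\<dots> \<le> 1" using ab by (intro Q_mass) auto
    finally show ?thesis by simp
  qed
  also have "\<dots> \<le> (LINT y':{0<..y}|m. q b y' 0 * 1 - q a y' 0 * 1)"
  proof -
    have "(LINT y':{0<..y}|m. q b y' 0 - q a y' 0) = (LINT y':{0<..y}|m. q b y' 0) - (LINT y':{0<..y}|m. q a y' 0)"
      using ab by (intro set_integral_diff qi) auto
    moreover have "0 \<le> (LINT y':{0<..y}|m. q b y' 0)"
      unfolding set_lebesgue_integral_def
      by (rule integral_nonneg_AE) (use ab in \<open>auto simp: indicator_def q_nonneg\<close>)
    ultimately show ?thesis by simp
  qed
  finally have "- integral {a..b} (\<lambda>t. R' t y) \<le> deriv s y"
    unfolding eq using scale(3)[OF y] by (simp add: field_simps)
  moreover have "(\<integral>\<^sup>+t\<in>{a..b}. ennreal (- R' t y) \<partial>lborel) = ennreal (- integral {a..b} (\<lambda>t. R' t y))"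
  proof -
    have "continuous_on {a..b} (\<lambda>t. R' t y)"
      using continuous_on_slice(1)[OF parabolicD(5)[OF pq], of y] y ab
      by (subst continuous_on_cong[OF refl, of _ _ "\<lambda>t. deriv (\<lambda>y. q t y 0) y"]) (auto simp: R'_eq)
    then have "((\<lambda>t. - R' t y) has_integral - integral {a..b} (\<lambda>t. R' t y)) {a..b}"
      by (intro has_integral_neg integrable_integral integrable_continuous_interval)
    from nn_integral_has_integral_lebesgue'[OF _ this] show ?thesis by (simp add: R'_nonpos)
  qed
  ultimately show "(\<integral>\<^sup>+t\<in>{1 / real (Suc n)..real (Suc n)}. ennreal (- R' t y) \<partial>lborel) \<le> ennreal (deriv s y)"
    by (simp add: a_def b_def ennreal_leI)
qed (auto simp: R_0)

text \<open>\<open>R u y - R u z\<close> is the integral of \<open>- R' u v\<close> over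
  \<open>v\<close> in \<open>{y..z}\<close>. Integrated over \<open>u\<close>, this is at most the
  integral of \<open>s'\<close>, hence at most \<open>S - s y\<close>; as
  \<open>z \<rightarrow> \<infinity>\<close>, \<open>R u z\<close> vanishes.\<close>

lemma nn_integral_R_le:
  assumes S: "\<And>y. 0 < y \<Longrightarrow> s y \<le> S" and y: "0 < y"
  shows "(\<integral>\<^sup>+u. ennreal (R u y) \<partial>lborel) \<le> ennreal (S - s y)"
proof -
  have diff: "(\<integral>\<^sup>+u. ennreal (R u y - R u z) \<partial>lborel) \<le> ennreal (S - s y)" if z: "y \<le> z" for z
  proof -
    have "ennreal (R u y - R u z) = (\<integral>\<^sup>+v. ennreal (- R' u v) * indicator {y..z} v \<partial>lborel)" for u
    proof (cases "0 < u")
      case True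
      have "(\<integral>\<^sup>+v. ennreal (- R' u v) * indicator {y..z} v \<partial>lborel) = ennreal (- q u z 0 - - q u y 0)"
        by (rule nn_integral_FTC_Icc)
           (use True y z R'_nonpos in \<open>auto intro!: DERIV_minus q0_has_derivative\<close>)
      then show ?thesis using True y z by (simp add: R_eq)
    qed (simp add: R_0)
    then have "(\<integral>\<^sup>+u. ennreal (R u y - R u z) \<partial>lborel)
      = (\<integral>\<^sup>+u. \<integral>\<^sup>+v. ennreal (- R' u v) * indicator {y..z} v \<partial>lborel \<partial>lborel)"
      by simp
    also have "\<dots> = (\<integral>\<^sup>+v. \<integral>\<^sup>+u. ennreal (- R' u v) * indicator {y..z} v \<partial>lborel \<partial>lborel)"
      by (rule lborel_pair.Fubini') measurable
    also have "\<dots> = (\<integral>\<^sup>+v. (\<integral>\<^sup>+u. ennreal (- R' u v) \<partial>lborel) * indicator {y..z} v \<partial>lborel)"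
      by (intro nn_integral_cong nn_integral_multc) measurable
    also have "\<dots> \<le> (\<integral>\<^sup>+v. ennreal (indicator {0<..} v *\<^sub>R deriv s v) * indicator {y..z} v \<partial>lborel)"
      by (intro nn_integral_mono) (use y in \<open>auto simp: indicator_def intro!: nn_integral_R'_le\<close>)
    also have "\<dots> = ennreal (s z - s y)"
    proof (rule nn_integral_FTC_Icc)
      show "(\<lambda>v. indicator {0<..} v *\<^sub>R deriv s v) \<in> borel_measurable borel"
        by (rule borel_measurable_continuous_on_indicator[OF _ continuous_deriv_scale]) simp
    qed (use y z scale(3) in \<open>auto intro!: scale_has_derivative simp: less_imp_le\<close>)
    also have "\<dots> \<le> ennreal (S - s y)" using S[of z] y z by (intro ennreal_leI) auto
    finally show ?thesis .
  qed
  have "ennreal (R u y) = liminf (\<lambda>n. ennreal (R u y - R u (y + real n)))" for u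
  proof -
    have "(\<lambda>n. R u (y + real n)) \<longlonglongrightarrow> 0"
    proof (cases "0 < u")
      case True
      have "filterlim (\<lambda>n. y + real n) at_top sequentially"
        by (intro filterlim_tendsto_add_at_top[OF tendsto_const] filterlim_real_sequentially)
      from filterlim_compose[OF q_vanishing[OF True] this] show ?thesis
        using True y by (simp add: R_eq add_pos_nonneg)
    qed (simp add: R_0)
    then have "(\<lambda>n. ennreal (R u y - R u (y + real n))) \<longlonglongrightarrow> ennreal (R u y - 0)"
      by (intro tendsto_intros)
    then show ?thesis by (intro lim_imp_Liminf[symmetric]) auto
  qed
  then have "(\<integral>\<^sup>+u. ennreal (R u y) \<partial>lborel) = (\<integral>\<^sup>+u. liminf (\<lambda>n. ennreal (R u y - R u (y + real n))) \<partial>lborel)"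
    by (intro nn_integral_cong) 
  also have "\<dots> \<le> liminf (\<lambda>n. \<integral>\<^sup>+u. ennreal (R u y - R u (y + real n)) \<partial>lborel)"
    by (intro nn_integral_liminf) measurable
  also have "\<dots> \<le> liminf (\<lambda>n. ennreal (S - s y))"
    by (intro Liminf_mono always_eventually allI diff) simp
  finally show ?thesis by (simp add: Liminf_const)
qed

text \<open>Transience provides \<open>x\<close>, \<open>y\<close> such that \<open>y\<close> is
  missed from \<open>x\<close> with probability \<open>?c > 0\<close>; then \<open>y < x\<close>,
  since paths tend to infinity and reach every higher point. A path that misses \<open>y\<close>
  reaches each \<open>z > x\<close> before \<open>y\<close>, so
  \<open>?c \<le> (s x - s y) / (s z - s y)\<close>, which bounds \<open>s z\<close>.\<close>

lemma scale_bounded_above: "\<exists>S. \<forall>y>0. s y \<le> S"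
proof -
  obtain x y where xy: "0 < x" "0 < y" and tr: "measure (P x) {\<omega> \<in> space M. \<exists>t\<ge>0. X t \<omega> = y} < 1"
    using transience(1) by (auto simp: transient_def)
  interpret P: prob_space "P x" by (rule prob_P[OF xy(1)])
  let ?H = "{\<omega> \<in> space M. \<exists>t\<ge>0. X t \<omega> = y}"
  have H: "?H \<in> sets M" by (rule hits_from_measurable) auto
  have "\<not> x \<le> y"
  proof
    assume "x \<le> y"
    have "AE \<omega> in P x. \<omega> \<in> ?H"
      using start[OF xy(1)] transience(2)[OF xy(1)] AE_space
    proof eventually_elim
      case (elim \<omega>)
      then show ?case
        using hits_if_eventually_above[of \<omega> 0 "\<lambda>_. y" y] \<open>x \<le> y\<close> space_P[OF xy(1)] by auto
    qed
    then show False using tr H P.prob_eq_1[of ?H] sets_P[OF xy(1)] by auto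
  qed
  then have yx: "y < x" by simp
  let ?c = "1 - measure (P x) ?H"
  have "s z \<le> s y + (s x - s y) / ?c" if z: "x < z" for z
  proof -
    let ?E = "{\<omega> \<in> space M. \<exists>t\<ge>0. X t \<omega> = z \<and> (\<forall>r\<in>{0..t}. X r \<omega> \<noteq> y)}"
    have E: "measure (P x) ?E = (s x - s y) / (s z - s y)"
      using scale(1) xy yx z unfolding scale_function_def by blast
    have pos: "0 < (s x - s y) / (s z - s y)"
      using scale_less[OF xy(2) yx] scale_less[of y z] xy yx z by simp
    \<comment> \<open>\<open>measure\<close> is \<open>0\<close> on non-measurable sets, so the
      positive value proves measurability.\<close>
    then have "?E \<in> sets (P x)" using E measure_notin_sets[of ?E "P x"] by fastforce
    moreover have "AE \<omega> in P x. \<omega> \<in> space (P x) - ?H \<longrightarrow> \<omega> \<in> ?E"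
      using start[OF xy(1)] transience(2)[OF xy(1)] AE_space
    proof eventually_elim
      case (elim \<omega>)
      then show ?case
        using hits_if_eventually_above[of \<omega> 0 "\<lambda>_. z" z] z space_P[OF xy(1)] by auto
    qed
    ultimately have "P.prob (space (P x) - ?H) \<le> P.prob ?E"
      by (intro P.finite_measure_mono_AE) auto
    moreover have "P.prob (space (P x) - ?H) = ?c"
      using H sets_P[OF xy(1)] by (intro P.prob_compl) auto
    ultimately have "?c \<le> (s x - s y) / (s z - s y)" using E by simp
    then show ?thesis
      using tr scale_less[of y z] xy yx z by (simp add: field_simps)
  qed
  note * = this
  have "s z \<le> max (s x) (s y + (s x - s y) / ?c)" if "0 < z" for z
    using *[of z] scale_le[of z x] that xy by (cases "x < z") auto
  then show ?thesis by blast
qed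

definition scale_sup :: real where "scale_sup = (SUP y\<in>{0<..}. s y)"

lemma scale_le_sup: "0 < y \<Longrightarrow> s y \<le> scale_sup"
  unfolding scale_sup_def using scale_bounded_above by (intro cSUP_upper) (auto simp: bdd_above_def)

lemma scale_near_sup: "0 < e \<Longrightarrow> \<exists>y>0. scale_sup - s y < e"
  using less_cSUP_iff[of "{0<..}" s "scale_sup - e"] scale_bounded_above
  unfolding scale_sup_def by (auto simp: bdd_above_def algebra_simps)

text \<open>The Green function of the transient diffusion with pole \<open>0\<close>; it dominates
  \<open>H\<close> and its variation in time.\<close>

definition U :: "real \<Rightarrow> real" where "U y = (LINT u|lborel. R u y)"

lemma integrable_R: "0 < y \<Longrightarrow> integrable lborel (\<lambda>u. R u y)"
  using nn_integral_R_le[OF scale_le_sup, of y]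
  by (intro integrableI_nonneg) (auto simp: R_nonneg intro: le_less_trans)

lemma nn_integral_R: "0 < y \<Longrightarrow> (\<integral>\<^sup>+u. ennreal (R u y) \<partial>lborel) = ennreal (U y)"
  unfolding U_def by (rule nn_integral_eq_integral) (auto simp: integrable_R R_nonneg)

lemma U_le: "0 < y \<Longrightarrow> U y \<le> scale_sup - s y"
  using nn_integral_R_le[OF scale_le_sup, of y] nn_integral_R[of y] scale_le_sup[of y] by simp

lemma U_nonneg: "0 \<le> U y"
  unfolding U_def by (rule integral_nonneg_AE) (simp add: R_nonneg)

lemma integrable_R': "0 < y \<Longrightarrow> integrable lborel (\<lambda>u. R' u y)"
proof -
  assume y: "0 < y"
  have "integrable lborel (\<lambda>u. - R' u y)"
    using nn_integral_R'_le[OF y]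
    by (intro integrableI_nonneg) (auto simp: R'_nonpos intro: le_less_trans)
  then show ?thesis by simp
qed

subsection \<open>The Markov property and the Chapman-Kolmogorov equation\<close>

lemma nn_integral_law:
  assumes "0 < t" "0 < x" and g: "g \<in> borel_measurable borel"
  shows "(\<integral>\<^sup>+\<omega>. g (X t \<omega>) \<partial>P x) = (\<integral>\<^sup>+z. ennreal (Q t x z) * g z \<partial>m)"
proof -
  have [measurable_cong]: "sets (P x) = sets M" by (rule sets_P[OF assms(2)])
  have X: "X t \<in> borel_measurable (P x)" using measurable_X[of t] assms by simp
  have "distr (P x) borel (X t) = density m (\<lambda>z. ennreal (Q t x z))"
  proof (rule measure_eqI)
    fix B :: "real set" assume "B \<in> sets (distr (P x) borel (X t))"
    then have B: "B \<in> sets borel" by simp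
    have "emeasure (distr (P x) borel (X t)) B = emeasure (P x) {\<omega> \<in> space M. X t \<omega> \<in> B}"
      using B X space_P[OF assms(2)] by (subst emeasure_distr) (auto simp: vimage_def Int_def conj_commute)
    then show "emeasure (distr (P x) borel (X t)) B = emeasure (density m (\<lambda>z. ennreal (Q t x z))) B"
      using B assms by (simp add: emeasure_P emeasure_density)
  qed simp
  then have "(\<integral>\<^sup>+z. g z \<partial>distr (P x) borel (X t)) = (\<integral>\<^sup>+z. g z \<partial>density m (\<lambda>z. ennreal (Q t x z)))" by simp
  then show ?thesis using X g assms by (simp add: nn_integral_distr nn_integral_density)
qed

text \<open>The assumption concerns events. It says that \<open>N1\<close>, the law of
  \<open>X\<close> at time \<open>T + r\<close> restricted to \<open>A\<close>, has the density of
  \<open>N2\<close>; equality of these measures extends to all nonnegative Borel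
  \<open>g\<close>.\<close>

lemma strong_markov_density:
  assumes x: "0 < x" and T: "stopping_time (natural_filtration M X) T" "\<And>\<omega>. \<omega> \<in> space M \<Longrightarrow> 0 \<le> T \<omega>"
    and A: "A \<in> sets (F.pre_sigma T)" and r: "0 < r" and g: "g \<in> borel_measurable borel"
  shows "(\<integral>\<^sup>+\<omega>\<in>A. g (X (T \<omega> + r) \<omega>) \<partial>P x) =
    (\<integral>\<^sup>+\<omega>\<in>A. (\<integral>\<^sup>+z. ennreal (Q r (X (T \<omega>) \<omega>) z) * g z \<partial>m) \<partial>P x)"
proof -
  have [measurable_cong]: "sets (P x) = sets M" by (rule sets_P[OF x])
  interpret P: prob_space "P x" by (rule prob_P[OF x])
  interpret pair_sigma_finite "P x" m ..
  have Tm [measurable]: "T \<in> borel_measurable M" by (rule stopping_time_measurable[OF T(1)])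
  have Am [measurable]: "A \<in> sets M" by (rule pre_sigma_subset[OF T(1) A])
  have XT [measurable]: "(\<lambda>\<omega>. X (T \<omega>) \<omega>) \<in> borel_measurable M"
    by (intro X_measurable_compose) (use T(2) in auto)
  have XTr [measurable]: "(\<lambda>\<omega>. X (T \<omega> + r) \<omega>) \<in> borel_measurable M"
    by (intro X_measurable_compose) (use T(2) r in \<open>auto intro: add_nonneg_nonneg\<close>)
  have AM: "A \<subseteq> space M" using Am sets.sets_into_space by blast
  define N1 where "N1 = distr (density (P x) (indicator A)) borel (\<lambda>\<omega>. X (T \<omega> + r) \<omega>)"
  define N2 where "N2 = density m (\<lambda>z. \<integral>\<^sup>+\<omega>. ennreal (Q r (X (T \<omega>) \<omega>) z) * indicator A \<omega> \<partial>P x)"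
  have [measurable]: "(\<lambda>p. ennreal (Q r (X (T (fst p)) (fst p)) (snd p)) * indicator A (fst p)) \<in> borel_measurable (P x \<Otimes>\<^sub>M m)"
    using r by measurable
  have kern [measurable]: "(\<lambda>z. \<integral>\<^sup>+\<omega>. ennreal (Q r (X (T \<omega>) \<omega>) z) * indicator A \<omega> \<partial>P x) \<in> borel_measurable m"
    using r by measurable
  have fub: "(\<integral>\<^sup>+z. (\<integral>\<^sup>+\<omega>. ennreal (Q r (X (T \<omega>) \<omega>) z) * indicator A \<omega> \<partial>P x) * f z \<partial>m)
     = (\<integral>\<^sup>+\<omega>\<in>A. (\<integral>\<^sup>+z. ennreal (Q r (X (T \<omega>) \<omega>) z) * f z \<partial>m) \<partial>P x)"
    if [measurable]: "f \<in> borel_measurable borel" for f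
  proof -
    have "(\<integral>\<^sup>+z. (\<integral>\<^sup>+\<omega>. ennreal (Q r (X (T \<omega>) \<omega>) z) * indicator A \<omega> \<partial>P x) * f z \<partial>m)
       = (\<integral>\<^sup>+z. \<integral>\<^sup>+\<omega>. ennreal (Q r (X (T \<omega>) \<omega>) z) * indicator A \<omega> * f z \<partial>P x \<partial>m)"
      by (intro nn_integral_cong nn_integral_multc[symmetric]) (use r in measurable)
    also have "\<dots> = (\<integral>\<^sup>+\<omega>. \<integral>\<^sup>+z. ennreal (Q r (X (T \<omega>) \<omega>) z) * indicator A \<omega> * f z \<partial>m \<partial>P x)"
      by (rule Fubini') (use r in measurable)
    also have "\<dots> = (\<integral>\<^sup>+\<omega>. \<integral>\<^sup>+z. (ennreal (Q r (X (T \<omega>) \<omega>) z) * f z) * indicator A \<omega> \<partial>m \<partial>P x)"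
      by (simp add: mult_ac)
    also have "\<dots> = (\<integral>\<^sup>+\<omega>\<in>A. (\<integral>\<^sup>+z. ennreal (Q r (X (T \<omega>) \<omega>) z) * f z \<partial>m) \<partial>P x)"
      by (intro nn_integral_cong nn_integral_multc) (use r in measurable)
    finally show ?thesis .
  qed
  have "N1 = N2"
  proof (rule measure_eqI)
    show "sets N1 = sets N2" by (simp add: N1_def N2_def)
    fix B assume "B \<in> sets N1"
    then have B [measurable]: "B \<in> sets borel" by (simp add: N1_def)
    have vim: "(\<lambda>\<omega>. X (T \<omega> + r) \<omega>) -` B \<inter> space M \<in> sets (P x)"
      using measurable_sets[OF XTr B] sets_P[OF x] by simp
    have "emeasure N1 B = emeasure (density (P x) (indicator A)) ((\<lambda>\<omega>. X (T \<omega> + r) \<omega>) -` B \<inter> space M)"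
      unfolding N1_def by (subst emeasure_distr) (auto simp: space_P[OF x])
    also have "\<dots> = (\<integral>\<^sup>+\<omega>. indicator A \<omega> * indicator ((\<lambda>\<omega>. X (T \<omega> + r) \<omega>) -` B \<inter> space M) \<omega> \<partial>P x)"
      by (rule emeasure_density[OF _ vim]) simp
    also have "\<dots> = (\<integral>\<^sup>+\<omega>. indicator {\<omega> \<in> A. X (T \<omega> + r) \<omega> \<in> B} \<omega> \<partial>P x)"
      by (intro nn_integral_cong) (use AM in \<open>auto simp: indicator_def\<close>)
    also have "\<dots> = emeasure (P x) {\<omega> \<in> A. X (T \<omega> + r) \<omega> \<in> B}"
    proof (rule nn_integral_indicator)
      have "{\<omega> \<in> A. X (T \<omega> + r) \<omega> \<in> B} = A \<inter> {\<omega> \<in> space M. X (T \<omega> + r) \<omega> \<in> B}" using AM by auto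
      then show "{\<omega> \<in> A. X (T \<omega> + r) \<omega> \<in> B} \<in> sets (P x)" using XTr B Am by measurable
    qed
    also have "\<dots> = (\<integral>\<^sup>+\<omega>\<in>A. emeasure (P (X (T \<omega>) \<omega>)) {\<omega>' \<in> space M. X r \<omega>' \<in> B} \<partial>P x)"
      by (rule strong_markov[OF x T A less_imp_le[OF r] B])
    also have "\<dots> = (\<integral>\<^sup>+\<omega>\<in>A. (\<integral>\<^sup>+z. ennreal (Q r (X (T \<omega>) \<omega>) z) * indicator B z \<partial>m) \<partial>P x)"
    proof (rule nn_integral_cong)
      fix \<omega> assume "\<omega> \<in> space (P x)"
      then have "0 < X (T \<omega>) \<omega>" using positive_paths T(2) space_P[OF x] by simp
      then show "emeasure (P (X (T \<omega>) \<omega>)) {\<omega>' \<in> space M. X r \<omega>' \<in> B} * indicator A \<omega> =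
         (\<integral>\<^sup>+z. ennreal (Q r (X (T \<omega>) \<omega>) z) * indicator B z \<partial>m) * indicator A \<omega>"
        using emeasure_P[OF r _ B] by simp
    qed
    also have "\<dots> = emeasure N2 B"
      unfolding N2_def by (subst emeasure_density) (simp_all add: fub)
    finally show "emeasure N1 B = emeasure N2 B" .
  qed
  then have "(\<integral>\<^sup>+z. g z \<partial>N1) = (\<integral>\<^sup>+z. g z \<partial>N2)" by simp
  moreover have "(\<integral>\<^sup>+z. g z \<partial>N1) = (\<integral>\<^sup>+\<omega>\<in>A. g (X (T \<omega> + r) \<omega>) \<partial>P x)"
    unfolding N1_def using g
    by (subst nn_integral_distr, measurable, subst nn_integral_density, measurable) (simp add: mult.commute)
  moreover have "(\<integral>\<^sup>+z. g z \<partial>N2) = (\<integral>\<^sup>+\<omega>\<in>A. (\<integral>\<^sup>+z. ennreal (Q r (X (T \<omega>) \<omega>) z) * g z \<partial>m) \<partial>P x)"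
    unfolding N2_def using g by (subst nn_integral_density) (simp_all add: fub)
  ultimately show ?thesis by simp
qed

text \<open>Both sides are densities of the law of \<open>X\<close> at time \<open>v + d\<close>
  under \<open>P y\<close>, and densities of a law are determined only up to null sets.\<close>

lemma chapman_kolmogorov_AE:
  assumes "0 < v" "0 < d" "0 < y"
  shows "AE w in m. ennreal (Q (v + d) y w) = (\<integral>\<^sup>+z. ennreal (Q v y z) * ennreal (Q d z w) \<partial>m)"
proof -
  interpret mm: pair_sigma_finite m m ..
  have meas [measurable]: "(\<lambda>p. ennreal (Q v y (fst p)) * ennreal (Q d (fst p) (snd p))) \<in> borel_measurable (m \<Otimes>\<^sub>M m)"
    "(\<lambda>w. \<integral>\<^sup>+z. ennreal (Q v y z) * ennreal (Q d z w) \<partial>m) \<in> borel_measurable m"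
    using assms by measurable
  have "density m (\<lambda>w. ennreal (Q (v + d) y w)) = density m (\<lambda>w. \<integral>\<^sup>+z. ennreal (Q v y z) * ennreal (Q d z w) \<partial>m)"
  proof (rule measure_eqI)
    fix B assume "B \<in> sets (density m (\<lambda>w. ennreal (Q (v + d) y w)))"
    then have B [measurable]: "B \<in> sets borel" by simp
    have T: "stopping_time (natural_filtration M X) (\<lambda>_. v)" by (rule stopping_time_const)
    have sp: "space M \<in> sets (F.pre_sigma (\<lambda>_. v))"
      using sets.top[of "F.pre_sigma (\<lambda>_. v)"] by (simp add: F.space_pre_sigma)
    have "emeasure (density m (\<lambda>w. ennreal (Q (v + d) y w))) B = (\<integral>\<^sup>+w. ennreal (Q (v + d) y w) * indicator B w \<partial>m)"
      using assms by (subst emeasure_density) auto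
    also have "\<dots> = (\<integral>\<^sup>+\<omega>. indicator B (X (v + d) \<omega>) \<partial>P y)"
      using assms by (subst nn_integral_law) auto
    also have "\<dots> = (\<integral>\<^sup>+\<omega>\<in>space M. indicator B (X (v + d) \<omega>) \<partial>P y)"
      by (intro nn_integral_cong) (simp add: space_P[OF assms(3)])
    also have "\<dots> = (\<integral>\<^sup>+\<omega>\<in>space M. (\<integral>\<^sup>+w. ennreal (Q d (X v \<omega>) w) * indicator B w \<partial>m) \<partial>P y)"
      by (rule strong_markov_density[OF assms(3) T _ sp]) (use assms in auto)
    also have "\<dots> = (\<integral>\<^sup>+\<omega>. (\<integral>\<^sup>+w. ennreal (Q d (X v \<omega>) w) * indicator B w \<partial>m) \<partial>P y)"
      by (intro nn_integral_cong) (simp add: space_P[OF assms(3)])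
    also have "\<dots> = (\<integral>\<^sup>+z. ennreal (Q v y z) * (\<integral>\<^sup>+w. ennreal (Q d z w) * indicator B w \<partial>m) \<partial>m)"
      using assms by (intro nn_integral_law) auto
    also have "\<dots> = (\<integral>\<^sup>+z. \<integral>\<^sup>+w. ennreal (Q v y z) * ennreal (Q d z w) * indicator B w \<partial>m \<partial>m)"
      by (intro nn_integral_cong) (subst nn_integral_cmult[symmetric], use assms in \<open>auto simp: mult_ac\<close>)
    also have "\<dots> = (\<integral>\<^sup>+w. \<integral>\<^sup>+z. ennreal (Q v y z) * ennreal (Q d z w) * indicator B w \<partial>m \<partial>m)"
      by (rule mm.Fubini'[symmetric]) (use assms in measurable)
    also have "\<dots> = (\<integral>\<^sup>+w. (\<integral>\<^sup>+z. ennreal (Q v y z) * ennreal (Q d z w) \<partial>m) * indicator B w \<partial>m)"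
      by (intro nn_integral_cong nn_integral_multc) (use assms in measurable)
    also have "\<dots> = emeasure (density m (\<lambda>w. \<integral>\<^sup>+z. ennreal (Q v y z) * ennreal (Q d z w) \<partial>m)) B"
      by (subst emeasure_density) auto
    finally show "emeasure (density m (\<lambda>w. ennreal (Q (v + d) y w))) B
       = emeasure (density m (\<lambda>w. \<integral>\<^sup>+z. ennreal (Q v y z) * ennreal (Q d z w) \<partial>m)) B" .
  qed simp
  moreover have "(\<integral>\<^sup>+w. ennreal (Q (v + d) y w) \<partial>m) \<noteq> \<infinity>"
    using Q_mass[of "v + d" y] assms by (auto simp: top_unique)
  ultimately show ?thesis
    using finite_density_unique[of "\<lambda>w. ennreal (Q (v + d) y w)" m "\<lambda>w. \<integral>\<^sup>+z. ennreal (Q v y z) * ennreal (Q d z w) \<partial>m"] assms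
    by simp
qed

text \<open>Every interval has positive mass, so almost every statement holds at points arbitrarily
  close to a given one. This lets the equation above pass to exceptional points, in particular to
  \<open>0\<close>.\<close>

lemma AE_m_dense:
  assumes "AE w in m. good w" "0 \<le> c" "0 < e"
  shows "\<exists>w. c < w \<and> w < c + e \<and> good w"
proof (rule ccontr)
  assume no: "\<not> ?thesis"
  \<comment> \<open>The interval starts at \<open>c + e/2\<close> because positivity of
    \<open>m\<close> is assumed for positive left end points, and \<open>c\<close> may be
    \<open>0\<close>.\<close>
  have "AE w in m. w \<notin> {c + e/2<..<c + e}"
    using assms(1) by eventually_elim (use no assms in auto)
  then have "{c + e/2<..<c + e} \<in> null_sets m"
    by (subst AE_iff_null_sets) auto
  moreover have "0 < emeasure m {c + e/2<..<c + e}"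
    using speed assms unfolding speed_measure_def by (auto simp: field_simps)
  ultimately show False by (simp add: null_sets_def)
qed

text \<open>Fatou's lemma along good points decreasing to \<open>w\<close>, with joint continuity of
  the density; hence an inequality, but at every point.\<close>

lemma chapman_kolmogorov_le:
  assumes "0 < v" "0 < d" "0 < y" "0 \<le> w"
  shows "(\<integral>\<^sup>+z. ennreal (Q v y z) * ennreal (Q d z w) \<partial>m) \<le> ennreal (Q (v + d) y w)"
proof -
  have "\<forall>n. \<exists>w'. w < w' \<and> w' < w + 1 / real (Suc n) \<and> ennreal (Q (v + d) y w') = (\<integral>\<^sup>+z. ennreal (Q v y z) * ennreal (Q d z w') \<partial>m)"
    by (intro allI AE_m_dense chapman_kolmogorov_AE) (use assms in auto)
  then obtain k where k: "\<And>n. w < k n" "\<And>n. k n < w + 1 / real (Suc n)"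
      "\<And>n. ennreal (Q (v + d) y (k n)) = (\<integral>\<^sup>+z. ennreal (Q v y z) * ennreal (Q d z (k n)) \<partial>m)"
    by metis
  have kl: "k \<longlonglongrightarrow> w"
  proof (rule tendsto_sandwich[of "\<lambda>_. w" _ _ "\<lambda>n. w + 1 / real (Suc n)"])
    have "(\<lambda>n. w + 1 / real (Suc n)) \<longlonglongrightarrow> w + 0" by (intro tendsto_intros LIMSEQ_Suc[OF lim_1_over_n])
    then show "(\<lambda>n. w + 1 / real (Suc n)) \<longlonglongrightarrow> w" by simp
  qed (use k in \<open>auto intro!: always_eventually less_imp_le\<close>)
  have "(\<integral>\<^sup>+z. ennreal (Q v y z) * ennreal (Q d z w) \<partial>m)
    = (\<integral>\<^sup>+z. liminf (\<lambda>n. ennreal (Q v y z) * ennreal (Q d z (k n))) \<partial>m)"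
  proof (intro nn_integral_cong)
    fix z
    have "(\<lambda>n. ennreal (Q v y z * Q d z (k n))) \<longlonglongrightarrow> ennreal (Q v y z * Q d z w)"
      using assms by (intro tendsto_intros Q_tendsto kl) auto
    then show "ennreal (Q v y z) * ennreal (Q d z w) = liminf (\<lambda>n. ennreal (Q v y z) * ennreal (Q d z (k n)))"
      using assms by (intro lim_imp_Liminf[symmetric]) (auto simp: ennreal_mult Q_nonneg)
  qed
  also have "\<dots> \<le> liminf (\<lambda>n. \<integral>\<^sup>+z. ennreal (Q v y z) * ennreal (Q d z (k n)) \<partial>m)"
    using assms by (intro nn_integral_liminf) measurable
  also have "\<dots> = liminf (\<lambda>n. ennreal (Q (v + d) y (k n)))"
    by (simp only: k(3))
  also have "\<dots> = ennreal (Q (v + d) y w)"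
    using assms by (intro lim_imp_Liminf tendsto_intros Q_tendsto kl) auto
  finally show ?thesis .
qed

text \<open>
  The reverse inequality at \<open>0\<close> does not follow from Fatou's lemma. With \<open>g = q(v, y, \<sqdot>)\<close> and
  \<open>a\<^sub>n = q(d, \<sqdot>, w\<^sub>n)\<close>, \<open>w\<^sub>n \<rightarrow> 0\<close>, split \<open>g a\<^sub>n \<le> g min(a\<^sub>n, K g) + a\<^sub>n\<^sup>2 / K\<close>: the first term is dominated by
  \<open>K g\<^sup>2\<close>, and the integral of the second is at most \<open>q(2d, w\<^sub>n, w\<^sub>n) / K\<close>.
\<close>

lemma chapman_kolmogorov_0:
  assumes "0 < v" "0 < d" "0 < y"
  shows "(\<integral>\<^sup>+z. ennreal (Q v y z) * ennreal (Q d z 0) \<partial>m) = ennreal (Q (v + d) y 0)"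
proof (rule antisym)
  show "(\<integral>\<^sup>+z. ennreal (Q v y z) * ennreal (Q d z 0) \<partial>m) \<le> ennreal (Q (v + d) y 0)"
    by (rule chapman_kolmogorov_le) (use assms in auto)
  have "\<forall>n. \<exists>w'. 0 < w' \<and> w' < 0 + 1 / real (Suc n) \<and> ennreal (Q (v + d) y w') = (\<integral>\<^sup>+z. ennreal (Q v y z) * ennreal (Q d z w') \<partial>m)"
    by (intro allI AE_m_dense chapman_kolmogorov_AE) (use assms in auto)
  then obtain k where k: "\<And>n. 0 < k n" "\<And>n. k n < 0 + 1 / real (Suc n)"
      "\<And>n. ennreal (Q (v + d) y (k n)) = (\<integral>\<^sup>+z. ennreal (Q v y z) * ennreal (Q d z (k n)) \<partial>m)"
    by metis
  have kl: "k \<longlonglongrightarrow> 0"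
    by (rule tendsto_sandwich[of "\<lambda>_. 0" _ _ "\<lambda>n. 1 / real (Suc n)"])
       (use k LIMSEQ_Suc[OF lim_1_over_n] in \<open>auto intro!: always_eventually less_imp_le\<close>)
  let ?I = "\<integral>\<^sup>+z. ennreal (Q v y z) * ennreal (Q d z 0) \<partial>m"
  have bound0: "ennreal (Q (v + d) y 0) \<le> (\<integral>\<^sup>+z. ennreal (Q v y z * min (Q d z 0) (K * Q v y z)) \<partial>m) + ennreal (Q (d + d) 0 0 / K)"
    if K: "0 < K" for K
  proof (rule LIMSEQ_le)
    show "(\<lambda>n. ennreal (Q (v + d) y (k n))) \<longlonglongrightarrow> ennreal (Q (v + d) y 0)"
      using assms by (intro tendsto_intros Q_tendsto kl) auto
    let ?J = "\<lambda>w. \<integral>\<^sup>+z. ennreal (Q v y z * min (Q d z w) (K * Q v y z)) \<partial>m"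
    have "(\<lambda>n. ?J (k n)) \<longlonglongrightarrow> ?J 0"
    \<comment> \<open>By symmetry the majorant is \<open>K\<close> times the square of
      \<open>Q v y z\<close>. Written this way, its integral is at most
      \<open>K * Q (v + v) y y\<close> by \<open>chapman_kolmogorov_le\<close>.\<close>
    proof (rule nn_integral_dominated_convergence[where w = "\<lambda>z. ennreal (K * (Q v y z * Q v z y))"])
      show "AE z in m. (\<lambda>n. ennreal (Q v y z * min (Q d z (k n)) (K * Q v y z))) \<longlonglongrightarrow> ennreal (Q v y z * min (Q d z 0) (K * Q v y z))"
        using assms by (intro AE_I2 tendsto_intros Q_tendsto kl) auto
      show "AE z in m. ennreal (Q v y z * min (Q d z (k n)) (K * Q v y z)) \<le> ennreal (K * (Q v y z * Q v z y))" for n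
      proof (intro AE_I2 ennreal_leI)
        fix z
        have "Q v y z * min (Q d z (k n)) (K * Q v y z) \<le> Q v y z * (K * Q v y z)"
          using assms by (intro mult_left_mono Q_nonneg) auto
        then show "Q v y z * min (Q d z (k n)) (K * Q v y z) \<le> K * (Q v y z * Q v z y)"
          using Q_sym[of v y z] assms by (simp add: mult_ac)
      qed
      have "(\<integral>\<^sup>+z. ennreal (K * (Q v y z * Q v z y)) \<partial>m) = ennreal K * (\<integral>\<^sup>+z. ennreal (Q v y z) * ennreal (Q v z y) \<partial>m)"
        using assms K by (subst nn_integral_cmult[symmetric]) (auto simp: ennreal_mult Q_nonneg)
      also have "\<dots> \<le> ennreal K * ennreal (Q (v + v) y y)"
        using assms by (intro mult_left_mono chapman_kolmogorov_le) auto
      also have "\<dots> < \<infinity>" by (simp add: ennreal_mult_less_top)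
      finally show "(\<integral>\<^sup>+z. ennreal (K * (Q v y z * Q v z y)) \<partial>m) < \<infinity>" .
    qed (use assms in measurable)
    then show "(\<lambda>n. ?J (k n) + ennreal (Q (d + d) (k n) (k n) / K)) \<longlonglongrightarrow> ?J 0 + ennreal (Q (d + d) 0 0 / K)"
      using assms K by (intro tendsto_add tendsto_intros Q_tendsto kl) auto
    have "ennreal (Q (v + d) y (k n)) \<le> ?J (k n) + ennreal (Q (d + d) (k n) (k n) / K)" for n
    proof -
      have "ennreal (Q (v + d) y (k n)) = (\<integral>\<^sup>+z. ennreal (Q v y z * Q d z (k n)) \<partial>m)"
        using assms by (simp add: k(3) ennreal_mult Q_nonneg)
      also have "\<dots> \<le> (\<integral>\<^sup>+z. ennreal (Q v y z * min (Q d z (k n)) (K * Q v y z)) + ennreal (1 / K) * (ennreal (Q d (k n) z) * ennreal (Q d z (k n))) \<partial>m)"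
      proof (intro nn_integral_mono)
        fix z
        let ?g = "Q v y z" and ?a = "Q d z (k n)"
        have g: "0 \<le> ?g" "0 \<le> ?a" using assms by (auto intro: Q_nonneg)
        have "?g * ?a \<le> ?g * min ?a (K * ?g) + 1 / K * (?a * ?a)"
        proof (cases "?a \<le> K * ?g")
          case False
          then have "(K * ?g) * ?a \<le> ?a * ?a" using g by (intro mult_right_mono) auto
          then have "?g * ?a \<le> 1 / K * (?a * ?a)" using K by (simp add: field_simps)
          moreover have "0 \<le> ?g * min ?a (K * ?g)" using g K by simp
          ultimately show ?thesis by simp
        qed (use K in simp)
        then have "ennreal (?g * ?a) \<le> ennreal (?g * min ?a (K * ?g) + 1 / K * (?a * ?a))" by (rule ennreal_leI)
        also have "\<dots> = ennreal (?g * min ?a (K * ?g)) + ennreal (1 / K * (?a * ?a))"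
          using g K by (intro ennreal_plus) auto
        also have "ennreal (1 / K * (?a * ?a)) = ennreal (1 / K) * (ennreal (Q d (k n) z) * ennreal ?a)"
        proof -
          have "ennreal (1 / K * (?a * ?a)) = ennreal (1 / K) * (ennreal ?a * ennreal ?a)"
            using g K by (subst ennreal_mult, simp, simp, subst ennreal_mult) auto
          then show ?thesis using Q_sym[of d "k n" z] assms by simp
        qed
        finally show "ennreal (?g * ?a) \<le> ennreal (?g * min ?a (K * ?g)) + ennreal (1 / K) * (ennreal (Q d (k n) z) * ennreal ?a)" .
      qed
      also have "\<dots> = ?J (k n) + ennreal (1 / K) * (\<integral>\<^sup>+z. ennreal (Q d (k n) z) * ennreal (Q d z (k n)) \<partial>m)"
        using assms by (subst nn_integral_add) (auto simp: nn_integral_cmult)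
      also have "\<dots> \<le> ?J (k n) + ennreal (1 / K) * ennreal (Q (d + d) (k n) (k n))"
        using assms k(1)[of n] by (intro add_left_mono mult_left_mono chapman_kolmogorov_le) auto
      also have "ennreal (1 / K) * ennreal (Q (d + d) (k n) (k n)) = ennreal (Q (d + d) (k n) (k n) / K)"
        using assms K by (subst ennreal_mult[symmetric]) (auto simp: Q_nonneg)
      finally show ?thesis .
    qed
    then show "\<exists>N. \<forall>n\<ge>N. ennreal (Q (v + d) y (k n)) \<le> ?J (k n) + ennreal (Q (d + d) (k n) (k n) / K)" by blast
  qed
  have bound: "ennreal (Q (v + d) y 0) \<le> ?I + ennreal (Q (d + d) 0 0 / K)" if K: "0 < K" for K
  proof -
    have "(\<integral>\<^sup>+z. ennreal (Q v y z * min (Q d z 0) (K * Q v y z)) \<partial>m) \<le> ?I"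
    proof (rule nn_integral_mono)
      fix z
      have "Q v y z * min (Q d z 0) (K * Q v y z) \<le> Q v y z * Q d z 0"
        using assms by (intro mult_left_mono Q_nonneg) auto
      then show "ennreal (Q v y z * min (Q d z 0) (K * Q v y z)) \<le> ennreal (Q v y z) * ennreal (Q d z 0)"
        using assms by (simp add: ennreal_mult[symmetric] Q_nonneg ennreal_leI)
    qed
    then show ?thesis using bound0[OF K] by (meson add_right_mono order_trans)
  qed
  show "ennreal (Q (v + d) y 0) \<le> ?I"
  proof (rule ennreal_le_epsilon)
    fix e :: real assume e: "0 < e"
    let ?c = "Q (d + d) 0 0"
    have c: "0 \<le> ?c" using assms by (intro Q_nonneg) auto
    \<comment> \<open>The cut-off is \<open>K = (?c + 1) / e\<close>: it makes the error at most
      \<open>e\<close>, and the summand \<open>1\<close> keeps \<open>K\<close> positive when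
      \<open>?c = 0\<close>.\<close>
    have "?c / ((?c + 1) / e) = e * (?c / (?c + 1))" using e c by (simp add: field_simps)
    also have "\<dots> \<le> e * 1" using e c by (intro mult_left_mono) auto
    finally have "?c / ((?c + 1) / e) \<le> e" by simp
    then have "?I + ennreal (?c / ((?c + 1) / e)) \<le> ?I + ennreal e"
      by (intro add_left_mono ennreal_leI)
    then show "ennreal (Q (v + d) y 0) \<le> ?I + ennreal e"
      using bound[of "(?c + 1) / e"] e c by (auto intro: order_trans)
  qed
qed

text \<open>The weight \<open>k (T \<omega>)\<close> is known at time \<open>T\<close>. The
  unweighted identity \<open>base\<close> also holds on \<open>A\<close> intersected with events
  \<open>T \<in> C\<close>, so the images under \<open>T\<close> of the two weighted laws
  coincide.\<close>

lemma strong_markov_R: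
  assumes x: "0 < x" and T: "stopping_time (natural_filtration M X) T" "\<And>\<omega>. \<omega> \<in> space M \<Longrightarrow> 0 \<le> T \<omega>"
    and A: "A \<in> sets (F.pre_sigma T)" and r: "0 < r" and d: "0 < d" and k: "k \<in> borel_measurable borel"
  shows "(\<integral>\<^sup>+\<omega>\<in>A. k (T \<omega>) * ennreal (R d (X (T \<omega> + r) \<omega>)) \<partial>P x) =
    (\<integral>\<^sup>+\<omega>\<in>A. k (T \<omega>) * ennreal (R (r + d) (X (T \<omega>) \<omega>)) \<partial>P x)"
proof -
  have [measurable_cong]: "sets (P x) = sets M" by (rule sets_P[OF x])
  have Tm [measurable]: "T \<in> borel_measurable M" by (rule stopping_time_measurable[OF T(1)])
  have Am [measurable]: "A \<in> sets M" by (rule pre_sigma_subset[OF T(1) A])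
  have AM: "A \<subseteq> space M" using Am sets.sets_into_space by blast
  have XT [measurable]: "(\<lambda>\<omega>. X (T \<omega>) \<omega>) \<in> borel_measurable M"
    by (intro X_measurable_compose) (use T(2) in auto)
  have XTr [measurable]: "(\<lambda>\<omega>. X (T \<omega> + r) \<omega>) \<in> borel_measurable M"
    by (intro X_measurable_compose) (use T(2) r in \<open>auto intro: add_nonneg_nonneg\<close>)
  have base: "(\<integral>\<^sup>+\<omega>\<in>A'. ennreal (R d (X (T \<omega> + r) \<omega>)) \<partial>P x) = (\<integral>\<^sup>+\<omega>\<in>A'. ennreal (R (r + d) (X (T \<omega>) \<omega>)) \<partial>P x)"
    if A': "A' \<in> sets (F.pre_sigma T)" for A'
  proof -
    have "(\<integral>\<^sup>+\<omega>\<in>A'. ennreal (R d (X (T \<omega> + r) \<omega>)) \<partial>P x) = (\<integral>\<^sup>+\<omega>\<in>A'. ennreal (Q d (X (T \<omega> + r) \<omega>) 0) \<partial>P x)"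
    proof (rule nn_integral_cong)
      fix \<omega> assume "\<omega> \<in> space (P x)"
      then have "0 < X (T \<omega> + r) \<omega>" using positive_paths T(2) r space_P[OF x] by (simp add: add_nonneg_nonneg)
      then show "ennreal (R d (X (T \<omega> + r) \<omega>)) * indicator A' \<omega> = ennreal (Q d (X (T \<omega> + r) \<omega>) 0) * indicator A' \<omega>"
        using d by (simp add: R_eq(2))
    qed
    also have "\<dots> = (\<integral>\<^sup>+\<omega>\<in>A'. (\<integral>\<^sup>+z. ennreal (Q r (X (T \<omega>) \<omega>) z) * ennreal (Q d z 0) \<partial>m) \<partial>P x)"
      by (rule strong_markov_density[OF x T A' r]) (use d in measurable)
    also have "\<dots> = (\<integral>\<^sup>+\<omega>\<in>A'. ennreal (R (r + d) (X (T \<omega>) \<omega>)) \<partial>P x)"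
    proof (rule nn_integral_cong)
      fix \<omega> assume "\<omega> \<in> space (P x)"
      then have "0 < X (T \<omega>) \<omega>" using positive_paths T(2) space_P[OF x] by simp
      then show "(\<integral>\<^sup>+z. ennreal (Q r (X (T \<omega>) \<omega>) z) * ennreal (Q d z 0) \<partial>m) * indicator A' \<omega> =
         ennreal (R (r + d) (X (T \<omega>) \<omega>)) * indicator A' \<omega>"
        using d r by (simp add: chapman_kolmogorov_0 R_eq(2))
    qed
    finally show ?thesis .
  qed
  define N where "N g = distr (density (P x) (\<lambda>\<omega>. g \<omega> * indicator A \<omega>)) borel T" for g :: "'w \<Rightarrow> ennreal"
  have N_em: "emeasure (N g) C = (\<integral>\<^sup>+\<omega>\<in>A \<inter> (T -` C \<inter> space M). g \<omega> \<partial>P x)"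
    if [measurable]: "g \<in> borel_measurable M" "C \<in> sets borel" for g C
  proof -
    have TC: "T -` C \<inter> space M \<in> sets (P x)" using measurable_sets[OF Tm] that sets_P[OF x] by simp
    have "emeasure (N g) C = emeasure (density (P x) (\<lambda>\<omega>. g \<omega> * indicator A \<omega>)) (T -` C \<inter> space M)"
      unfolding N_def by (subst emeasure_distr) (auto simp: space_P[OF x])
    also have "\<dots> = (\<integral>\<^sup>+\<omega>. (g \<omega> * indicator A \<omega>) * indicator (T -` C \<inter> space M) \<omega> \<partial>P x)"
      by (rule emeasure_density[OF _ TC]) measurable
    also have "\<dots> = (\<integral>\<^sup>+\<omega>\<in>A \<inter> (T -` C \<inter> space M). g \<omega> \<partial>P x)"
      by (intro nn_integral_cong) (auto simp: indicator_def)
    finally show ?thesis .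
  qed
  have N_int: "(\<integral>\<^sup>+t. k t \<partial>N g) = (\<integral>\<^sup>+\<omega>\<in>A. k (T \<omega>) * g \<omega> \<partial>P x)"
    if [measurable]: "g \<in> borel_measurable M" for g
  proof -
    have "(\<integral>\<^sup>+t. k t \<partial>N g) = (\<integral>\<^sup>+\<omega>. k (T \<omega>) \<partial>density (P x) (\<lambda>\<omega>. g \<omega> * indicator A \<omega>))"
      unfolding N_def by (rule nn_integral_distr) (use k in simp_all)
    also have "\<dots> = (\<integral>\<^sup>+\<omega>. (g \<omega> * indicator A \<omega>) * k (T \<omega>) \<partial>P x)"
      by (rule nn_integral_density) (use k in measurable)
    finally show ?thesis by (simp add: mult_ac)
  qed
  have "N (\<lambda>\<omega>. ennreal (R d (X (T \<omega> + r) \<omega>))) = N (\<lambda>\<omega>. ennreal (R (r + d) (X (T \<omega>) \<omega>)))"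
  proof (rule measure_eqI)
    fix C assume "C \<in> sets (N (\<lambda>\<omega>. ennreal (R d (X (T \<omega> + r) \<omega>))))"
    then have C: "C \<in> sets borel" by (simp add: N_def)
    have "T -` C \<inter> space M \<in> sets (F.pre_sigma T)"
      using measurable_sets[OF F.measurable_stopping_time_pre_sigma[OF T(1)] C] by (simp add: F.space_pre_sigma)
    then have "A \<inter> (T -` C \<inter> space M) \<in> sets (F.pre_sigma T)" using A by (rule_tac sets.Int)
    from base[OF this] show "emeasure (N (\<lambda>\<omega>. ennreal (R d (X (T \<omega> + r) \<omega>)))) C
        = emeasure (N (\<lambda>\<omega>. ennreal (R (r + d) (X (T \<omega>) \<omega>)))) C"
      using C by (simp add: N_em)
  qed (simp add: N_def)
  then have "(\<integral>\<^sup>+t. k t \<partial>N (\<lambda>\<omega>. ennreal (R d (X (T \<omega> + r) \<omega>)))) = (\<integral>\<^sup>+t. k t \<partial>N (\<lambda>\<omega>. ennreal (R (r + d) (X (T \<omega>) \<omega>))))"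
    by simp
  then show ?thesis by (simp add: N_int)
qed

text \<open>Put \<open>v = T + r\<close>, exchange the integrals and apply
  \<open>strong_markov_R\<close> at each fixed \<open>r\<close>: Chapman-Kolmogorov turns a run of
  length \<open>r\<close> followed by the kernel of age \<open>d\<close> into the kernel of age
  \<open>r + d\<close>.\<close>

lemma strong_markov_occupation:
  assumes x: "0 < x" and T: "stopping_time (natural_filtration M X) T" "\<And>\<omega>. \<omega> \<in> space M \<Longrightarrow> 0 \<le> T \<omega>"
    and A: "A \<in> sets (F.pre_sigma T)" and d: "0 < d" and k: "k \<in> borel_measurable borel"
  shows "(\<integral>\<^sup>+\<omega>\<in>A. (\<integral>\<^sup>+v. k v * ennreal (R d (X (max 0 v) \<omega>)) * indicator {T \<omega><..} v \<partial>lborel) \<partial>P x) =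
    (\<integral>\<^sup>+\<omega>\<in>A. (\<integral>\<^sup>+r. k (T \<omega> + r) * ennreal (R (r + d) (X (T \<omega>) \<omega>)) * indicator {0<..} r \<partial>lborel) \<partial>P x)"
proof -
  have [measurable_cong]: "sets (P x) = sets M" by (rule sets_P[OF x])
  interpret P: prob_space "P x" by (rule prob_P[OF x])
  interpret pair_sigma_finite "P x" lborel ..
  note [measurable] = k
  have Tm [measurable]: "T \<in> borel_measurable M" by (rule stopping_time_measurable[OF T(1)])
  have Am [measurable]: "A \<in> sets M" by (rule pre_sigma_subset[OF T(1) A])
  have XT [measurable]: "(\<lambda>\<omega>. X (T \<omega>) \<omega>) \<in> borel_measurable M"
    by (intro X_measurable_compose) (use T(2) in auto)
  have XTr [measurable]: "(\<lambda>p. X (max 0 (T (fst p) + snd p)) (fst p)) \<in> borel_measurable (M \<Otimes>\<^sub>M lborel)"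
    by (intro X_measurable_compose) auto
  have "(\<integral>\<^sup>+\<omega>\<in>A. (\<integral>\<^sup>+v. k v * ennreal (R d (X (max 0 v) \<omega>)) * indicator {T \<omega><..} v \<partial>lborel) \<partial>P x) =
     (\<integral>\<^sup>+\<omega>. (\<integral>\<^sup>+r. k (T \<omega> + r) * ennreal (R d (X (max 0 (T \<omega> + r)) \<omega>)) * indicator {0<..} r * indicator A \<omega> \<partial>lborel) \<partial>P x)"
  proof (rule nn_integral_cong)
    fix \<omega> assume "\<omega> \<in> space (P x)"
    then have \<omega>: "\<omega> \<in> space M" using space_P[OF x] by simp
    have [measurable]: "(\<lambda>v. X (max 0 v) \<omega>) \<in> borel_measurable borel"
      by (intro X_measurable_compose) (use \<omega> in auto)
    have "(\<integral>\<^sup>+v. k v * ennreal (R d (X (max 0 v) \<omega>)) * indicator {T \<omega><..} v \<partial>lborel)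
       = (\<integral>\<^sup>+r. k (T \<omega> + r) * ennreal (R d (X (max 0 (T \<omega> + r)) \<omega>)) * indicator {T \<omega><..} (T \<omega> + r) \<partial>lborel)"
      by (subst nn_integral_real_affine[where c = 1 and t = "T \<omega>"]) auto
    also have "\<dots> = (\<integral>\<^sup>+r. k (T \<omega> + r) * ennreal (R d (X (max 0 (T \<omega> + r)) \<omega>)) * indicator {0<..} r \<partial>lborel)"
      by (intro nn_integral_cong) (auto simp: indicator_def)
    finally show "(\<integral>\<^sup>+v. k v * ennreal (R d (X (max 0 v) \<omega>)) * indicator {T \<omega><..} v \<partial>lborel) * indicator A \<omega> =
       (\<integral>\<^sup>+r. k (T \<omega> + r) * ennreal (R d (X (max 0 (T \<omega> + r)) \<omega>)) * indicator {0<..} r * indicator A \<omega> \<partial>lborel)"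
      by (subst nn_integral_multc) simp_all
  qed
  also have "\<dots> = (\<integral>\<^sup>+r. (\<integral>\<^sup>+\<omega>. k (T \<omega> + r) * ennreal (R d (X (max 0 (T \<omega> + r)) \<omega>)) * indicator {0<..} r * indicator A \<omega> \<partial>P x) \<partial>lborel)"
    by (rule Fubini'[symmetric]) measurable
  also have "\<dots> = (\<integral>\<^sup>+r. (\<integral>\<^sup>+\<omega>. k (T \<omega> + r) * ennreal (R (r + d) (X (T \<omega>) \<omega>)) * indicator {0<..} r * indicator A \<omega> \<partial>P x) \<partial>lborel)"
  proof (rule nn_integral_cong)
    fix r :: real
    show "(\<integral>\<^sup>+\<omega>. k (T \<omega> + r) * ennreal (R d (X (max 0 (T \<omega> + r)) \<omega>)) * indicator {0<..} r * indicator A \<omega> \<partial>P x) =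
       (\<integral>\<^sup>+\<omega>. k (T \<omega> + r) * ennreal (R (r + d) (X (T \<omega>) \<omega>)) * indicator {0<..} r * indicator A \<omega> \<partial>P x)"
    proof (cases "0 < r")
      case True
      have "(\<integral>\<^sup>+\<omega>. k (T \<omega> + r) * ennreal (R d (X (max 0 (T \<omega> + r)) \<omega>)) * indicator {0<..} r * indicator A \<omega> \<partial>P x)
         = (\<integral>\<^sup>+\<omega>\<in>A. k (T \<omega> + r) * ennreal (R d (X (T \<omega> + r) \<omega>)) \<partial>P x)"
      proof (rule nn_integral_cong)
        fix \<omega> assume "\<omega> \<in> space (P x)"
        then have "0 \<le> T \<omega> + r" using T(2) space_P[OF x] True by (simp add: add_nonneg_nonneg)
        then show "k (T \<omega> + r) * ennreal (R d (X (max 0 (T \<omega> + r)) \<omega>)) * indicator {0<..} r * indicator A \<omega> =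
          k (T \<omega> + r) * ennreal (R d (X (T \<omega> + r) \<omega>)) * indicator A \<omega>" using True by (simp add: max_def)
      qed
      also have "\<dots> = (\<integral>\<^sup>+\<omega>\<in>A. k (T \<omega> + r) * ennreal (R (r + d) (X (T \<omega>) \<omega>)) \<partial>P x)"
        by (rule strong_markov_R[OF x T A True d, where k = "\<lambda>t. k (t + r)"]) measurable
      finally show ?thesis using True by simp
    qed simp
  qed
  also have "\<dots> = (\<integral>\<^sup>+\<omega>. (\<integral>\<^sup>+r. k (T \<omega> + r) * ennreal (R (r + d) (X (T \<omega>) \<omega>)) * indicator {0<..} r * indicator A \<omega> \<partial>lborel) \<partial>P x)"
    by (rule Fubini') measurable
  also have "\<dots> = (\<integral>\<^sup>+\<omega>\<in>A. (\<integral>\<^sup>+r. k (T \<omega> + r) * ennreal (R (r + d) (X (T \<omega>) \<omega>)) * indicator {0<..} r \<partial>lborel) \<partial>P x)"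
    by (intro nn_integral_cong nn_integral_multc) measurable
  finally show ?thesis .
qed

lemma expectation_R:
  assumes "0 < v" "0 < d" "0 < x"
  shows "(\<integral>\<^sup>+\<omega>. ennreal (R d (X v \<omega>)) \<partial>P x) = ennreal (R (v + d) x)"
proof -
  have "(\<integral>\<^sup>+\<omega>. ennreal (R d (X v \<omega>)) \<partial>P x) = (\<integral>\<^sup>+z. ennreal (Q v x z) * ennreal (R d z) \<partial>m)"
    using assms by (intro nn_integral_law) auto
  also have "\<dots> = (\<integral>\<^sup>+z. ennreal (Q v x z) * ennreal (Q d z 0) \<partial>m)"
    by (rule nn_integral_cong_AE) (use AE_m_pos assms in \<open>auto simp: R_eq(2)\<close>)
  finally show ?thesis using assms by (simp add: chapman_kolmogorov_0 R_eq(2))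
qed

lemma R_tendsto_0: "0 < c \<Longrightarrow> (\<lambda>n. R (1 / real (Suc n)) c) \<longlonglongrightarrow> 0"
proof -
  assume c: "0 < c"
  have "filterlim (\<lambda>n. 1 / real (Suc n)) (at_right 0) sequentially"
    unfolding filterlim_at by (intro conjI LIMSEQ_Suc[OF lim_1_over_n]) auto
  from filterlim_compose[OF q_small_time[OF c] this] show ?thesis
    using c by (simp add: R_eq(1))
qed

subsection \<open>Change in time of the mass beyond a level\<close>

lemma integrable_Q: "0 < t \<Longrightarrow> 0 < x \<Longrightarrow> integrable m (\<lambda>y. Q t x y)"
  using Q_mass[of t x] by (intro integrableI_nonneg) (auto simp: Q_nonneg intro: le_less_trans)

lemma integrable_Q_mult:
  assumes "0 < t" "0 < x" "g \<in> borel_measurable borel" "\<And>y. \<bar>g y\<bar> \<le> C"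
  shows "integrable m (\<lambda>y. Q t x y * g y)"
proof (rule Bochner_Integration.integrable_bound[OF integrable_mult_right[OF integrable_Q[OF assms(1,2)], of C]])
  have "\<bar>Q t x y * g y\<bar> \<le> \<bar>C * Q t x y\<bar>" for y
    using mult_left_mono[OF assms(4)[of y] Q_nonneg[OF assms(1), of x y]]
    by (metis abs_ge_self abs_mult abs_of_nonneg[OF Q_nonneg[OF assms(1)]] mult.commute order_trans)
  then show "AE y in m. norm (Q t x y * g y) \<le> norm (C * Q t x y)" by simp
qed (use assms in measurable)

definition q_y :: "real \<Rightarrow> real \<Rightarrow> real \<Rightarrow> real" where "q_y t y x = deriv (\<lambda>y. q t y x) y"

lemma q_y_continuous: "0 < x \<Longrightarrow> 0 < y \<Longrightarrow> 0 < a \<Longrightarrow> continuous_on {a..b} (\<lambda>t. q_y t y x)"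
  using continuous_on_slice(1)[OF parabolicD(5)[OF parabolic_q[of x a b]], of y] by (simp add: q_y_def)

lemma q_time_continuous: "0 < x \<Longrightarrow> 0 < y \<Longrightarrow> 0 < a \<Longrightarrow> continuous_on {a..b} (\<lambda>t. q t y x)"
  using continuous_on_slice(1)[OF parabolicD(4)[OF parabolic_q[of x a b]], of y] by simp

lemma mass_below_change:
  assumes x: "0 < x" and ab: "0 < a" "a \<le> b" and d: "0 < d"
  shows "(LINT y:{0<..d}|m. Q b x y) - (LINT y:{0<..d}|m. Q a x y) = integral {a..b} (\<lambda>t. q_y t d x) / deriv s d"
proof -
  obtain A where A: "\<And>t y. t \<in> {a..b} \<Longrightarrow> 0 \<le> y \<Longrightarrow> y \<le> d \<Longrightarrow> \<bar>q t y x\<bar> \<le> A"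
    using q_bounded[OF ab(1), of x b d] x by (meson less_imp_le)
  have "(LINT y:{0<..d}|m. Q b x y) - (LINT y:{0<..d}|m. Q a x y) = (LINT y:{0<..d}|m. Q b x y - Q a x y)"
    using integrable_mult_indicator[OF _ integrable_Q, of "{0<..d}"] x ab
    by (intro set_integral_diff(2)[symmetric]) (auto simp: set_integrable_def)
  also have "\<dots> = (LINT y:{0<..d}|m. q b y x * 1 - q a y x * 1)"
    by (rule set_lebesgue_integral_cong) (use x ab in \<open>auto simp: Q_eq q_sym\<close>)
  also have "\<dots> = integral {a..b} (\<lambda>t. flux (\<lambda>t y. q t y x) (\<lambda>t. deriv (\<lambda>y. q t y x)) (\<lambda>_ _. 1) (\<lambda>_ _. 0) t d)"
    by (rule green_from_0[OF parabolic_q parabolic_one ab(2) d, of _ A 1]) (use A x ab in auto)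
  also have "\<dots> = integral {a..b} (\<lambda>t. q_y t d x) / deriv s d"
    by (simp add: flux_def q_y_def)
  finally show ?thesis .
qed

text \<open>\<open>N_above x d v t\<close> is the expectation of \<open>q(v - t, X\<^sub>t, 0)\<close> under \<open>P x\<close> on \<open>X\<^sub>t > d\<close>, and \<open>0\<close> for \<open>v \<le> t\<close>.\<close>

definition N_above :: "real \<Rightarrow> real \<Rightarrow> real \<Rightarrow> real \<Rightarrow> real" where
  "N_above x d v t = (LINT y:{d<..}|m. Q t x y * R (v - t) y)"

lemma integrable_N_above:
  assumes "0 < x" "0 < t" "0 < d"
  shows "set_integrable m {d<..} (\<lambda>y. Q t x y * R (v - t) y)"
proof -
  have "integrable m (\<lambda>y. Q t x y * (indicator {d<..} y * R (v - t) y))"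
  proof (rule integrable_Q_mult[where C = "R (v - t) d"])
    show "\<bar>indicator {d<..} y * R (v - t) y\<bar> \<le> R (v - t) d" for y
      using R_antimono[of d y "v - t"] assms R_nonneg by (auto simp: indicator_def)
  qed (use assms in auto)
  then show ?thesis by (simp add: set_integrable_def mult_ac)
qed

lemma N_above_nonneg: "0 < t \<Longrightarrow> 0 \<le> N_above x d v t"
  unfolding N_above_def set_lebesgue_integral_def
  by (rule integral_nonneg_AE) (auto simp: indicator_def intro!: mult_nonneg_nonneg Q_nonneg R_nonneg)

lemma N_above_le:
  assumes "0 < x" "0 < t" "0 < d"
  shows "N_above x d v t \<le> R (v - t) d"
proof -
  have "N_above x d v t \<le> (LINT y|m. R (v - t) d * Q t x y)"
    unfolding N_above_def set_lebesgue_integral_def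
  proof (rule integral_mono)
    show "integrable m (\<lambda>y. indicator {d<..} y *\<^sub>R (Q t x y * R (v - t) y))"
      using integrable_N_above[OF assms] by (simp add: set_integrable_def)
    show "integrable m (\<lambda>y. R (v - t) d * Q t x y)"
      by (rule integrable_mult_right[OF integrable_Q[OF assms(2,1)]])
    fix y
    show "indicator {d<..} y *\<^sub>R (Q t x y * R (v - t) y) \<le> R (v - t) d * Q t x y"
      using mult_left_mono[OF R_antimono[of d y "v - t"] Q_nonneg[of t x y]] assms Q_nonneg[of t x y] R_nonneg[of "v - t" d]
      by (auto simp: indicator_def mult_ac)
  qed
  also have "\<dots> = R (v - t) d * (LINT y|m. Q t x y)" by simp
  also have "\<dots> \<le> R (v - t) d * 1"
  proof (rule mult_left_mono)
    have "ennreal (LINT y|m. Q t x y) \<le> 1"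
      using Q_mass[of t x] assms nn_integral_eq_integral[OF integrable_Q[of t x]] by (simp add: Q_nonneg)
    then show "(LINT y|m. Q t x y) \<le> 1" by simp
  qed (rule R_nonneg)
  finally show ?thesis by simp
qed

text \<open>By \<open>chapman_kolmogorov_0\<close> the mass on the whole half-line is
  \<open>R v x\<close> at every \<open>t < v\<close>. The unbounded part is thus traded for the
  interval \<open>{0<..d}\<close>, where Green's formula is available.\<close>

lemma N_above_eq:
  assumes "0 < x" "0 < t" "t < v" "0 < d"
  shows "N_above x d v t = R v x - (LINT y:{0<..d}|m. q t y x * q (v - t) y 0)"
    and "set_integrable m {0<..d} (\<lambda>y. q t y x * q (v - t) y 0)"
proof -
  have meas: "(\<lambda>y. Q t x y * R (v - t) y) \<in> borel_measurable m" using assms by measurable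
  have "(\<integral>\<^sup>+y. ennreal (Q t x y * R (v - t) y) \<partial>m) = (\<integral>\<^sup>+y. ennreal (Q t x y) * ennreal (Q (v - t) y 0) \<partial>m)"
    by (rule nn_integral_cong_AE) (use AE_m_pos assms in \<open>auto simp: R_eq(2) ennreal_mult Q_nonneg\<close>)
  also have "\<dots> = ennreal (R v x)" using assms by (simp add: chapman_kolmogorov_0 R_eq(2))
  finally have nn: "(\<integral>\<^sup>+y. ennreal (Q t x y * R (v - t) y) \<partial>m) = ennreal (R v x)" .
  have int: "integrable m (\<lambda>y. Q t x y * R (v - t) y)"
    using nn meas assms by (intro integrableI_nonneg) (auto simp: Q_nonneg R_nonneg)
  have val: "(LINT y|m. Q t x y * R (v - t) y) = R v x"
    using nn nn_integral_eq_integral[OF int] assms by (simp add: Q_nonneg R_nonneg Bochner_Integration.integral_nonneg)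
  have s1: "set_integrable m {0<..d} (\<lambda>y. Q t x y * R (v - t) y)"
    using integrable_mult_indicator[OF _ int] by (simp add: set_integrable_def)
  have cong: "indicator {0<..d} y *\<^sub>R (Q t x y * R (v - t) y) = indicator {0<..d} y *\<^sub>R (q t y x * q (v - t) y 0)" for y
    using assms by (auto simp: indicator_def R_eq(1) Q_eq q_sym)
  show "set_integrable m {0<..d} (\<lambda>y. q t y x * q (v - t) y 0)"
    using s1 unfolding set_integrable_def cong .
  have "R v x = (LINT y:{0<..d} \<union> {d<..}|m. Q t x y * R (v - t) y)"
    unfolding val[symmetric] set_lebesgue_integral_def
  proof (rule integral_cong_AE)
    show "AE y in m. Q t x y * R (v - t) y = indicator ({0<..d} \<union> {d<..}) y *\<^sub>R (Q t x y * R (v - t) y)"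
      using AE_m_pos by eventually_elim (auto simp: indicator_def)
  qed (use meas in measurable)
  also have "\<dots> = (LINT y:{0<..d}|m. Q t x y * R (v - t) y) + N_above x d v t"
    unfolding N_above_def by (intro set_integral_Un s1 integrable_N_above) (use assms in auto)
  also have "(LINT y:{0<..d}|m. Q t x y * R (v - t) y) = (LINT y:{0<..d}|m. q t y x * q (v - t) y 0)"
    unfolding set_lebesgue_integral_def cong ..
  finally show "N_above x d v t = R v x - (LINT y:{0<..d}|m. q t y x * q (v - t) y 0)" by simp
qed

text \<open>\<open>s'(d)\<close> times the flux through the level \<open>d\<close> for the forward
  solution \<open>q(t, y, x)\<close> and the backward solution
  \<open>q(v - t, y, 0)\<close>.\<close>

definition level_flux :: "real \<Rightarrow> real \<Rightarrow> real \<Rightarrow> real \<Rightarrow> real" where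
  "level_flux x d v t = q_y t d x * R (v - t) d - q t d x * R' (v - t) d"

text \<open>What is gained below the level is lost above it, and \<open>green_from_0\<close>
  computes the gain. Its sign condition holds because the kernel with pole \<open>0\<close>
  decreases in \<open>y\<close>; \<open>b < v\<close> keeps the age of the kernel positive.\<close>

lemma N_above_change_before:
  assumes x: "0 < x" and ab: "0 < a" "a \<le> b" "b < v" and d: "0 < d"
  shows "N_above x d v b - N_above x d v a = - ((LINT t:{a..b}|lborel. level_flux x d v t) / deriv s d)"
proof -
  obtain A where A: "\<And>t y. t \<in> {a..b} \<Longrightarrow> 0 \<le> y \<Longrightarrow> y \<le> d \<Longrightarrow> \<bar>q t y x\<bar> \<le> A"
    using q_bounded[OF ab(1), of x b d] x by (meson less_imp_le)
  have vb: "0 < v - b" using ab by simp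
  obtain B where B: "\<And>t y. t \<in> {v - b..v - a} \<Longrightarrow> 0 \<le> y \<Longrightarrow> y \<le> d \<Longrightarrow> \<bar>q t y 0\<bar> \<le> B"
    using q_bounded[OF vb, of 0 "v - a" d] by blast
  have par: "parabolic 1 (v - b) (v - a) (\<lambda>t y. q t y 0) (\<lambda>t y. deriv (\<lambda>r. q r y 0) t) (\<lambda>t. deriv (\<lambda>y. q t y 0))"
    by (rule parabolic_q[OF order_refl vb])
  have px: "parabolic 1 a b (\<lambda>t y. q t y x) (\<lambda>t y. deriv (\<lambda>r. q r y x) t) (\<lambda>t. deriv (\<lambda>y. q t y x))"
    by (rule parabolic_q[OF less_imp_le[OF x] ab(1)])
  have eqf: "flux (\<lambda>t y. q t y x) (\<lambda>t. deriv (\<lambda>y. q t y x)) (\<lambda>t y. q (v - t) y 0) (\<lambda>t. deriv (\<lambda>y. q (v - t) y 0)) t d = level_flux x d v t / deriv s d"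
    if "t \<in> {a..b}" for t
    using that ab d by (simp add: flux_def level_flux_def q_y_def R_eq(1) R'_eq)
  have "N_above x d v b - N_above x d v a = - ((LINT y:{0<..d}|m. q b y x * q (v - b) y 0) - (LINT y:{0<..d}|m. q a y x * q (v - a) y 0))"
    using N_above_eq(1)[OF x, of a v d] N_above_eq(1)[OF x, of b v d] ab d by simp
  also have "(LINT y:{0<..d}|m. q b y x * q (v - b) y 0) - (LINT y:{0<..d}|m. q a y x * q (v - a) y 0)
     = (LINT y:{0<..d}|m. q b y x * q (v - b) y 0 - q a y x * q (v - a) y 0)"
    by (intro set_integral_diff(2)[symmetric] N_above_eq(2) x) (use ab d in auto)
  also have "\<dots> = integral {a..b} (\<lambda>t. flux (\<lambda>t y. q t y x) (\<lambda>t. deriv (\<lambda>y. q t y x)) (\<lambda>t y. q (v - t) y 0) (\<lambda>t. deriv (\<lambda>y. q (v - t) y 0)) t d)"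
  proof (rule green_from_0[OF px parabolic_time_reversal[OF par] ab(2) d, of A B])
    show "deriv (\<lambda>y. q (v - t) y 0) y \<le> 0" if "t \<in> {a..b}" "0 < y" "y \<le> d" for t y
      using R'_nonpos[of "v - t" y] that ab by (simp add: R'_eq)
  qed (use A B in auto)
  also have "\<dots> = integral {a..b} (\<lambda>t. level_flux x d v t / deriv s d)"
    by (rule integral_cong) (rule eqf)
  also have "\<dots> = integral {a..b} (\<lambda>t. level_flux x d v t) / deriv s d" by simp
  also have "integral {a..b} (\<lambda>t. level_flux x d v t) = (LINT t:{a..b}|lborel. level_flux x d v t)"
  proof (rule set_borel_integral_eq_integral(2)[symmetric])
    have "continuous_on {a..b} (\<lambda>t. flux (\<lambda>t y. q t y x) (\<lambda>t. deriv (\<lambda>y. q t y x)) (\<lambda>t y. q (v - t) y 0) (\<lambda>t. deriv (\<lambda>y. q (v - t) y 0)) t d * deriv s d)"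
      using continuous_on_slice(1)[OF flux_continuous[OF px parabolic_time_reversal[OF par]], of d] d
      by (intro continuous_intros) auto
    then have "continuous_on {a..b} (\<lambda>t. level_flux x d v t)"
      by (rule continuous_on_cong[THEN iffD1, rotated -1]) (use eqf scale(3)[OF d] in auto)
    then show "set_integrable lborel {a..b} (\<lambda>t. level_flux x d v t)" by (rule borel_integrable_atLeastAtMost')
  qed
  finally show ?thesis .
qed

lemma set_integrable_level_flux:
  assumes "0 < x" "0 < a" "0 < d"
  shows "set_integrable lborel {a..b} (\<lambda>t. level_flux x d v t)"
  unfolding level_flux_def
  by (intro set_integral_diff(1) set_integrable_convolution q_y_continuous q_time_continuous integrable_R integrable_R' assms)

text \<open>
  Here \<open>v\<close> may also lie in \<open>{a..b}\<close> or below \<open>a\<close>, since \<open>R\<close> and \<open>R'\<close> vanish at nonpositive times.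
\<close>

lemma N_above_change:
  assumes x: "0 < x" and ab: "0 < a" "a \<le> b" and d: "0 < d"
  shows "N_above x d v b - N_above x d v a = - ((LINT t:{a..b}|lborel. level_flux x d v t) / deriv s d)"
proof -
  have N_0: "N_above x d v t = 0" if "v \<le> t" for t using that by (simp add: N_above_def R_0)
  have level_flux_0: "level_flux x d v t = 0" if "v \<le> t" for t using that by (simp add: level_flux_def R_0)
  consider "v \<le> a" | "a < v" "v \<le> b" | "b < v" by linarith
  then show ?thesis
  proof cases
    case 1
    have "(LINT t:{a..b}|lborel. level_flux x d v t) = (LINT t:{a..b}|lborel. 0)"
      by (rule set_lebesgue_integral_cong) (use 1 level_flux_0 in auto)
    then show ?thesis using 1 ab by (simp add: N_0)
  next
    case 3
    then show ?thesis by (rule N_above_change_before[OF x ab _ d])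
  next
    case 2
    \<comment> \<open>Times increasing to \<open>v\<close>, starting from \<open>a\<close> for
      \<open>n = 0\<close>, at which the previous lemma applies.\<close>
    define c where "c n = v - (v - a) / real (Suc n)" for n
    have c: "a \<le> c n" "c n < v" for n
    proof -
      have "(v - a) / real (Suc n) \<le> (v - a) / 1" by (rule divide_left_mono) (use 2 in auto)
      moreover have "0 < (v - a) / real (Suc n)" using 2 by simp
      ultimately show "a \<le> c n" "c n < v" by (simp_all add: c_def)
    qed
    have cl: "c \<longlonglongrightarrow> v"
    proof -
      have "(\<lambda>n. v - (v - a) * (1 / real (Suc n))) \<longlonglongrightarrow> v - (v - a) * 0"
        by (intro tendsto_intros LIMSEQ_Suc[OF lim_1_over_n])
      then show ?thesis by (simp add: c_def[abs_def])
    qed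
    have eq: "N_above x d v (c n) - N_above x d v a = - ((LINT t:{a..c n}|lborel. level_flux x d v t) / deriv s d)" for n
      by (rule N_above_change_before[OF x ab(1) c d])
    \<comment> \<open>Above \<open>d\<close> the kernel is at most its value at \<open>d\<close>,
      which vanishes as its age tends to \<open>0\<close>. So the mass dies continuously at time
      \<open>v\<close>, without a jump.\<close>
    have N0: "(\<lambda>n. N_above x d v (c n)) \<longlonglongrightarrow> 0"
    proof (rule tendsto_sandwich[of "\<lambda>_. 0" _ _ "\<lambda>n. R (v - c n) d"])
      have "filterlim (\<lambda>n. v - c n) (at_right 0) sequentially"
        unfolding filterlim_at
      proof (intro conjI)
        show "(\<lambda>n. v - c n) \<longlonglongrightarrow> 0" using tendsto_diff[OF tendsto_const[of v] cl] by simp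
        show "eventually (\<lambda>n. v - c n \<in> {0<..} \<and> v - c n \<noteq> 0) sequentially"
        proof (intro always_eventually allI)
          show "v - c n \<in> {0<..} \<and> v - c n \<noteq> 0" for n using c(2)[of n] by simp
        qed
      qed
      from filterlim_compose[OF q_small_time[OF d] this] show "(\<lambda>n. R (v - c n) d) \<longlonglongrightarrow> 0"
        using c(2) d by (simp add: R_eq(1))
      show "eventually (\<lambda>n. 0 \<le> N_above x d v (c n)) sequentially"
      proof (intro always_eventually allI)
        show "0 \<le> N_above x d v (c n)" for n by (rule N_above_nonneg[OF less_le_trans[OF ab(1) c(1)]])
      qed
      show "eventually (\<lambda>n. N_above x d v (c n) \<le> R (v - c n) d) sequentially"
      proof (intro always_eventually allI)
        show "N_above x d v (c n) \<le> R (v - c n) d" for n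
          by (rule N_above_le[OF x less_le_trans[OF ab(1) c(1)] d])
      qed
    qed simp
    have I: "(\<lambda>n. LINT t:{a..c n}|lborel. level_flux x d v t) \<longlonglongrightarrow> (LINT t:{a..b}|lborel. level_flux x d v t)"
      unfolding set_lebesgue_integral_def
    proof (rule integral_dominated_convergence[where w = "\<lambda>t. \<bar>indicator {a..b} t *\<^sub>R level_flux x d v t\<bar>"])
      have int: "integrable lborel (\<lambda>t. indicator {a..b} t *\<^sub>R level_flux x d v t)"
        using set_integrable_level_flux[OF x ab(1) d, of b v] by (simp add: set_integrable_def)
      then show "integrable lborel (\<lambda>t. \<bar>indicator {a..b} t *\<^sub>R level_flux x d v t\<bar>)" by (rule integrable_abs)
      show "(\<lambda>t. indicator {a..b} t *\<^sub>R level_flux x d v t) \<in> borel_measurable lborel"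
        using int by (rule borel_measurable_integrable)
      show "(\<lambda>t. indicator {a..c n} t *\<^sub>R level_flux x d v t) \<in> borel_measurable lborel" for n
        using borel_measurable_integrable[OF set_integrable_level_flux[OF x ab(1) d, of "c n" v, unfolded set_integrable_def]] .
      show "AE t in lborel. (\<lambda>n. indicator {a..c n} t *\<^sub>R level_flux x d v t) \<longlonglongrightarrow> indicator {a..b} t *\<^sub>R level_flux x d v t"
      proof (intro AE_I2)
        fix t
        show "(\<lambda>n. indicator {a..c n} t *\<^sub>R level_flux x d v t) \<longlonglongrightarrow> indicator {a..b} t *\<^sub>R level_flux x d v t"
        proof (cases "t < v")
          case True
          have "eventually (\<lambda>n. t < c n) sequentially" using order_tendstoD(1)[OF cl True] .
          then have "eventually (\<lambda>n. indicator {a..c n} t *\<^sub>R level_flux x d v t = indicator {a..b} t *\<^sub>R level_flux x d v t) sequentially"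
            by (rule eventually_mono) (use True 2 in \<open>auto simp: indicator_def\<close>)
          then show ?thesis by (rule tendsto_eventually)
        qed (simp add: level_flux_0)
      qed
      show "AE t in lborel. norm (indicator {a..c n} t *\<^sub>R level_flux x d v t) \<le> \<bar>indicator {a..b} t *\<^sub>R level_flux x d v t\<bar>" for n
        using c(2)[of n] 2 by (intro AE_I2) (auto simp: indicator_def)
    qed
    have "(\<lambda>n. N_above x d v (c n) - N_above x d v a) \<longlonglongrightarrow> 0 - N_above x d v a"
      by (intro tendsto_intros N0)
    moreover have "(\<lambda>n. - ((LINT t:{a..c n}|lborel. level_flux x d v t) / deriv s d)) \<longlonglongrightarrow> - ((LINT t:{a..b}|lborel. level_flux x d v t) / deriv s d)"
      using scale(3)[OF d] by (intro tendsto_intros I) auto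
    ultimately have "0 - N_above x d v a = - ((LINT t:{a..b}|lborel. level_flux x d v t) / deriv s d)"
      unfolding eq by (rule LIMSEQ_unique)
    then show ?thesis using 2 by (simp add: N_0)
  qed
qed

end

subsection \<open>Passage probabilities\<close>

locale last_passage_problem = entrance_diffusion M P X s \<rho> q
  for M :: "'w measure" and P :: "real \<Rightarrow> 'w measure" and X :: "real \<Rightarrow> 'w \<Rightarrow> real"
    and s \<rho> :: "real \<Rightarrow> real" and q :: "real \<Rightarrow> real \<Rightarrow> real \<Rightarrow> real" +
  fixes h h' f :: "real \<Rightarrow> real"
  assumes h: "\<And>t. 0 \<le> t \<Longrightarrow> 0 < h t" "bounded (h ` {0..})"
      "\<And>t. 0 \<le> t \<Longrightarrow> (h has_real_derivative h' t) (at t within {0..})"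
      "bounded (h' ` {0..})"
    and f: "\<And>t. 0 \<le> t \<Longrightarrow> 0 < f t" "continuous_on {0..} f"
      "\<And>t. 0 \<le> t \<Longrightarrow> (LINT u:{0<..}|lborel. h (t + u) * q u (f t) 0) = 1"
begin

section \<open>The weighted potential \<open>H\<close> and the boundedness of the curve\<close>

text \<open>Frozen at \<open>h 0\<close> for negative times, it stays bounded, continuous and
  Lipschitz on the whole line.\<close>

definition hh :: "real \<Rightarrow> real" where "hh t = h (max 0 t)"

definition h_bound :: real where "h_bound = (SOME C. \<forall>t\<ge>0. \<bar>h t\<bar> \<le> C)"

definition h_lip :: real where "h_lip = (SOME C. \<forall>t\<ge>0. \<bar>h' t\<bar> \<le> C)"

lemma hh_bound: "\<bar>hh t\<bar> \<le> h_bound"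
proof -
  have "\<exists>C. \<forall>t\<ge>0. \<bar>h t\<bar> \<le> C" using h(2) by (auto simp: bounded_iff)
  from someI_ex[OF this] show ?thesis by (simp add: hh_def h_bound_def)
qed

lemma h'_bound: "0 \<le> t \<Longrightarrow> \<bar>h' t\<bar> \<le> h_lip"
proof -
  have "\<exists>C. \<forall>t\<ge>0. \<bar>h' t\<bar> \<le> C" using h(4) by (auto simp: bounded_iff)
  from someI_ex[OF this] show "0 \<le> t \<Longrightarrow> \<bar>h' t\<bar> \<le> h_lip" by (simp add: h_lip_def)
qed

lemma h_bound_nonneg: "0 \<le> h_bound" and h_lip_nonneg: "0 \<le> h_lip"
  using hh_bound[of 0] h'_bound[of 0] by auto

lemma hh_nonneg: "0 \<le> hh t"
  using h(1)[of "max 0 t"] by (simp add: hh_def)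

lemma hh_lip: "\<bar>hh t - hh u\<bar> \<le> h_lip * \<bar>t - u\<bar>"
proof -
  have "norm (h (max 0 t) - h (max 0 u)) \<le> h_lip * norm (max 0 t - max 0 u)"
    by (rule field_differentiable_bound[where S = "{0..}" and f' = h'])
       (use h(3) h'_bound in auto)
  also have "\<dots> \<le> h_lip * \<bar>t - u\<bar>"
    using h_lip_nonneg by (intro mult_left_mono) auto
  finally show ?thesis by (simp add: hh_def)
qed

lemma hh_continuous: "continuous_on UNIV hh"
proof -
  have "continuous_on {0..} h" using h(3) by (intro DERIV_continuous_on) auto
  then have "continuous_on UNIV (\<lambda>t. h (max 0 t))"
    by (rule continuous_on_compose2) (auto intro!: continuous_intros)
  then show ?thesis by (simp add: hh_def[abs_def])
qed

lemma hh_measurable [measurable]: "hh \<in> borel_measurable borel"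
  by (rule borel_measurable_continuous_onI[OF hh_continuous])

definition H :: "real \<Rightarrow> real \<Rightarrow> real" where "H t y = (LINT u|lborel. hh (t + u) * R u y)"

lemma integrable_H: "0 < y \<Longrightarrow> integrable lborel (\<lambda>u. hh (t + u) * R u y)"
  by (rule integrable_bounded_mult[OF integrable_R]) (auto intro: hh_bound)

lemma nn_integral_H: "0 < y \<Longrightarrow> (\<integral>\<^sup>+u. ennreal (hh (t + u) * R u y) \<partial>lborel) = ennreal (H t y)"
  unfolding H_def by (rule nn_integral_eq_integral[OF integrable_H]) (auto simp: hh_nonneg R_nonneg)

lemma H_nonneg: "0 \<le> H t y"
  unfolding H_def by (rule integral_nonneg_AE) (auto simp: hh_nonneg R_nonneg)

lemma H_antimono: "0 < y \<Longrightarrow> y \<le> z \<Longrightarrow> H t z \<le> H t y"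
  unfolding H_def by (intro integral_mono integrable_H mult_left_mono R_antimono hh_nonneg) auto

lemma H_le: "0 < y \<Longrightarrow> H t y \<le> h_bound * U y"
proof -
  assume y: "0 < y"
  have "H t y \<le> (LINT u|lborel. h_bound * R u y)"
    unfolding H_def using y hh_bound
    by (intro integral_mono integrable_H integrable_mult_right integrable_R mult_right_mono R_nonneg)
       (auto intro: order_trans[OF abs_ge_self])
  then show ?thesis using y by (simp add: U_def)
qed

lemma H_lip: "0 < y \<Longrightarrow> \<bar>H t y - H t' y\<bar> \<le> h_lip * \<bar>t - t'\<bar> * U y"
proof -
  assume y: "0 < y"
  have eq: "H t y - H t' y = (LINT u|lborel. hh (t + u) * R u y - hh (t' + u) * R u y)"
    unfolding H_def by (rule Bochner_Integration.integral_diff[symmetric]; rule integrable_H[OF y])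
  have "\<bar>H t y - H t' y\<bar> \<le> (LINT u|lborel. \<bar>hh (t + u) * R u y - hh (t' + u) * R u y\<bar>)"
    unfolding eq by (rule integral_abs_bound)
  also have "\<dots> \<le> (LINT u|lborel. h_lip * \<bar>t - t'\<bar> * R u y)"
  proof (rule integral_mono)
    show "integrable lborel (\<lambda>u. \<bar>hh (t + u) * R u y - hh (t' + u) * R u y\<bar>)"
      by (rule integrable_abs[OF Bochner_Integration.integrable_diff[OF integrable_H[OF y] integrable_H[OF y]]])
    show "integrable lborel (\<lambda>u. h_lip * \<bar>t - t'\<bar> * R u y)"
      by (intro integrable_mult_right integrable_R y)
    fix u
    have "\<bar>hh (t + u) * R u y - hh (t' + u) * R u y\<bar> = \<bar>hh (t + u) - hh (t' + u)\<bar> * R u y"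
      by (simp add: left_diff_distrib[symmetric] abs_mult R_nonneg)
    also have "\<dots> \<le> h_lip * \<bar>t - t'\<bar> * R u y"
      using hh_lip[of "t + u" "t' + u"] by (intro mult_right_mono R_nonneg) auto
    finally show "\<bar>hh (t + u) * R u y - hh (t' + u) * R u y\<bar> \<le> h_lip * \<bar>t - t'\<bar> * R u y" .
  qed
  finally show ?thesis by (simp add: U_def)
qed

lemma H_eq_set_integral:
  assumes "0 \<le> t" "0 < y"
  shows "(LINT u:{0<..}|lborel. h (t + u) * q u y 0) = H t y"
  unfolding H_def set_lebesgue_integral_def
  by (intro Bochner_Integration.integral_cong) (use assms in \<open>auto simp: indicator_def R_def hh_def\<close>)

lemma H_f: "0 \<le> t \<Longrightarrow> H t (f t) = 1"
  using f(3)[of t] H_eq_set_integral[of t "f t"] f(1)[of t] by simp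

lemma H_le_1: "0 \<le> t \<Longrightarrow> f t \<le> y \<Longrightarrow> H t y \<le> 1"
  using H_antimono[of "f t" y t] H_f f(1) by simp

lemma H_ge_1: "0 \<le> t \<Longrightarrow> 0 < y \<Longrightarrow> y \<le> f t \<Longrightarrow> 1 \<le> H t y"
  using H_antimono[of y "f t" t] H_f by simp

text \<open>\<open>H t y\<close> is at most \<open>h_bound * (scale_sup - s y)\<close>, which is
  below \<open>1\<close> for some \<open>y\<close> chosen independently of \<open>t\<close>; the
  curve, on which \<open>H = 1\<close>, cannot rise above that \<open>y\<close>.\<close>

lemma f_bounded: "\<exists>K. \<forall>t\<ge>0. f t \<le> K"
proof -
  obtain y where y: "0 < y" "scale_sup - s y < 1 / (h_bound + 1)"
    using scale_near_sup[of "1 / (h_bound + 1)"] h_bound_nonneg by (auto simp: add_nonneg_pos)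
  have "h_bound * U y \<le> h_bound * (1 / (h_bound + 1))"
    using U_le[OF y(1)] y h_bound_nonneg by (intro mult_left_mono) auto
  also have "\<dots> < 1" using h_bound_nonneg by (simp add: field_simps)
  finally have lt: "h_bound * U y < 1" .
  have "f t \<le> y" if "0 \<le> t" for t
    using H_ge_1[OF that y(1)] H_le[OF y(1), of t] lt by (cases "f t \<le> y") auto
  then show ?thesis by blast
qed

text \<open>The expected occupation after \<open>t\<close> given \<open>X\<^sub>t = y\<close>,
  weighted with \<open>hh\<close> and the kernel of age \<open>d\<close>; it replaces
  \<open>H\<close> as long as \<open>d\<close> is positive.\<close>

definition H_shift :: "real \<Rightarrow> real \<Rightarrow> real \<Rightarrow> real" where
  "H_shift d t y = (LINT u|lborel. indicator {0<..} u * hh (t + u) * R (u + d) y)"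

text \<open>With \<open>w = u + d\<close>, passing from \<open>H_shift\<close> to \<open>H\<close>
  moves the argument of \<open>hh\<close> by \<open>d\<close>, which costs \<open>h_lip * d\<close>,
  and restores the ages \<open>w \<le> d\<close>, which cost \<open>h_bound\<close>. Monotonicity of
  the kernel makes the bound uniform over \<open>y \<ge> c\<close>.\<close>

definition shift_error :: "real \<Rightarrow> real \<Rightarrow> real" where
  "shift_error d c = (LINT w|lborel. (h_lip * d + h_bound * indicator {..d} w) * R w c)"

lemma integrable_H_shift:
  assumes "0 < y"
  shows "integrable lborel (\<lambda>u. indicator {0<..} u * hh (t + u) * R (u + d) y)"
proof (rule integrable_bounded_mult)
  have "integrable lborel (\<lambda>u. R (d + 1 * u) y)"
    by (rule lborel_integrable_real_affine[OF integrable_R[OF assms]]) simp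
  then show "integrable lborel (\<lambda>u. R (u + d) y)" by (simp add: add.commute)
  show "\<bar>indicator {0<..} u * hh (t + u)\<bar> \<le> h_bound" for u
    using hh_bound[of "t + u"] h_bound_nonneg by (auto simp: indicator_def)
qed simp

lemma nn_integral_H_shift:
  assumes "0 < y"
  shows "(\<integral>\<^sup>+r. ennreal (hh (t + r)) * ennreal (R (r + d) y) * indicator {0<..} r \<partial>lborel) = ennreal (H_shift d t y)"
proof -
  have "ennreal (H_shift d t y) = (\<integral>\<^sup>+r. ennreal (indicator {0<..} r * hh (t + r) * R (r + d) y) \<partial>lborel)"
    unfolding H_shift_def by (rule nn_integral_eq_integral[OF integrable_H_shift[OF assms], symmetric]) (auto simp: hh_nonneg R_nonneg)
  also have "\<dots> = (\<integral>\<^sup>+r. ennreal (hh (t + r)) * ennreal (R (r + d) y) * indicator {0<..} r \<partial>lborel)"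
    by (intro nn_integral_cong) (auto simp: indicator_def ennreal_mult hh_nonneg R_nonneg)
  finally show ?thesis by simp
qed

lemma H_shift_nonneg: "0 \<le> H_shift d t y"
  unfolding H_shift_def by (rule integral_nonneg_AE) (auto simp: hh_nonneg R_nonneg)

lemma integrable_shift_error: "0 < c \<Longrightarrow> 0 \<le> d \<Longrightarrow> integrable lborel (\<lambda>w. (h_lip * d + h_bound * indicator {..d} w) * R w c)"
  by (rule integrable_bounded_mult[where C = "h_lip * d + h_bound"])
     (auto intro!: integrable_R simp: indicator_def h_bound_nonneg h_lip_nonneg)

lemma shift_error_nonneg: "0 \<le> d \<Longrightarrow> 0 \<le> shift_error d c"
  unfolding shift_error_def by (rule integral_nonneg_AE) (auto simp: h_bound_nonneg h_lip_nonneg R_nonneg)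

lemma H_shift_close:
  assumes "0 < d" "0 < c" "c \<le> y"
  shows "\<bar>H_shift d t y - H t y\<bar> \<le> shift_error d c"
proof -
  have y: "0 < y" using assms by simp
  let ?g = "\<lambda>w. indicator {d<..} w * hh (t + w - d) * R w y"
  have "H_shift d t y = (LINT u|lborel. ?g (d + 1 * u))"
    unfolding H_shift_def by (intro Bochner_Integration.integral_cong) (auto simp: indicator_def algebra_simps)
  also have "\<dots> = (LINT w|lborel. ?g w)"
    using lborel_integral_real_affine[of 1 ?g d] by simp
  finally have eq: "H_shift d t y = (LINT w|lborel. ?g w)" .
  have gi: "integrable lborel ?g"
  proof (rule integrable_bounded_mult[OF integrable_R[OF y]])
    show "\<bar>indicator {d<..} w * hh (t + w - d)\<bar> \<le> h_bound" for w
      using hh_bound[of "t + w - d"] h_bound_nonneg by (auto simp: indicator_def)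
  qed simp
  have eq2: "H_shift d t y - H t y = (LINT w|lborel. ?g w - hh (t + w) * R w y)"
    unfolding eq H_def by (rule Bochner_Integration.integral_diff[symmetric, OF gi integrable_H[OF y]])
  have "\<bar>H_shift d t y - H t y\<bar> \<le> (LINT w|lborel. \<bar>?g w - hh (t + w) * R w y\<bar>)"
    unfolding eq2 by (rule integral_abs_bound)
  also have "\<dots> \<le> shift_error d c"
    unfolding shift_error_def
  proof (rule integral_mono)
    show "integrable lborel (\<lambda>w. \<bar>?g w - hh (t + w) * R w y\<bar>)"
      by (rule integrable_abs[OF Bochner_Integration.integrable_diff[OF gi integrable_H[OF y]]])
    show "integrable lborel (\<lambda>w. (h_lip * d + h_bound * indicator {..d} w) * R w c)"
      using assms by (intro integrable_shift_error) auto
    fix w :: real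
    have "\<bar>?g w - hh (t + w) * R w y\<bar> = \<bar>indicator {d<..} w * hh (t + w - d) - hh (t + w)\<bar> * R w y"
      by (simp add: left_diff_distrib[symmetric] abs_mult R_nonneg)
    also have "\<dots> \<le> (h_lip * d + h_bound * indicator {..d} w) * R w y"
      using hh_lip[of "t + w - d" "t + w"] hh_bound[of "t + w"] assms h_lip_nonneg
      by (intro mult_right_mono R_nonneg) (auto simp: indicator_def intro: add_increasing)
    also have "\<dots> \<le> (h_lip * d + h_bound * indicator {..d} w) * R w c"
      using assms h_lip_nonneg h_bound_nonneg by (intro mult_left_mono R_antimono) auto
    finally show "\<bar>?g w - hh (t + w) * R w y\<bar> \<le> (h_lip * d + h_bound * indicator {..d} w) * R w c" .
  qed
  finally show ?thesis .
qed

lemma shift_error_tendsto_0: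
  assumes c: "0 < c"
  shows "(\<lambda>n. shift_error (1 / real (Suc n)) c) \<longlonglongrightarrow> 0"
proof -
  have "(\<lambda>n. LINT w|lborel. (h_lip * (1 / real (Suc n)) + h_bound * indicator {..1 / real (Suc n)} w) * R w c)
      \<longlonglongrightarrow> (LINT w|(lborel :: real measure). 0)"
  proof (rule integral_dominated_convergence[where w = "\<lambda>w. (h_lip + h_bound) * R w c"])
    show "integrable lborel (\<lambda>w. (h_lip + h_bound) * R w c)"
      by (intro integrable_mult_right integrable_R c)
    show "AE w in lborel. (\<lambda>n. (h_lip * (1 / real (Suc n)) + h_bound * indicator {..1 / real (Suc n)} w) * R w c) \<longlonglongrightarrow> 0"
    proof (intro AE_I2)
      fix w :: real
      show "(\<lambda>n. (h_lip * (1 / real (Suc n)) + h_bound * indicator {..1 / real (Suc n)} w) * R w c) \<longlonglongrightarrow> 0"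
      proof (cases "0 < w")
        case True
        have "eventually (\<lambda>n. 1 / real (Suc n) < w) sequentially"
          using order_tendstoD(2)[OF LIMSEQ_Suc[OF lim_1_over_n] True] by simp
        then have "eventually (\<lambda>n. (indicator {..1 / real (Suc n)} w :: real) = 0) sequentially"
          by (rule eventually_mono) auto
        then have "(\<lambda>n. indicator {..1 / real (Suc n)} w :: real) \<longlonglongrightarrow> 0"
          by (rule tendsto_eventually)
        moreover have "(\<lambda>n. 1 / real (Suc n)) \<longlonglongrightarrow> 0" by (rule LIMSEQ_Suc[OF lim_1_over_n])
        ultimately have "(\<lambda>n. (h_lip * (1 / real (Suc n)) + h_bound * indicator {..1 / real (Suc n)} w) * R w c) \<longlonglongrightarrow> (h_lip * 0 + h_bound * 0) * R w c"
          by (intro tendsto_intros)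
        then show ?thesis by simp
      qed (simp add: R_0)
    qed
    show "AE w in lborel. norm ((h_lip * (1 / real (Suc n)) + h_bound * indicator {..1 / real (Suc n)} w) * R w c) \<le> (h_lip + h_bound) * R w c" for n
    proof (intro AE_I2)
      fix w :: real
      have 1: "1 / real (Suc n) \<le> 1" by simp
      have "h_lip * (1 / real (Suc n)) \<le> h_lip * 1"
        by (rule mult_left_mono[OF 1 h_lip_nonneg])
      moreover have "h_bound * indicator {..1 / real (Suc n)} w \<le> h_bound"
        using h_bound_nonneg by (auto simp: indicator_def)
      ultimately have "(h_lip * (1 / real (Suc n)) + h_bound * indicator {..1 / real (Suc n)} w) * R w c \<le> (h_lip + h_bound) * R w c"
        by (intro mult_right_mono R_nonneg) simp
      moreover have "0 \<le> (h_lip * (1 / real (Suc n)) + h_bound * indicator {..1 / real (Suc n)} w) * R w c"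
        using h_bound_nonneg h_lip_nonneg by (intro mult_nonneg_nonneg R_nonneg add_nonneg_nonneg) auto
      ultimately show "norm ((h_lip * (1 / real (Suc n)) + h_bound * indicator {..1 / real (Suc n)} w) * R w c) \<le> (h_lip + h_bound) * R w c"
        by simp
    qed
  qed measurable
  then show ?thesis by (simp add: shift_error_def)
qed

section \<open>Occupation near \<open>0\<close> and the first contact with the curve\<close>

definition above :: "real \<Rightarrow> 'w set" where "above t = {\<omega> \<in> space M. X t \<omega> \<in> {f t<..}}"

definition hits_above :: "real \<Rightarrow> real \<Rightarrow> 'w set" where
  "hits_above t N = {\<omega> \<in> hits f t N. X t \<omega> \<in> {f t<..}}"

text \<open>For small \<open>d\<close> the kernel \<open>R d\<close> is negligible away from
  \<open>0\<close>, so this measures the visits near \<open>0\<close> after time \<open>T\<close>,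
  each weighted with \<open>hh\<close> at its time.\<close>

abbreviation occupation :: "real \<Rightarrow> real \<Rightarrow> 'w \<Rightarrow> ennreal" where
  "occupation d T \<omega> \<equiv> (\<integral>\<^sup>+v. ennreal (hh v) * ennreal (R d (X (max 0 v) \<omega>)) * indicator {T<..} v \<partial>lborel)"

lemma f_continuous: "0 \<le> t \<Longrightarrow> continuous_on {t..N} f"
  by (rule continuous_on_subset[OF f(2)]) auto

lemma above_measurable: "0 \<le> t \<Longrightarrow> above t \<in> sets M"
  unfolding above_def using measurable_X[of t] by measurable

lemma hits_above_measurable: "0 \<le> t \<Longrightarrow> hits_above t N \<in> sets M"
proof -
  assume t: "0 \<le> t"
  have "hits_above t N = hits f t N \<inter> above t" by (auto simp: hits_above_def above_def hits_def)
  then show ?thesis using hits_measurable[OF t f_continuous[OF t]] above_measurable[OF t] by simp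
qed

lemma X_fixed_measurable [measurable]: "\<omega> \<in> space M \<Longrightarrow> (\<lambda>v. X (max 0 v) \<omega>) \<in> borel_measurable borel"
  by (intro X_measurable_compose) auto

lemma occupation_above:
  assumes x: "0 < x" and t: "0 \<le> t" and d: "0 < d"
  shows "(\<integral>\<^sup>+\<omega>\<in>above t. occupation d t \<omega> \<partial>P x) = (\<integral>\<^sup>+\<omega>\<in>above t. ennreal (H_shift d t (X t \<omega>)) \<partial>P x)"
proof -
  have "(\<integral>\<^sup>+\<omega>\<in>above t. occupation d t \<omega> \<partial>P x) =
    (\<integral>\<^sup>+\<omega>\<in>above t. (\<integral>\<^sup>+r. ennreal (hh (t + r)) * ennreal (R (r + d) (X t \<omega>)) * indicator {0<..} r \<partial>lborel) \<partial>P x)"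
    unfolding above_def
    by (rule strong_markov_occupation[OF x stopping_time_const _ const_pre_sigma[OF t] d]) (use t in auto)
  also have "\<dots> = (\<integral>\<^sup>+\<omega>\<in>above t. ennreal (H_shift d t (X t \<omega>)) \<partial>P x)"
    by (intro nn_integral_cong) (use t space_P[OF x] positive_paths in \<open>simp add: nn_integral_H_shift\<close>)
  finally show ?thesis .
qed

lemma occupation_hits_above:
  assumes x: "0 < x" and t: "0 \<le> t" "t \<le> N" and d: "0 < d"
  shows "(\<integral>\<^sup>+\<omega>\<in>hits_above t N. occupation d (first_hit f t N \<omega>) \<omega> \<partial>P x) =
    (\<integral>\<^sup>+\<omega>\<in>hits_above t N. ennreal (H_shift d (first_hit f t N \<omega>) (f (first_hit f t N \<omega>))) \<partial>P x)"
proof -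
  note fh = first_hit_bounds[OF t f_continuous[OF t(1)]]
  have "(\<integral>\<^sup>+\<omega>\<in>hits_above t N. occupation d (first_hit f t N \<omega>) \<omega> \<partial>P x) =
    (\<integral>\<^sup>+\<omega>\<in>hits_above t N. (\<integral>\<^sup>+r. ennreal (hh (first_hit f t N \<omega> + r)) * ennreal (R (r + d) (X (first_hit f t N \<omega>) \<omega>)) * indicator {0<..} r \<partial>lborel) \<partial>P x)"
    unfolding hits_above_def
    by (rule strong_markov_occupation[OF x stopping_time_first_hit[OF t f_continuous[OF t(1)]] _
          first_hit_pre_sigma[OF t f_continuous[OF t(1)]] d])
       (use fh(1) t in \<open>auto intro: order_trans\<close>)
  also have "\<dots> = (\<integral>\<^sup>+\<omega>\<in>hits_above t N. ennreal (H_shift d (first_hit f t N \<omega>) (f (first_hit f t N \<omega>))) \<partial>P x)"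
  proof (intro nn_integral_cong)
    fix \<omega>
    show "(\<integral>\<^sup>+r. ennreal (hh (first_hit f t N \<omega> + r)) * ennreal (R (r + d) (X (first_hit f t N \<omega>) \<omega>)) * indicator {0<..} r \<partial>lborel) * indicator (hits_above t N) \<omega>
      = ennreal (H_shift d (first_hit f t N \<omega>) (f (first_hit f t N \<omega>))) * indicator (hits_above t N) \<omega>"
    proof (cases "\<omega> \<in> hits_above t N")
      case True
      then have "\<omega> \<in> hits f t N" by (simp add: hits_above_def)
      from first_hit_attained(2)[OF t(1) f_continuous[OF t(1)] this]
      have "X (first_hit f t N \<omega>) \<omega> = f (first_hit f t N \<omega>)" .
      moreover have "0 < f (first_hit f t N \<omega>)" using fh(1)[of \<omega>] t by (intro f) simp
      ultimately show ?thesis by (simp add: nn_integral_H_shift)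
    qed simp
  qed
  finally show ?thesis .
qed

lemma f_lower_bound:
  assumes "0 \<le> t" "t \<le> N"
  obtains c where "0 < c" "\<And>u. u \<in> {t..N} \<Longrightarrow> c \<le> f u"
proof -
  have "\<exists>u\<in>{t..N}. \<forall>v\<in>{t..N}. f u \<le> f v"
    by (rule continuous_attains_inf) (use assms f_continuous in auto)
  then show ?thesis using that f(1) assms by (meson atLeastAtMost_iff order_trans)
qed

lemma X_joint_measurable_P:
  assumes "0 < x"
  shows "(\<lambda>p. X (max 0 (snd p)) (fst p)) \<in> borel_measurable (P x \<Otimes>\<^sub>M lborel)"
proof -
  have [measurable_cong]: "sets (P x) = sets M" by (rule sets_P[OF assms])
  show ?thesis by (intro X_measurable_compose) auto
qed

lemma occupation_measurable:
  assumes x: "0 < x" and [measurable]: "T \<in> borel_measurable M"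
  shows "(\<lambda>\<omega>. occupation d (T \<omega>) \<omega>) \<in> borel_measurable (P x)"
proof -
  have [measurable_cong]: "sets (P x) = sets M" by (rule sets_P[OF x])
  note [measurable] = X_joint_measurable_P[OF x]
  have ind: "(\<lambda>p. indicator {T (fst p)<..} (snd p) :: ennreal) = (\<lambda>p. if T (fst p) < snd p then 1 else 0)"
    by (auto simp: fun_eq_iff)
  have [measurable]: "(\<lambda>p. indicator {T (fst p)<..} (snd p) :: ennreal) \<in> borel_measurable (P x \<Otimes>\<^sub>M lborel)"
    unfolding ind by measurable
  show ?thesis by measurable
qed

text \<open>At a fixed time \<open>v\<close> the expected kernel is \<open>R (v + d) x\<close>, and
  \<open>v > N\<close> entails \<open>v + d > N\<close>. The bound is therefore free of
  \<open>d\<close>: it survives \<open>d \<rightarrow> 0\<close> and disappears only as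
  \<open>N \<rightarrow> \<infinity>\<close>.\<close>

lemma occupation_tail:
  assumes x: "0 < x" and N: "0 \<le> N" and d: "0 < d"
  shows "(\<integral>\<^sup>+\<omega>. occupation d N \<omega> \<partial>P x) \<le> ennreal h_bound * (\<integral>\<^sup>+w. ennreal (R w x) * indicator {N<..} w \<partial>lborel)"
proof -
  interpret P: prob_space "P x" by (rule prob_P[OF x])
  interpret pair_sigma_finite "P x" lborel ..
  note [measurable] = X_joint_measurable_P[OF x]
  have "(\<integral>\<^sup>+\<omega>. occupation d N \<omega> \<partial>P x) =
    (\<integral>\<^sup>+v. (\<integral>\<^sup>+\<omega>. ennreal (hh v) * ennreal (R d (X (max 0 v) \<omega>)) * indicator {N<..} v \<partial>P x) \<partial>lborel)"
    by (rule Fubini'[symmetric]) measurable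
  also have "\<dots> \<le> (\<integral>\<^sup>+v. ennreal h_bound * (ennreal (R (v + d) x) * indicator {N<..} (v + d)) \<partial>lborel)"
  proof (rule nn_integral_mono)
    fix v :: real
    show "(\<integral>\<^sup>+\<omega>. ennreal (hh v) * ennreal (R d (X (max 0 v) \<omega>)) * indicator {N<..} v \<partial>P x)
       \<le> ennreal h_bound * (ennreal (R (v + d) x) * indicator {N<..} (v + d))"
    proof (cases "N < v")
      case True
      have Xv: "X v \<in> borel_measurable (P x)" using measurable_X[of v] True N sets_P[OF x] by (simp cong: measurable_cong_sets)
      have "(\<integral>\<^sup>+\<omega>. ennreal (hh v) * ennreal (R d (X (max 0 v) \<omega>)) * indicator {N<..} v \<partial>P x)
         = ennreal (hh v) * (\<integral>\<^sup>+\<omega>. ennreal (R d (X v \<omega>)) \<partial>P x)"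
        using True N Xv by (simp add: nn_integral_cmult max_def)
      also have "\<dots> = ennreal (hh v) * ennreal (R (v + d) x)"
        using True N d x by (simp add: expectation_R)
      also have "\<dots> \<le> ennreal h_bound * ennreal (R (v + d) x)"
        using hh_bound[of v] by (intro mult_right_mono ennreal_leI) auto
      finally show ?thesis using True d by simp
    qed simp
  qed
  also have "\<dots> = ennreal h_bound * (\<integral>\<^sup>+v. ennreal (R (d + 1 * v) x) * indicator {N<..} (d + 1 * v) \<partial>lborel)"
    by (subst nn_integral_cmult) (auto simp: add.commute)
  also have "(\<integral>\<^sup>+v. ennreal (R (d + 1 * v) x) * indicator {N<..} (d + 1 * v) \<partial>lborel) = (\<integral>\<^sup>+w. ennreal (R w x) * indicator {N<..} w \<partial>lborel)"
    by (subst nn_integral_real_affine[where c = 1 and t = d and f = "\<lambda>w. ennreal (R w x) * indicator {N<..} w"]) auto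
  finally show ?thesis .
qed

text \<open>\<open>I n\<close> is the occupation after \<open>t\<close> on \<open>above t\<close>,
  close to the expectation of \<open>H\<close>; \<open>J n\<close> is the occupation after the
  contact, close to the probability of the contact because \<open>H = 1\<close> on the curve.
  Clearly \<open>J n \<le> I n\<close>. The difference arises before the contact, where the kernel
  is at most \<open>R (d n) c\<close>, or after \<open>N\<close>.\<close>

lemma hits_above_bounds:
  assumes x: "0 < x" and t: "0 \<le> t" "t \<le> N"
  shows "emeasure (P x) (hits_above t N) \<le> (\<integral>\<^sup>+\<omega>\<in>above t. ennreal (H t (X t \<omega>)) \<partial>P x)"
    and "(\<integral>\<^sup>+\<omega>\<in>above t. ennreal (H t (X t \<omega>)) \<partial>P x)
      \<le> emeasure (P x) (hits_above t N) + ennreal h_bound * (\<integral>\<^sup>+w. ennreal (R w x) * indicator {N<..} w \<partial>lborel)"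
proof -
  have [measurable_cong]: "sets (P x) = sets M" by (rule sets_P[OF x])
  interpret P: prob_space "P x" by (rule prob_P[OF x])
  let ?B = "above t" and ?A = "hits_above t N" and ?T = "first_hit f t N"
  note fc = f_continuous[OF t(1), of N]
  note fh = first_hit_bounds[OF t fc]
  have [measurable]: "?B \<in> sets M" "?A \<in> sets M" "?T \<in> borel_measurable M" "X t \<in> borel_measurable M"
    using above_measurable hits_above_measurable t stopping_time_measurable[OF stopping_time_first_hit[OF t fc]] measurable_X
    by auto
  \<comment> \<open>A positive lower bound of the curve up to the horizon: all errors are evaluated
    at this level. It depends on \<open>N\<close>, so \<open>d\<close> has to tend to
    \<open>0\<close> before \<open>N\<close> grows.\<close>
  obtain c where c: "0 < c" "\<And>u. u \<in> {t..N} \<Longrightarrow> c \<le> f u" using f_lower_bound[OF t] by blast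
  have Hm: "(\<lambda>\<omega>. ennreal (H t (X t \<omega>)) * indicator ?B \<omega>) \<in> borel_measurable (P x)"
  proof -
    have "(\<lambda>y. H t y) \<in> borel_measurable borel" unfolding H_def by measurable
    then show ?thesis by measurable
  qed
  have Hdm: "(\<lambda>\<omega>. ennreal (H_shift d t (X t \<omega>)) * indicator ?B \<omega>) \<in> borel_measurable (P x)" for d
  proof -
    have "(\<lambda>y. H_shift d t y) \<in> borel_measurable borel" unfolding H_shift_def by measurable
    then show ?thesis by measurable
  qed
  have Jm: "(\<lambda>\<omega>. ennreal (H_shift d (?T \<omega>) (f (?T \<omega>))) * indicator ?A \<omega>) \<in> borel_measurable (P x)" for d
  proof -
    have "(\<lambda>\<omega>. X (?T \<omega>) \<omega>) \<in> borel_measurable M"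
      by (intro X_measurable_compose) (use fh t in \<open>auto intro: order_trans\<close>)
    then have "(\<lambda>\<omega>. ennreal (H_shift d (?T \<omega>) (X (?T \<omega>) \<omega>)) * indicator ?A \<omega>) \<in> borel_measurable (P x)"
      unfolding H_shift_def by measurable
    also have "(\<lambda>\<omega>. ennreal (H_shift d (?T \<omega>) (X (?T \<omega>) \<omega>)) * indicator ?A \<omega>) = (\<lambda>\<omega>. ennreal (H_shift d (?T \<omega>) (f (?T \<omega>))) * indicator ?A \<omega>)"
      using first_hit_attained(2)[OF t(1) fc] by (auto simp: fun_eq_iff indicator_def hits_above_def)
    finally show ?thesis .
  qed
  have closeB: "\<bar>H_shift d t (X t \<omega>) - H t (X t \<omega>)\<bar> \<le> shift_error d c" if "0 < d" "\<omega> \<in> ?B" for d \<omega>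
    by (rule H_shift_close[OF that(1) c(1)]) (use that c(2)[of t] t in \<open>auto simp: above_def\<close>)
  have closeA: "\<bar>H_shift d (?T \<omega>) (f (?T \<omega>)) - 1\<bar> \<le> shift_error d c" if "0 < d" for d \<omega>
  proof -
    have T: "?T \<omega> \<in> {t..N}" using fh by simp
    then have "H (?T \<omega>) (f (?T \<omega>)) = 1" using t by (intro H_f) auto
    then show ?thesis using H_shift_close[OF that c(1) c(2)[OF T], of "?T \<omega>"] by simp
  qed
  define d where "d n = 1 / real (Suc n)" for n
  have d: "0 < d n" for n by (simp add: d_def)
  have e0: "0 \<le> shift_error (d n) c" for n using d[of n] by (intro shift_error_nonneg) simp
  define I where "I n = (\<integral>\<^sup>+\<omega>\<in>?B. occupation (d n) t \<omega> \<partial>P x)" for n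
  define J where "J n = (\<integral>\<^sup>+\<omega>\<in>?A. occupation (d n) (?T \<omega>) \<omega> \<partial>P x)" for n
  have AB: "?A \<subseteq> ?B" by (auto simp: hits_above_def above_def hits_def)
  have IH: "I n \<le> (\<integral>\<^sup>+\<omega>\<in>?B. ennreal (H t (X t \<omega>)) \<partial>P x) + ennreal (shift_error (d n) c)" for n
    unfolding I_def occupation_above[OF x t(1) d]
  proof (rule P.nn_integral_le_add_const[OF Hm])
    fix \<omega>
    show "ennreal (H_shift (d n) t (X t \<omega>)) * indicator ?B \<omega> \<le> ennreal (H t (X t \<omega>)) * indicator ?B \<omega> + ennreal (shift_error (d n) c)"
      using closeB[OF d, of \<omega> n] e0[of n] H_nonneg[of t "X t \<omega>"]
      by (cases "\<omega> \<in> ?B") (auto simp flip: ennreal_plus intro!: ennreal_leI)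
  qed
  have HI: "(\<integral>\<^sup>+\<omega>\<in>?B. ennreal (H t (X t \<omega>)) \<partial>P x) \<le> I n + ennreal (shift_error (d n) c)" for n
    unfolding I_def occupation_above[OF x t(1) d]
  proof (rule P.nn_integral_le_add_const[OF Hdm])
    fix \<omega>
    show "ennreal (H t (X t \<omega>)) * indicator ?B \<omega> \<le> ennreal (H_shift (d n) t (X t \<omega>)) * indicator ?B \<omega> + ennreal (shift_error (d n) c)"
      using closeB[OF d, of \<omega> n] e0[of n] H_shift_nonneg[of "d n" t "X t \<omega>"]
      by (cases "\<omega> \<in> ?B") (auto simp flip: ennreal_plus intro!: ennreal_leI)
  qed
  have A_ind: "emeasure (P x) ?A = (\<integral>\<^sup>+\<omega>. indicator ?A \<omega> \<partial>P x)" by simp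
  have AJ: "emeasure (P x) ?A \<le> J n + ennreal (shift_error (d n) c)" for n
    unfolding J_def occupation_hits_above[OF x t d] A_ind
  proof (rule P.nn_integral_le_add_const[OF Jm])
    fix \<omega>
    have "ennreal 1 \<le> ennreal (H_shift (d n) (?T \<omega>) (f (?T \<omega>)) + shift_error (d n) c)"
      using closeA[OF d, of n \<omega>] by (intro ennreal_leI) linarith
    then show "indicator ?A \<omega> \<le> ennreal (H_shift (d n) (?T \<omega>) (f (?T \<omega>))) * indicator ?A \<omega> + ennreal (shift_error (d n) c)"
      using e0[of n] H_shift_nonneg[of "d n" "?T \<omega>" "f (?T \<omega>)"]
      by (cases "\<omega> \<in> ?A") (simp_all add: ennreal_plus)
  qed
  have JA: "J n \<le> emeasure (P x) ?A + ennreal (shift_error (d n) c)" for n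
    unfolding J_def occupation_hits_above[OF x t d] A_ind
  proof (rule P.nn_integral_le_add_const)
    fix \<omega>
    have "ennreal (H_shift (d n) (?T \<omega>) (f (?T \<omega>))) \<le> ennreal (1 + shift_error (d n) c)"
      using closeA[OF d, of n \<omega>] by (intro ennreal_leI) linarith
    then show "ennreal (H_shift (d n) (?T \<omega>) (f (?T \<omega>))) * indicator ?A \<omega> \<le> indicator ?A \<omega> + ennreal (shift_error (d n) c)"
      using e0[of n] by (cases "\<omega> \<in> ?A") (simp_all add: ennreal_plus)
  qed simp
  have JI: "J n \<le> I n" for n
    unfolding I_def J_def
  proof (rule nn_integral_mono, rule mult_mono)
    fix \<omega>
    show "occupation (d n) (?T \<omega>) \<omega> \<le> occupation (d n) t \<omega>"
      using fh(1)[of \<omega>] by (intro nn_integral_mono mult_left_mono) (auto simp: indicator_def)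
    show "indicator ?A \<omega> \<le> (indicator ?B \<omega> :: ennreal)" using AB by (auto simp: indicator_def)
  qed auto
  let ?E = "ennreal h_bound * (\<integral>\<^sup>+w. ennreal (R w x) * indicator {N<..} w \<partial>lborel)"
  have IJ: "I n \<le> J n + ennreal (h_bound * R (d n) c * (N - t)) + ?E" for n
  proof -
    have "I n \<le> (\<integral>\<^sup>+\<omega>. occupation (d n) (?T \<omega>) \<omega> * indicator ?A \<omega> + ennreal (h_bound * R (d n) c * (N - t)) + occupation (d n) N \<omega> \<partial>P x)"
      unfolding I_def
    proof (rule nn_integral_mono)
      fix \<omega> assume "\<omega> \<in> space (P x)"
      then have \<omega>: "\<omega> \<in> space M" using space_P[OF x] by simp
      let ?\<phi> = "\<lambda>v. ennreal (hh v) * ennreal (R (d n) (X (max 0 v) \<omega>))"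
      note [measurable] = X_fixed_measurable[OF \<omega>]
      show "occupation (d n) t \<omega> * indicator ?B \<omega> \<le> occupation (d n) (?T \<omega>) \<omega> * indicator ?A \<omega> + ennreal (h_bound * R (d n) c * (N - t)) + occupation (d n) N \<omega>"
      proof (cases "\<omega> \<in> ?B")
        case True
        have "occupation (d n) t \<omega> \<le> (\<integral>\<^sup>+v. ?\<phi> v * indicator {?T \<omega><..} v * indicator ?A \<omega> + ennreal (h_bound * R (d n) c) * indicator {t..N} v + ?\<phi> v * indicator {N<..} v \<partial>lborel)"
        proof (rule nn_integral_mono)
          fix v :: real
          \<comment> \<open>Each case is charged to one summand: before the contact the path lies
            above \<open>c\<close>; after a contact the time counts in \<open>J n\<close>; without a
            contact \<open>?T \<omega>\<close> is the default value \<open>N\<close>, and the time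
            counts in the tail.\<close>
          consider "v \<le> t" | "t < v" "v \<le> ?T \<omega>" | "?T \<omega> < v" "\<omega> \<in> ?A" | "?T \<omega> < v" "\<omega> \<notin> ?A" by linarith
          then show "?\<phi> v * indicator {t<..} v \<le> ?\<phi> v * indicator {?T \<omega><..} v * indicator ?A \<omega> + ennreal (h_bound * R (d n) c) * indicator {t..N} v + ?\<phi> v * indicator {N<..} v"
          proof cases
            case 2
            have vN: "v \<in> {t..N}" using 2 fh(2)[of \<omega>] by simp
            have "f v \<le> X v \<omega>"
              by (rule above_before_first_hit[OF t fc \<omega>]) (use True 2 in \<open>auto simp: above_def\<close>)
            then have "c \<le> X v \<omega>" using c(2)[OF vN] by simp
            then have "hh v * R (d n) (X v \<omega>) \<le> h_bound * R (d n) c"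
              using hh_bound[of v] c(1) h_bound_nonneg by (intro mult_mono R_antimono R_nonneg) auto
            then have "?\<phi> v \<le> ennreal (h_bound * R (d n) c)"
              using 2 t by (simp add: ennreal_mult'[symmetric] hh_nonneg max_def ennreal_leI)
            then show ?thesis using 2 vN fh(2)[of \<omega>] by (simp add: indicator_def)
          next
            case 3
            then show ?thesis using fh(1)[of \<omega>] by (auto simp: indicator_def)
          next
            case 4
            then have "\<omega> \<notin> hits f t N" using True by (auto simp: hits_above_def above_def)
            then have "?T \<omega> = N" by (simp add: first_hit_def)
            then show ?thesis using 4 t by (auto simp: indicator_def)
          qed simp
        qed
        also have "\<dots> = (\<integral>\<^sup>+v. ?\<phi> v * indicator {?T \<omega><..} v * indicator ?A \<omega> \<partial>lborel) + (\<integral>\<^sup>+v. ennreal (h_bound * R (d n) c) * indicator {t..N} v \<partial>lborel) + occupation (d n) N \<omega>"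
          by (subst nn_integral_add, measurable, subst nn_integral_add) measurable
        also have "(\<integral>\<^sup>+v. ?\<phi> v * indicator {?T \<omega><..} v * indicator ?A \<omega> \<partial>lborel) = occupation (d n) (?T \<omega>) \<omega> * indicator ?A \<omega>"
          by (rule nn_integral_multc) measurable
        also have "(\<integral>\<^sup>+v. ennreal (h_bound * R (d n) c) * indicator {t..N} v \<partial>lborel) = ennreal (h_bound * R (d n) c * (N - t))"
          using t h_bound_nonneg R_nonneg by (simp add: nn_integral_cmult_indicator ennreal_mult)
        finally show ?thesis using True by simp
      qed simp
    qed
    also have "\<dots> = J n + ennreal (h_bound * R (d n) c * (N - t)) + (\<integral>\<^sup>+\<omega>. occupation (d n) N \<omega> \<partial>P x)"
    proof -
      have [measurable]: "(\<lambda>\<omega>. occupation (d n) (?T \<omega>) \<omega>) \<in> borel_measurable (P x)" "(\<lambda>\<omega>. occupation (d n) N \<omega>) \<in> borel_measurable (P x)"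
        by (rule occupation_measurable[OF x]; measurable)+
      show ?thesis unfolding J_def
        by (subst nn_integral_add, measurable, subst nn_integral_add, measurable) (simp add: P.emeasure_space_1)
    qed
    also have "\<dots> \<le> J n + ennreal (h_bound * R (d n) c * (N - t)) + ?E"
      using t by (intro add_left_mono occupation_tail x d) simp
    finally show ?thesis .
  qed
  have el: "(\<lambda>n. shift_error (d n) c) \<longlonglongrightarrow> 0"
    unfolding d_def by (rule shift_error_tendsto_0[OF c(1)])
  have rl: "(\<lambda>n. R (d n) c) \<longlonglongrightarrow> 0"
    unfolding d_def by (rule R_tendsto_0[OF c(1)])
  show "emeasure (P x) ?A \<le> (\<integral>\<^sup>+\<omega>\<in>?B. ennreal (H t (X t \<omega>)) \<partial>P x)"
  proof (rule ennreal_le_add_tendsto_0)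
    fix n
    have "emeasure (P x) ?A \<le> J n + ennreal (shift_error (d n) c)" by (rule AJ)
    also have "\<dots> \<le> ((\<integral>\<^sup>+\<omega>\<in>?B. ennreal (H t (X t \<omega>)) \<partial>P x) + ennreal (shift_error (d n) c)) + ennreal (shift_error (d n) c)"
      by (intro add_right_mono order_trans[OF JI IH])
    finally show "emeasure (P x) ?A \<le> (\<integral>\<^sup>+\<omega>\<in>?B. ennreal (H t (X t \<omega>)) \<partial>P x) + ennreal (shift_error (d n) c + shift_error (d n) c)"
      using e0[of n] by (simp add: add.assoc ennreal_plus[symmetric] del: ennreal_plus)
  next
    show "(\<lambda>n. shift_error (d n) c + shift_error (d n) c) \<longlonglongrightarrow> 0" using tendsto_add[OF el el] by simp
  qed
  show "(\<integral>\<^sup>+\<omega>\<in>?B. ennreal (H t (X t \<omega>)) \<partial>P x) \<le> emeasure (P x) ?A + ?E"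
  proof (rule ennreal_le_add_tendsto_0)
    fix n
    have r0: "0 \<le> h_bound * R (d n) c * (N - t)" using h_bound_nonneg R_nonneg t by simp
    have "(\<integral>\<^sup>+\<omega>\<in>?B. ennreal (H t (X t \<omega>)) \<partial>P x) \<le> I n + ennreal (shift_error (d n) c)" by (rule HI)
    also have "\<dots> \<le> (((emeasure (P x) ?A + ennreal (shift_error (d n) c)) + ennreal (h_bound * R (d n) c * (N - t))) + ?E) + ennreal (shift_error (d n) c)"
      by (intro add_right_mono order_trans[OF IJ] JA)
    also have "\<dots> = (emeasure (P x) ?A + ?E) + (ennreal (shift_error (d n) c) + ennreal (h_bound * R (d n) c * (N - t)) + ennreal (shift_error (d n) c))"
      by (simp add: ac_simps)
    finally show "(\<integral>\<^sup>+\<omega>\<in>?B. ennreal (H t (X t \<omega>)) \<partial>P x) \<le> (emeasure (P x) ?A + ?E) + ennreal (shift_error (d n) c + h_bound * R (d n) c * (N - t) + shift_error (d n) c)"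
      using e0[of n] r0 by (simp add: ennreal_plus[symmetric] del: ennreal_plus)
  next
    have "(\<lambda>n. shift_error (d n) c + h_bound * R (d n) c * (N - t) + shift_error (d n) c) \<longlonglongrightarrow> 0 + h_bound * 0 * (N - t) + 0"
      by (intro tendsto_intros el rl)
    then show "(\<lambda>n. shift_error (d n) c + h_bound * R (d n) c * (N - t) + shift_error (d n) c) \<longlonglongrightarrow> 0" by simp
  qed
qed

section \<open>The probability of a contact after a given time\<close>

definition tail :: "real \<Rightarrow> 'w set" where "tail t = {\<omega> \<in> space M. \<exists>u\<ge>t. X u \<omega> = f u}"

lemma tail_measurable: "0 \<le> t \<Longrightarrow> tail t \<in> sets M"
  unfolding tail_def by (rule hits_from_measurable) (auto intro: continuous_on_subset[OF f(2)])

lemma tail_Int_above: "tail t \<inter> above t = (\<Union>n. hits_above t (real n))"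
  using hits_from_eq[of t f] unfolding tail_def above_def hits_above_def hits_def by auto

text \<open>Let the horizon grow in the two bounds: the events \<open>hits_above\<close> increase to
  a contact at any later time, and the error vanishes because \<open>R w x\<close> is integrable in
  \<open>w\<close>.\<close>

lemma hit_probability:
  assumes x: "0 < x" and t: "0 \<le> t"
  shows "emeasure (P x) (tail t \<inter> above t) = (\<integral>\<^sup>+\<omega>\<in>above t. ennreal (H t (X t \<omega>)) \<partial>P x)"
proof -
  have sets: "hits_above t N \<in> sets (P x)" for N
    using hits_above_measurable[OF t] sets_P[OF x] by simp
  have inc: "incseq (\<lambda>n. hits_above t (real n))"
    unfolding incseq_def hits_above_def hits_def by force
  have sup: "emeasure (P x) (tail t \<inter> above t) = (SUP n. emeasure (P x) (hits_above t (real n)))"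
    unfolding tail_Int_above using sets inc by (intro SUP_emeasure_incseq[symmetric]) auto
  show ?thesis
  proof (rule antisym)
    show "emeasure (P x) (tail t \<inter> above t) \<le> (\<integral>\<^sup>+\<omega>\<in>above t. ennreal (H t (X t \<omega>)) \<partial>P x)"
      unfolding sup
    proof (rule SUP_least)
      fix n
      show "emeasure (P x) (hits_above t (real n)) \<le> (\<integral>\<^sup>+\<omega>\<in>above t. ennreal (H t (X t \<omega>)) \<partial>P x)"
      proof (cases "t \<le> real n")
        case False
        then have "hits_above t (real n) = {}" by (auto simp: hits_above_def hits_def)
        then show ?thesis by simp
      qed (rule hits_above_bounds(1)[OF x t])
    qed
    show "(\<integral>\<^sup>+\<omega>\<in>above t. ennreal (H t (X t \<omega>)) \<partial>P x) \<le> emeasure (P x) (tail t \<inter> above t)"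
    proof (rule LIMSEQ_le_const)
      let ?E = "\<lambda>n. ennreal h_bound * (\<integral>\<^sup>+w. ennreal (R w x) * indicator {real n<..} w \<partial>lborel)"
      have "(\<lambda>n. \<integral>\<^sup>+w. ennreal (R w x) * indicator {real n<..} w \<partial>lborel) \<longlonglongrightarrow> (\<integral>\<^sup>+w. 0 \<partial>(lborel :: real measure))"
      proof (rule nn_integral_dominated_convergence[where w = "\<lambda>w. ennreal (R w x)"])
        show "(\<integral>\<^sup>+w. ennreal (R w x) \<partial>lborel) < \<infinity>" using nn_integral_R[OF x] by simp
        show "AE w in lborel. (\<lambda>n. ennreal (R w x) * indicator {real n<..} w) \<longlonglongrightarrow> 0"
        proof (intro AE_I2)
          fix w
          have "eventually (\<lambda>n. w \<le> real n) sequentially"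
            using filterlim_real_sequentially by (auto simp: filterlim_at_top)
          then have "eventually (\<lambda>n. ennreal (R w x) * indicator {real n<..} w = 0) sequentially"
            by (rule eventually_mono) auto
          then show "(\<lambda>n. ennreal (R w x) * indicator {real n<..} w) \<longlonglongrightarrow> 0" by (rule tendsto_eventually)
        qed
      qed (auto simp: indicator_def)
      then have "?E \<longlonglongrightarrow> ennreal h_bound * 0"
        by (intro tendsto_mult_ennreal tendsto_const) auto
      then have "(\<lambda>n. emeasure (P x) (tail t \<inter> above t) + ?E n) \<longlonglongrightarrow> emeasure (P x) (tail t \<inter> above t) + ennreal h_bound * 0"
        by (intro tendsto_add tendsto_const)
      then show "(\<lambda>n. emeasure (P x) (tail t \<inter> above t) + ?E n) \<longlonglongrightarrow> emeasure (P x) (tail t \<inter> above t)" by simp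
      have "(\<integral>\<^sup>+\<omega>\<in>above t. ennreal (H t (X t \<omega>)) \<partial>P x) \<le> emeasure (P x) (tail t \<inter> above t) + ?E n" if "nat \<lceil>t\<rceil> \<le> n" for n
      proof -
        have "t \<le> real n" using that by linarith
        have "(\<integral>\<^sup>+\<omega>\<in>above t. ennreal (H t (X t \<omega>)) \<partial>P x) \<le> emeasure (P x) (hits_above t (real n)) + ?E n"
          by (rule hits_above_bounds(2)[OF x t \<open>t \<le> real n\<close>])
        also have "\<dots> \<le> emeasure (P x) (tail t \<inter> above t) + ?E n"
          unfolding sup by (intro add_right_mono SUP_upper) simp
        finally show ?thesis .
      qed
      then show "\<exists>N. \<forall>n\<ge>N. (\<integral>\<^sup>+\<omega>\<in>above t. ennreal (H t (X t \<omega>)) \<partial>P x) \<le> emeasure (P x) (tail t \<inter> above t) + ?E n" by blast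
    qed
  qed
qed

text \<open>Off \<open>above t\<close> the path starts on or below a bounded curve and tends to
  infinity, so a contact is almost sure, in agreement with \<open>H \<ge> 1\<close> there. On
  \<open>above t\<close>, \<open>H \<le> 1\<close> and \<open>hit_probability\<close>
  applies.\<close>

lemma tail_probability:
  assumes x: "0 < x" and t: "0 \<le> t"
  shows "emeasure (P x) (tail t) = (\<integral>\<^sup>+\<omega>. ennreal (min 1 (H t (X t \<omega>))) \<partial>P x)"
proof -
  have [measurable_cong]: "sets (P x) = sets M" by (rule sets_P[OF x])
  have [measurable]: "tail t \<in> sets M" "above t \<in> sets M" "X t \<in> borel_measurable M"
    using tail_measurable above_measurable measurable_X t by auto
  have Hm [measurable]: "(\<lambda>y. H t y) \<in> borel_measurable borel" unfolding H_def by measurable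
  obtain K where K: "\<And>u. 0 \<le> u \<Longrightarrow> f u \<le> K" using f_bounded by blast
  have "emeasure (P x) (tail t) = emeasure (P x) (tail t \<inter> above t) + emeasure (P x) (tail t - above t)"
    by (subst plus_emeasure) (auto intro!: arg_cong[where f = "emeasure (P x)"])
  also have "emeasure (P x) (tail t - above t) = emeasure (P x) (space M - above t)"
  proof (rule emeasure_eq_AE)
    show "AE \<omega> in P x. (\<omega> \<in> tail t - above t) = (\<omega> \<in> space M - above t)"
      using transience(2)[OF x] AE_space
    proof eventually_elim
      case (elim \<omega>)
      then have \<omega>: "\<omega> \<in> space M" using space_P[OF x] by simp
      have "\<omega> \<in> tail t" if "\<omega> \<notin> above t"
        using hits_if_eventually_above[OF \<omega> elim(1) _ _ t, of f K] K t that \<omega> continuous_on_subset[OF f(2), of "{t..}"]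
        by (auto simp: tail_def above_def)
      then show ?case using \<omega> by auto
    qed
  qed (auto simp: space_P[OF x, symmetric])
  also have "emeasure (P x) (space M - above t) = (\<integral>\<^sup>+\<omega>. indicator (space M - above t) \<omega> \<partial>P x)"
    by (rule nn_integral_indicator[symmetric]) (simp add: space_P[OF x, symmetric])
  also have "emeasure (P x) (tail t \<inter> above t) = (\<integral>\<^sup>+\<omega>\<in>above t. ennreal (H t (X t \<omega>)) \<partial>P x)"
    by (rule hit_probability[OF x t])
  also have "(\<integral>\<^sup>+\<omega>\<in>above t. ennreal (H t (X t \<omega>)) \<partial>P x) + (\<integral>\<^sup>+\<omega>. indicator (space M - above t) \<omega> \<partial>P x)
     = (\<integral>\<^sup>+\<omega>. ennreal (H t (X t \<omega>)) * indicator (above t) \<omega> + indicator (space M - above t) \<omega> \<partial>P x)"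
    by (rule nn_integral_add[symmetric]) (simp_all add: space_P[OF x, symmetric])
  also have "\<dots> = (\<integral>\<^sup>+\<omega>. ennreal (min 1 (H t (X t \<omega>))) \<partial>P x)"
  proof (rule nn_integral_cong)
    fix \<omega> assume "\<omega> \<in> space (P x)"
    then have \<omega>: "\<omega> \<in> space M" using space_P[OF x] by simp
    show "ennreal (H t (X t \<omega>)) * indicator (above t) \<omega> + indicator (space M - above t) \<omega> = ennreal (min 1 (H t (X t \<omega>)))"
    proof (cases "f t < X t \<omega>")
      case True
      then show ?thesis using H_le_1[OF t, of "X t \<omega>"] \<omega> by (simp add: above_def min_absorb2)
    next
      case False
      then show ?thesis using H_ge_1[OF t, of "X t \<omega>"] \<omega> positive_paths[OF \<omega> t] by (simp add: above_def min_absorb1)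
    qed
  qed
  finally show ?thesis .
qed

subsection \<open>The derivative of the tail\<close>

text \<open>Formally the derivative of \<open>H t y\<close> in \<open>y\<close>; the proof uses it
  only as this integral, which is the one in the density.\<close>

definition H' :: "real \<Rightarrow> real \<Rightarrow> real" where "H' t y = (LINT u|lborel. hh (t + u) * R' u y)"

lemma H'_eq_set_integral:
  assumes "0 \<le> t" "0 < y"
  shows "(LINT u:{0<..}|lborel. h (u + t) * deriv (\<lambda>y. q u y 0) y) = H' t y"
  unfolding H'_def set_lebesgue_integral_def
  by (intro Bochner_Integration.integral_cong) (use assms in \<open>auto simp: indicator_def R'_def hh_def add.commute\<close>)

lemma integrable_H': "0 < y \<Longrightarrow> integrable lborel (\<lambda>u. hh (t + u) * R' u y)"
  by (rule integrable_bounded_mult[OF integrable_R']) (auto intro: hh_bound)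

lemma H'_nonpos: "H' t y \<le> 0"
proof -
  have "0 \<le> (LINT u|lborel. hh (t + u) * - R' u y)"
    by (rule integral_nonneg_AE) (use hh_nonneg R'_nonpos in \<open>auto intro!: mult_nonneg_nonpos\<close>)
  then show ?thesis by (simp add: H'_def)
qed

lemma H'_lip: "0 < y \<Longrightarrow> \<bar>H' t y - H' t' y\<bar> \<le> h_lip * \<bar>t - t'\<bar> * (LINT u|lborel. \<bar>R' u y\<bar>)"
proof -
  assume y: "0 < y"
  have eq: "H' t y - H' t' y = (LINT u|lborel. hh (t + u) * R' u y - hh (t' + u) * R' u y)"
    unfolding H'_def by (rule Bochner_Integration.integral_diff[symmetric]; rule integrable_H'[OF y])
  have "\<bar>H' t y - H' t' y\<bar> \<le> (LINT u|lborel. \<bar>hh (t + u) * R' u y - hh (t' + u) * R' u y\<bar>)"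
    unfolding eq by (rule integral_abs_bound)
  also have "\<dots> \<le> (LINT u|lborel. h_lip * \<bar>t - t'\<bar> * \<bar>R' u y\<bar>)"
  proof (rule integral_mono)
    show "integrable lborel (\<lambda>u. \<bar>hh (t + u) * R' u y - hh (t' + u) * R' u y\<bar>)"
      by (rule integrable_abs[OF Bochner_Integration.integrable_diff[OF integrable_H'[OF y] integrable_H'[OF y]]])
    show "integrable lborel (\<lambda>u. h_lip * \<bar>t - t'\<bar> * \<bar>R' u y\<bar>)"
      by (rule integrable_mult_right[OF integrable_abs[OF integrable_R'[OF y]]])
    fix u
    have "\<bar>hh (t + u) * R' u y - hh (t' + u) * R' u y\<bar> = \<bar>hh (t + u) - hh (t' + u)\<bar> * \<bar>R' u y\<bar>"
      by (simp add: left_diff_distrib[symmetric] abs_mult)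
    also have "\<dots> \<le> h_lip * \<bar>t - t'\<bar> * \<bar>R' u y\<bar>"
      using hh_lip[of "t + u" "t' + u"] by (intro mult_right_mono) auto
    finally show "\<bar>hh (t + u) * R' u y - hh (t' + u) * R' u y\<bar> \<le> h_lip * \<bar>t - t'\<bar> * \<bar>R' u y\<bar>" .
  qed
  finally show ?thesis by simp
qed

lemma H_continuous: "0 < y \<Longrightarrow> continuous_on S (\<lambda>t. H t y)"
  using H_lip[of y] by (intro continuous_on_if_lipschitz[where L = "h_lip * U y"]) (simp add: mult_ac)

lemma H'_continuous: "0 < y \<Longrightarrow> continuous_on S (\<lambda>t. H' t y)"
  using H'_lip[of y] by (intro continuous_on_if_lipschitz[where L = "h_lip * (LINT u|lborel. \<bar>R' u y\<bar>)"]) (simp add: mult_ac)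

text \<open>With \<open>u = v - t\<close>, the \<open>hh\<close>-weighted integral over
  \<open>v\<close> of \<open>G (v - t)\<close> becomes that of \<open>hh (t + u) * G u\<close>. For
  \<open>G\<close> equal to \<open>R\<close> or \<open>R'\<close> at a level, it reassembles
  \<open>H\<close> or \<open>H'\<close> from the kernels with end time \<open>v\<close>.\<close>

lemma convolution_Fubini:
  fixes A G :: "real \<Rightarrow> real"
  assumes A: "continuous_on {a..b} A" and G: "integrable lborel G"
  shows "integrable lborel (\<lambda>v. hh v * (LINT t:{a..b}|lborel. A t * G (v - t)))" (is ?th1)
    and "(LINT v|lborel. hh v * (LINT t:{a..b}|lborel. A t * G (v - t))) =
      (LINT t:{a..b}|lborel. A t * (LINT u|lborel. hh (t + u) * G u))" (is ?th2)
proof -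
  note [measurable] = borel_measurable_integrable[OF G]
  define A' where "A' t = indicator {a..b} t * A t" for t
  have [measurable]: "A' \<in> borel_measurable borel"
    using borel_measurable_continuous_on_indicator[OF _ A] by (simp add: A'_def[abs_def])
  have A'_int: "integrable lborel A'"
    using borel_integrable_atLeastAtMost'[OF A] by (simp add: set_integrable_def A'_def[abs_def])
  let ?F = "\<lambda>(t, v). hh v * (A' t * G (v - t))"
  have shift: "integrable lborel (\<lambda>v. G (v - t))" for t
    using lborel_integrable_real_affine[OF G, of 1 "- t"] by (simp add: algebra_simps)
  have inner: "integrable lborel (\<lambda>v. hh v * (A' t * G (v - t)))" for t
    by (rule integrable_bounded_mult[OF integrable_mult_right[OF shift]]) (auto intro: hh_bound)
  have shift_int: "(LINT v|lborel. k (v - t)) = (LINT v|lborel. k v)" for k :: "real \<Rightarrow> real" and t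
    using lborel_integral_real_affine[of 1 k "- t"] by (simp add: algebra_simps)
  have int: "integrable (lborel \<Otimes>\<^sub>M lborel) ?F"
  proof (rule lborel_pair.Fubini_integrable)
    show "?F \<in> borel_measurable (lborel \<Otimes>\<^sub>M lborel)" by measurable
    show "AE t in lborel. integrable lborel (\<lambda>v. ?F (t, v))" using inner by simp
    show "integrable lborel (\<lambda>t. LINT v|lborel. norm (?F (t, v)))"
    proof (rule Bochner_Integration.integrable_bound)
      show "integrable lborel (\<lambda>t. h_bound * (LINT u|lborel. \<bar>G u\<bar>) * A' t)"
        by (rule integrable_mult_right[OF A'_int])
      show "(\<lambda>t. LINT v|lborel. norm (?F (t, v))) \<in> borel_measurable lborel" by measurable
      show "AE t in lborel. norm (LINT v|lborel. norm (?F (t, v))) \<le> norm (h_bound * (LINT u|lborel. \<bar>G u\<bar>) * A' t)"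
      proof (intro AE_I2)
        fix t
        have "(LINT v|lborel. norm (?F (t, v))) \<le> (LINT v|lborel. (h_bound * \<bar>A' t\<bar>) * \<bar>G (v - t)\<bar>)"
        proof (rule integral_mono)
          show "integrable lborel (\<lambda>v. norm (?F (t, v)))" using integrable_norm[OF inner[of t]] by simp
          show "integrable lborel (\<lambda>v. (h_bound * \<bar>A' t\<bar>) * \<bar>G (v - t)\<bar>)"
            by (rule integrable_mult_right[OF integrable_abs[OF shift]])
          show "norm (?F (t, v)) \<le> (h_bound * \<bar>A' t\<bar>) * \<bar>G (v - t)\<bar>" for v
            using mult_right_mono[OF hh_bound[of v], of "\<bar>A' t\<bar> * \<bar>G (v - t)\<bar>"] by (simp add: abs_mult mult_ac)
        qed
        also have "\<dots> = (h_bound * \<bar>A' t\<bar>) * (LINT v|lborel. \<bar>G v\<bar>)"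
          using shift_int[of "\<lambda>u. \<bar>G u\<bar>" t] by simp
        also have "\<dots> = \<bar>h_bound * (LINT u|lborel. \<bar>G u\<bar>) * A' t\<bar>"
          by (simp add: abs_mult h_bound_nonneg mult_ac)
        finally have "(LINT v|lborel. norm (?F (t, v))) \<le> \<bar>h_bound * (LINT u|lborel. \<bar>G u\<bar>) * A' t\<bar>" .
        moreover have "0 \<le> (LINT v|lborel. norm (?F (t, v)))" by (rule integral_nonneg_AE) simp
        ultimately show "norm (LINT v|lborel. norm (?F (t, v))) \<le> norm (h_bound * (LINT u|lborel. \<bar>G u\<bar>) * A' t)"
          by simp
      qed
    qed
  qed
  have snd: "(LINT t|lborel. ?F (t, v)) = hh v * (LINT t:{a..b}|lborel. A t * G (v - t))" for v
  proof -
    have "(LINT t|lborel. ?F (t, v)) = hh v * (LINT t|lborel. A' t * G (v - t))" by simp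
    then show ?thesis by (simp add: set_lebesgue_integral_def A'_def mult.assoc)
  qed
  have fst: "(LINT v|lborel. ?F (t, v)) = indicator {a..b} t * (A t * (LINT u|lborel. hh (t + u) * G u))" for t
  proof -
    have "(LINT v|lborel. ?F (t, v)) = (LINT v|lborel. A' t * (hh (t + (v - t)) * G (v - t)))"
      by (intro Bochner_Integration.integral_cong) (simp_all add: mult_ac)
    also have "\<dots> = (LINT v|lborel. A' t * (hh (t + v) * G v))"
      by (rule shift_int[of "\<lambda>u. A' t * (hh (t + u) * G u)"])
    also have "\<dots> = A' t * (LINT v|lborel. hh (t + v) * G v)" by simp
    finally show ?thesis by (simp add: A'_def mult.assoc)
  qed
  have "integrable lborel (\<lambda>v. LINT t|lborel. ?F (t, v))"
    using lborel_pair.integrable_snd[OF int] by simp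
  then show ?th1 unfolding snd .
  have "(LINT v|lborel. (LINT t|lborel. ?F (t, v))) = (LINT t|lborel. (LINT v|lborel. ?F (t, v)))"
    using lborel_pair.Fubini_integral[of "\<lambda>t v. ?F (t, v)"] int by (simp add: split_beta')
  then show ?th2 unfolding snd fst by (simp add: set_lebesgue_integral_def)
qed

lemma H_measurable [measurable]: "(\<lambda>y. H t y) \<in> borel_measurable borel"
  unfolding H_def by measurable

lemma set_integrable_QH:
  assumes "0 < x" "0 < t" "0 < d"
  shows "set_integrable m {d<..} (\<lambda>y. Q t x y * H t y)"
proof -
  have "integrable m (\<lambda>y. Q t x y * (indicator {d<..} y * H t y))"
  proof (rule integrable_Q_mult[where C = "H t d"])
    show "\<bar>indicator {d<..} y * H t y\<bar> \<le> H t d" for y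
      using H_antimono[of d y t] assms H_nonneg by (auto simp: indicator_def)
  qed (use assms in auto)
  then show ?thesis by (simp add: set_integrable_def mult_ac)
qed

text \<open>Tonelli's theorem resolves \<open>H t y\<close> into the kernels
  \<open>R (v - t) y\<close>, so that \<open>N_above_change\<close> can be applied for each
  \<open>v\<close>.\<close>

lemma mass_above_eq:
  assumes "0 < x" "0 < t" "0 < d"
  shows "integrable lborel (\<lambda>v. hh v * N_above x d v t)"
    and "(LINT v|lborel. hh v * N_above x d v t) = (LINT y:{d<..}|m. Q t x y * H t y)"
proof -
  interpret pair_sigma_finite lborel m ..
  have meas: "(\<lambda>v. hh v * N_above x d v t) \<in> borel_measurable lborel"
    unfolding N_above_def set_lebesgue_integral_def using assms by measurable
  have nn1: "(\<integral>\<^sup>+y. ennreal (indicator {d<..} y *\<^sub>R (Q t x y * R (v - t) y)) \<partial>m) = ennreal (N_above x d v t)" for v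
    unfolding N_above_def set_lebesgue_integral_def
    by (rule nn_integral_eq_integral)
       (use integrable_N_above[OF assms, of v] assms in \<open>auto simp: set_integrable_def indicator_def Q_nonneg R_nonneg\<close>)
  have shift: "(\<integral>\<^sup>+v. ennreal (hh v * R (v - t) y) \<partial>lborel) = ennreal (H t y)" if "0 < y" for y
  proof -
    have "(\<integral>\<^sup>+v. ennreal (hh v * R (v - t) y) \<partial>lborel) = (\<integral>\<^sup>+u. ennreal (hh (t + u) * R u y) \<partial>lborel)"
      by (subst nn_integral_real_affine[where c = 1 and t = t]) auto
    then show ?thesis using nn_integral_H[OF that] by simp
  qed
  have "(\<integral>\<^sup>+v. ennreal (hh v * N_above x d v t) \<partial>lborel)
     = (\<integral>\<^sup>+v. (\<integral>\<^sup>+y. ennreal (hh v) * ennreal (indicator {d<..} y *\<^sub>R (Q t x y * R (v - t) y)) \<partial>m) \<partial>lborel)"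
  proof (rule nn_integral_cong)
    fix v
    show "ennreal (hh v * N_above x d v t) = (\<integral>\<^sup>+y. ennreal (hh v) * ennreal (indicator {d<..} y *\<^sub>R (Q t x y * R (v - t) y)) \<partial>m)"
      using assms by (subst nn_integral_cmult) (auto simp: nn1[unfolded real_scaleR_def] ennreal_mult hh_nonneg N_above_nonneg)
  qed
  also have "\<dots> = (\<integral>\<^sup>+y. (\<integral>\<^sup>+v. ennreal (hh v) * ennreal (indicator {d<..} y *\<^sub>R (Q t x y * R (v - t) y)) \<partial>lborel) \<partial>m)"
    by (rule Fubini'[symmetric]) (use assms in measurable)
  also have "\<dots> = (\<integral>\<^sup>+y. ennreal (indicator {d<..} y *\<^sub>R (Q t x y * H t y)) \<partial>m)"
  proof (rule nn_integral_cong)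
    fix y :: real
    show "(\<integral>\<^sup>+v. ennreal (hh v) * ennreal (indicator {d<..} y *\<^sub>R (Q t x y * R (v - t) y)) \<partial>lborel) = ennreal (indicator {d<..} y *\<^sub>R (Q t x y * H t y))"
    proof (cases "d < y")
      case True
      have "(\<integral>\<^sup>+v. ennreal (hh v) * ennreal (indicator {d<..} y *\<^sub>R (Q t x y * R (v - t) y)) \<partial>lborel)
         = (\<integral>\<^sup>+v. ennreal (Q t x y) * ennreal (hh v * R (v - t) y) \<partial>lborel)"
        using True assms by (intro nn_integral_cong) (simp add: ennreal_mult hh_nonneg R_nonneg Q_nonneg mult_ac)
      also have "\<dots> = ennreal (Q t x y) * ennreal (H t y)"
        using True assms by (subst nn_integral_cmult) (auto simp: shift)
      finally show ?thesis using True assms by (simp add: ennreal_mult Q_nonneg H_nonneg)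
    qed simp
  qed
  also have "\<dots> = ennreal (LINT y:{d<..}|m. Q t x y * H t y)"
    unfolding set_lebesgue_integral_def
    by (rule nn_integral_eq_integral)
       (use set_integrable_QH[OF assms] assms in \<open>auto simp: set_integrable_def indicator_def Q_nonneg H_nonneg\<close>)
  finally have nn: "(\<integral>\<^sup>+v. ennreal (hh v * N_above x d v t) \<partial>lborel) = ennreal (LINT y:{d<..}|m. Q t x y * H t y)" .
  show int: "integrable lborel (\<lambda>v. hh v * N_above x d v t)"
    using meas nn assms by (intro integrableI_nonneg) (auto simp: hh_nonneg N_above_nonneg)
  have "0 \<le> (LINT y:{d<..}|m. Q t x y * H t y)"
    unfolding set_lebesgue_integral_def
    by (rule integral_nonneg_AE) (use assms in \<open>auto simp: indicator_def Q_nonneg H_nonneg\<close>)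
  moreover have "0 \<le> (LINT v|lborel. hh v * N_above x d v t)"
    by (rule integral_nonneg_AE) (use assms in \<open>auto simp: hh_nonneg N_above_nonneg\<close>)
  moreover have "ennreal (LINT v|lborel. hh v * N_above x d v t) = ennreal (LINT y:{d<..}|m. Q t x y * H t y)"
    using nn_integral_eq_integral[OF int] nn assms by (simp add: hh_nonneg N_above_nonneg)
  ultimately show "(LINT v|lborel. hh v * N_above x d v t) = (LINT y:{d<..}|m. Q t x y * H t y)"
    by (simp add: ennreal_inj)
qed

text \<open>The expectation of \<open>min 1 (H t (X t))\<close> with the switch between the two
  branches frozen at \<open>d\<close>. For \<open>d = f t\<close> the switch is at the right
  place.\<close>

definition tail_at_level :: "real \<Rightarrow> real \<Rightarrow> real \<Rightarrow> real" where
  "tail_at_level x d t = (LINT y:{0<..d}|m. Q t x y) + (LINT y:{d<..}|m. Q t x y * H t y)"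

text \<open>The balance below \<open>d\<close> contributes the term with \<open>1\<close>, the flux
  through \<open>d\<close> those with \<open>H\<close> and \<open>H'\<close>. On the curve
  \<open>1 - H\<close> vanishes, and only the term with \<open>H'\<close> is left.\<close>

definition level_rate :: "real \<Rightarrow> real \<Rightarrow> real \<Rightarrow> real" where
  "level_rate x d t = (q_y t d x * (1 - H t d) + q t d x * H' t d) / deriv s d"

text \<open>Below the level, Green's formula with the constant \<open>1\<close>; above it,
  \<open>N_above_change\<close> integrated against \<open>hh v\<close> and reassembled by
  \<open>convolution_Fubini\<close>.\<close>

lemma tail_at_level_change:
  assumes x: "0 < x" and ab: "0 < a" "a \<le> b" and d: "0 < d"
  shows "tail_at_level x d b - tail_at_level x d a = integral {a..b} (level_rate x d)"
proof -
  have b: "0 < b" using ab by simp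
  note qyc = q_y_continuous[OF x d ab(1), of b] and qc = q_time_continuous[OF x d ab(1), of b]
  have "(LINT y:{d<..}|m. Q b x y * H b y) - (LINT y:{d<..}|m. Q a x y * H a y)
     = (LINT v|lborel. hh v * N_above x d v b) - (LINT v|lborel. hh v * N_above x d v a)"
    using mass_above_eq(2)[OF x _ d] ab b by simp
  also have "\<dots> = (LINT v|lborel. hh v * N_above x d v b - hh v * N_above x d v a)"
    by (rule Bochner_Integration.integral_diff[symmetric]) (use mass_above_eq(1)[OF x _ d] ab b in auto)
  also have "\<dots> = (LINT v|lborel. (- 1 / deriv s d) * (hh v * (LINT t:{a..b}|lborel. q_y t d x * R (v - t) d) - hh v * (LINT t:{a..b}|lborel. q t d x * R' (v - t) d)))"
  proof (rule Bochner_Integration.integral_cong[OF refl])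
    fix v
    have "(LINT t:{a..b}|lborel. level_flux x d v t) = (LINT t:{a..b}|lborel. q_y t d x * R (v - t) d) - (LINT t:{a..b}|lborel. q t d x * R' (v - t) d)"
      unfolding level_flux_def by (intro set_integral_diff(2) set_integrable_convolution qyc qc integrable_R integrable_R' d)
    then have "N_above x d v b - N_above x d v a = (- 1 / deriv s d) * ((LINT t:{a..b}|lborel. q_y t d x * R (v - t) d) - (LINT t:{a..b}|lborel. q t d x * R' (v - t) d))"
      using N_above_change[OF x ab d, of v] by simp
    then show "hh v * N_above x d v b - hh v * N_above x d v a = (- 1 / deriv s d) * (hh v * (LINT t:{a..b}|lborel. q_y t d x * R (v - t) d) - hh v * (LINT t:{a..b}|lborel. q t d x * R' (v - t) d))"
      by (simp only: right_diff_distrib[symmetric] mult.left_commute)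
  qed
  also have "\<dots> = (- 1 / deriv s d) * ((LINT v|lborel. hh v * (LINT t:{a..b}|lborel. q_y t d x * R (v - t) d)) - (LINT v|lborel. hh v * (LINT t:{a..b}|lborel. q t d x * R' (v - t) d)))"
    using convolution_Fubini(1)[OF qyc integrable_R[OF d]] convolution_Fubini(1)[OF qc integrable_R'[OF d]]
    by (subst integral_mult_right_zero) simp
  also have "\<dots> = (- 1 / deriv s d) * ((LINT t:{a..b}|lborel. q_y t d x * H t d) - (LINT t:{a..b}|lborel. q t d x * H' t d))"
    using convolution_Fubini(2)[OF qyc integrable_R[OF d]] convolution_Fubini(2)[OF qc integrable_R'[OF d]]
    by (simp add: H_def H'_def)
  also have "\<dots> = (- 1 / deriv s d) * (integral {a..b} (\<lambda>t. q_y t d x * H t d) - integral {a..b} (\<lambda>t. q t d x * H' t d))"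
    by (intro arg_cong2[where f = "(*)"] arg_cong2[where f = "(-)"] refl set_borel_integral_eq_integral(2) borel_integrable_atLeastAtMost'
        continuous_on_mult qyc qc H_continuous[OF d] H'_continuous[OF d])
  finally have up: "(LINT y:{d<..}|m. Q b x y * H b y) - (LINT y:{d<..}|m. Q a x y * H a y)
     = (- 1 / deriv s d) * (integral {a..b} (\<lambda>t. q_y t d x * H t d) - integral {a..b} (\<lambda>t. q t d x * H' t d))" .
  have i: "(\<lambda>t. q_y t d x) integrable_on {a..b}" "(\<lambda>t. q_y t d x * H t d) integrable_on {a..b}" "(\<lambda>t. q t d x * H' t d) integrable_on {a..b}"
    by (intro integrable_continuous_interval continuous_on_mult qyc qc H_continuous[OF d] H'_continuous[OF d])+
  have "integral {a..b} (level_rate x d) = integral {a..b} (\<lambda>t. (q_y t d x - q_y t d x * H t d + q t d x * H' t d) / deriv s d)"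
    by (rule integral_cong) (simp add: level_rate_def right_diff_distrib)
  also have "\<dots> = (integral {a..b} (\<lambda>t. q_y t d x) - integral {a..b} (\<lambda>t. q_y t d x * H t d) + integral {a..b} (\<lambda>t. q t d x * H' t d)) / deriv s d"
    using i by (simp add: integral_add integral_diff integrable_diff)
  finally have "integral {a..b} (level_rate x d) = integral {a..b} (\<lambda>t. q_y t d x) / deriv s d + ((LINT y:{d<..}|m. Q b x y * H b y) - (LINT y:{d<..}|m. Q a x y * H a y))"
    unfolding up using scale(3)[OF d] by (simp add: field_simps)
  then show ?thesis
    using mass_below_change[OF x ab d] by (simp add: tail_at_level_def)
qed

lemma tail_prob_eq_tail_at_level:
  assumes x: "0 < x" and t: "0 < t"
  shows "measure (P x) (tail t) = tail_at_level x (f t) t"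
proof -
  have ft: "0 < f t" using f(1) t by simp
  let ?g = "\<lambda>y. Q t x y * min 1 (H t y)"
  have int: "integrable m ?g"
  proof (rule integrable_Q_mult[OF t x, where C = 1])
    show "\<bar>min 1 (H t y)\<bar> \<le> 1" for y using H_nonneg[of t y] by simp
  qed simp
  have "emeasure (P x) (tail t) = (\<integral>\<^sup>+y. ennreal (Q t x y) * ennreal (min 1 (H t y)) \<partial>m)"
    using tail_probability[OF x less_imp_le[OF t]] nn_integral_law[OF t x, of "\<lambda>y. ennreal (min 1 (H t y))"] by simp
  also have "\<dots> = (\<integral>\<^sup>+y. ennreal (?g y) \<partial>m)"
    using t by (intro nn_integral_cong) (simp add: ennreal_mult Q_nonneg H_nonneg)
  also have "\<dots> = ennreal (LINT y|m. ?g y)"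
    using t by (intro nn_integral_eq_integral int AE_I2) (simp add: Q_nonneg H_nonneg)
  finally have "measure (P x) (tail t) = (LINT y|m. ?g y)"
    unfolding measure_def using t by (simp add: Q_nonneg H_nonneg integral_nonneg)
  also have "\<dots> = (LINT y:{0<..f t} \<union> {f t<..}|m. ?g y)"
    unfolding set_lebesgue_integral_def
  proof (rule integral_cong_AE)
    show "AE y in m. ?g y = indicator ({0<..f t} \<union> {f t<..}) y *\<^sub>R ?g y"
      using AE_m_pos by eventually_elim (auto simp: indicator_def)
  qed (use borel_measurable_integrable[OF int] in auto)
  also have "\<dots> = (LINT y:{0<..f t}|m. ?g y) + (LINT y:{f t<..}|m. ?g y)"
    using integrable_mult_indicator[OF _ int] by (intro set_integral_Un) (auto simp: set_integrable_def)
  also have "(LINT y:{0<..f t}|m. ?g y) = (LINT y:{0<..f t}|m. Q t x y)"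
    by (rule set_lebesgue_integral_cong) (use H_ge_1[of t] t in auto)
  also have "(LINT y:{f t<..}|m. ?g y) = (LINT y:{f t<..}|m. Q t x y * H t y)"
    by (rule set_lebesgue_integral_cong) (use H_le_1[of t] t in \<open>auto simp: min_absorb2\<close>)
  finally show ?thesis by (simp add: tail_at_level_def)
qed

text \<open>Raising the level from \<open>d\<close> to \<open>d'\<close> only replaces
  \<open>H\<close> by \<open>1\<close> on \<open>{d<..d'}\<close>.\<close>

lemma tail_at_level_diff:
  assumes x: "0 < x" and t: "0 < t" and d: "0 < d" "d \<le> d'"
    and A: "\<And>y. d < y \<Longrightarrow> y \<le> d' \<Longrightarrow> Q t x y \<le> A"
    and E: "\<And>y. d < y \<Longrightarrow> y \<le> d' \<Longrightarrow> \<bar>1 - H t y\<bar> \<le> E" and pos: "0 \<le> A" "0 \<le> E"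
  shows "\<bar>tail_at_level x d' t - tail_at_level x d t\<bar> \<le> A * E * measure m {d<..d'}"
proof -
  have fin: "emeasure m {d<..d'} < \<infinity>"
  proof (rule le_less_trans[OF emeasure_mono emeasure_m_Ioc_finite])
    show "{d<..d'} \<subseteq> {0<..d'}" using d by auto
  qed simp
  have i1: "set_integrable m S (\<lambda>y. Q t x y)" if "S \<in> sets borel" for S
    using integrable_mult_indicator[OF _ integrable_Q[OF t x], of S] that by (simp add: set_integrable_def)
  have i2: "set_integrable m S (\<lambda>y. Q t x y * H t y)" if "S \<in> sets borel" "S \<subseteq> {d<..}" for S
    using set_integrable_subset[OF set_integrable_QH[OF x t d(1)], of S] that by simp
  have "(LINT y:{0<..d'}|m. Q t x y) = (LINT y:{0<..d}|m. Q t x y) + (LINT y:{d<..d'}|m. Q t x y)"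
  proof -
    have "{0<..d'} = {0<..d} \<union> {d<..d'}" using d by auto
    then show ?thesis by (simp only:) (intro set_integral_Un i1, auto)
  qed
  moreover have "(LINT y:{d<..}|m. Q t x y * H t y) = (LINT y:{d<..d'}|m. Q t x y * H t y) + (LINT y:{d'<..}|m. Q t x y * H t y)"
  proof -
    have eq: "{d<..d'} \<union> {d'<..} = {d<..}" using d by auto
    have "(LINT y:{d<..d'} \<union> {d'<..}|m. Q t x y * H t y) = (LINT y:{d<..d'}|m. Q t x y * H t y) + (LINT y:{d'<..}|m. Q t x y * H t y)"
    proof (rule set_integral_Un)
      show "set_integrable m {d<..d'} (\<lambda>y. Q t x y * H t y)" "set_integrable m {d'<..} (\<lambda>y. Q t x y * H t y)"
        using d by (auto intro!: i2)
    qed auto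
    then show ?thesis unfolding eq .
  qed
  moreover have "(LINT y:{d<..d'}|m. Q t x y - Q t x y * H t y) = (LINT y:{d<..d'}|m. Q t x y) - (LINT y:{d<..d'}|m. Q t x y * H t y)"
    by (intro set_integral_diff(2) i1 i2) auto
  ultimately have eq: "tail_at_level x d' t - tail_at_level x d t = (LINT y:{d<..d'}|m. Q t x y - Q t x y * H t y)"
    by (simp add: tail_at_level_def)
  have "\<bar>tail_at_level x d' t - tail_at_level x d t\<bar> \<le> (LINT y:{d<..d'}|m. \<bar>Q t x y - Q t x y * H t y\<bar>)"
  proof -
    have "{d<..d'} \<subseteq> {d<..}" by auto
    from set_integral_norm_bound[OF set_integral_diff(1)[OF i1 i2[OF _ this]]] show ?thesis unfolding eq by simp
  qed
  also have "\<dots> \<le> (LINT y:{d<..d'}|m. A * E)"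
  proof (rule set_integral_mono)
    show "set_integrable m {d<..d'} (\<lambda>y. \<bar>Q t x y - Q t x y * H t y\<bar>)"
      by (rule set_integrable_abs[OF set_integral_diff(1)[OF i1 i2]]) auto
    show "set_integrable m {d<..d'} (\<lambda>y. A * E)"
      using fin by (simp add: set_integrable_def)
    fix y assume y: "y \<in> {d<..d'}"
    have "Q t x y - Q t x y * H t y = Q t x y * (1 - H t y)" by (simp add: right_diff_distrib)
    then have "\<bar>Q t x y - Q t x y * H t y\<bar> = Q t x y * \<bar>1 - H t y\<bar>"
      using Q_nonneg[OF t, of x y] by (simp add: abs_mult)
    also have "\<dots> \<le> A * E" using A[of y] E[of y] y pos by (intro mult_mono) auto
    finally show "\<bar>Q t x y - Q t x y * H t y\<bar> \<le> A * E" .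
  qed
  also have "\<dots> = A * E * measure m {d<..d'}"
    using fin by (subst set_integral_const) auto
  finally show ?thesis .
qed

lemma m_small_interval:
  assumes D: "0 < D" and e: "0 < e"
  shows "\<exists>r>0. measure m {D - r<..D + r} < e"
proof -
  \<comment> \<open>Radii of at most \<open>D\<close> keep the intervals inside the positive
    half-line, where the mass is known to be finite.\<close>
  have fin: "emeasure m {D - D / real (Suc n)<..D + D / real (Suc n)} \<noteq> \<infinity>" for n
  proof -
    have "D / real (Suc n) \<le> D / 1" by (rule divide_left_mono) (use D in auto)
    then have "emeasure m {D - D / real (Suc n)<..D + D / real (Suc n)} \<le> emeasure m {0<..D + D / real (Suc n)}"
      by (intro emeasure_mono) auto
    then show ?thesis using emeasure_m_Ioc_finite[of "D + D / real (Suc n)"] by (auto simp: top_unique)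
  qed
  have "(\<lambda>n. measure m {D - D / real (Suc n)<..D + D / real (Suc n)}) \<longlonglongrightarrow> measure m (\<Inter>n. {D - D / real (Suc n)<..D + D / real (Suc n)})"
  proof (rule Lim_measure_decseq)
    show "decseq (\<lambda>n. {D - D / real (Suc n)<..D + D / real (Suc n)})"
      unfolding decseq_def
    proof (intro allI impI)
      fix i j :: nat assume "i \<le> j"
      then have "D / real (Suc j) \<le> D / real (Suc i)" using D by (intro divide_left_mono) auto
      then show "{D - D / real (Suc j)<..D + D / real (Suc j)} \<subseteq> {D - D / real (Suc i)<..D + D / real (Suc i)}" by auto
    qed
  qed (use fin in auto)
  also have "measure m (\<Inter>n. {D - D / real (Suc n)<..D + D / real (Suc n)}) = 0"
  proof -
    have sub: "(\<Inter>n. {D - D / real (Suc n)<..D + D / real (Suc n)}) \<subseteq> {D}"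
    proof
      fix y assume y: "y \<in> (\<Inter>n. {D - D / real (Suc n)<..D + D / real (Suc n)})"
      then have yn: "\<bar>y - D\<bar> \<le> D * (1 / real (Suc n))" for n by (auto dest!: spec[of _ n] simp: abs_le_iff)
      have "(\<lambda>n. D * (1 / real (Suc n))) \<longlonglongrightarrow> D * 0"
        by (intro tendsto_intros LIMSEQ_Suc[OF lim_1_over_n])
      then have "\<bar>y - D\<bar> \<le> D * 0" using yn by (intro LIMSEQ_le_const) auto
      then show "y \<in> {D}" by simp
    qed
    have "emeasure m {D} = 0"
    proof -
      have "AE y in lborel. ennreal (rho_pos y) * indicator {D} y = 0"
        using AE_lborel_singleton[of D] by eventually_elim (simp add: indicator_def)
      then have "(\<integral>\<^sup>+y. ennreal (rho_pos y) * indicator {D} y \<partial>lborel) = 0"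
        by (subst nn_integral_0_iff_AE) auto
      then show ?thesis unfolding m_eq by (subst emeasure_density) auto
    qed
    then have "emeasure m (\<Inter>n. {D - D / real (Suc n)<..D + D / real (Suc n)}) = 0"
      using emeasure_mono[OF sub, of m] by simp
    then show ?thesis by (simp add: measure_def)
  qed
  finally have "eventually (\<lambda>n. measure m {D - D / real (Suc n)<..D + D / real (Suc n)} < e) sequentially"
    using e by (rule order_tendstoD)
  then obtain n where "measure m {D - D / real (Suc n)<..D + D / real (Suc n)} < e"
    by (auto dest: eventually_happens)
  then show ?thesis using D by (intro exI[of _ "D / real (Suc n)"]) auto
qed

lemma level_rate_continuous: "0 < x \<Longrightarrow> 0 < d \<Longrightarrow> 0 < a \<Longrightarrow> continuous_on {a..b} (level_rate x d)"
  unfolding level_rate_def using scale(3)[of d]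
  by (intro continuous_intros q_y_continuous q_time_continuous H_continuous H'_continuous) auto

lemma tail_at_level_has_derivative:
  assumes x: "0 < x" and a: "0 < a" and d: "0 < d"
  shows "(tail_at_level x d has_real_derivative level_rate x d a) (at a)"
proof -
  \<comment> \<open>The base time \<open>a/2\<close> is positive and leaves \<open>a\<close> in the
    interior, so the derivative is two-sided.\<close>
  have "((\<lambda>b. integral {a/2..b} (level_rate x d)) has_real_derivative level_rate x d a) (at a within {a/2..a+1})"
    by (rule integral_has_real_derivative) (use level_rate_continuous[OF x d] a in auto)
  then have "((\<lambda>b. integral {a/2..b} (level_rate x d)) has_real_derivative level_rate x d a) (at a)"
    by (subst (asm) at_within_interior) (use a in auto)
  then have "((\<lambda>b. tail_at_level x d (a/2) + integral {a/2..b} (level_rate x d)) has_real_derivative level_rate x d a) (at a)"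
    by (auto intro!: derivative_eq_intros)
  then show ?thesis
  proof (rule has_field_derivative_transform_within_open)
    show "open {a/2<..}" by simp
    show "tail_at_level x d (a/2) + integral {a/2..b} (level_rate x d) = tail_at_level x d b" if "b \<in> {a/2<..}" for b
      using tail_at_level_change[OF x _ _ d, of "a/2" b] a that by auto
  qed (use a in auto)
qed

text \<open>
  Moving the level from \<open>f a\<close> to \<open>f b\<close> does not contribute to the derivative: between these levels
  \<open>1 - H b\<close> is at most \<open>1 - H b (f a) = O(b - a)\<close>, and the measure of the interval tends to \<open>0\<close>.
\<close>

lemma tail_at_level_moving_level:
  assumes x: "0 < x" and a: "0 < a"
  shows "((\<lambda>b. tail_at_level x (f b) b - tail_at_level x (f a) b) has_real_derivative 0) (at a)"
proof -
  define D where "D = f a"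
  have D: "0 < D" using f(1) a by (simp add: D_def)
  obtain A where A: "\<And>t y. t \<in> {a/2..a+1} \<Longrightarrow> 0 \<le> y \<Longrightarrow> y \<le> D + 1 \<Longrightarrow> \<bar>q t y x\<bar> \<le> A"
    using q_bounded[of "a/2" x "a+1" "D+1"] a x by (metis half_gt_zero less_imp_le)
  have A0: "0 \<le> A" using A[of a 0] a D by (auto intro: order_trans[OF abs_ge_zero])
  \<comment> \<open>The error below is \<open>A * E = C * \<bar>b - a\<bar>\<close> times the mass
    between the levels. Hence \<open>r\<close> is chosen to make that mass less than
    \<open>e / (C + 1)\<close>, where the \<open>1\<close> excludes division by
    \<open>0\<close>.\<close>
  define C where "C = A * (h_lip * U D)"
  have C: "0 \<le> C" using A0 h_lip_nonneg U_nonneg by (simp add: C_def)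
  have fa: "isCont f a"
    using continuous_on_interior[OF f(2), of a] a by simp
  have "((\<lambda>b. (tail_at_level x (f b) b - tail_at_level x D b - 0) / (b - a)) \<longlongrightarrow> 0) (at a)"
  proof (rule tendstoI)
    fix e :: real assume e: "0 < e"
    obtain r where r: "0 < r" "measure m {D - r<..D + r} < e / (C + 1)"
      using m_small_interval[OF D, of "e / (C + 1)"] e C by auto
    \<comment> \<open>\<open>r\<close> may exceed \<open>D\<close>; the part cut off at
      \<open>0\<close> is not charged by \<open>m\<close>.\<close>
    have rfin: "emeasure m {max 0 (D - r)<..D + r} < \<infinity>"
    proof (rule le_less_trans[OF emeasure_mono emeasure_m_Ioc_finite])
      show "{max 0 (D - r)<..D + r} \<subseteq> {0<..D + r}" by auto
    qed simp
    have "eventually (\<lambda>b. dist (f b) D < min r 1) (at a)"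
      using fa r unfolding D_def isCont_def by (intro tendstoD) auto
    moreover have "eventually (\<lambda>b. b \<in> {a/2<..<a+1}) (at a)"
      using a by (intro eventually_at_in_open') auto
    moreover have "eventually (\<lambda>b. b \<noteq> a) (at a)" by (simp add: eventually_at_filter)
    ultimately show "eventually (\<lambda>b. dist ((tail_at_level x (f b) b - tail_at_level x D b - 0) / (b - a)) 0 < e) (at a)"
    proof eventually_elim
      case (elim b)
      then have b: "0 < b" "b \<in> {a/2..a+1}" using a by auto
      have fb: "0 < f b" using f(1) b by simp
      have fbD: "\<bar>f b - D\<bar> < r" "f b \<le> D + 1" using elim(1) by (auto simp: dist_real_def)
      define E where "E = h_lip * \<bar>b - a\<bar> * U D"
      have E0: "0 \<le> E" using h_lip_nonneg U_nonneg by (simp add: E_def)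
      have HD: "\<bar>1 - H b D\<bar> \<le> E"
        using H_lip[OF D, of b a] H_f[of a] a by (simp add: D_def E_def abs_minus_commute)
      have Qb: "Q b x y \<le> A" if "0 < y" "y \<le> D + 1" for y
        using A[OF b(2), of y] that b x q_sym[of b x y] by (simp add: Q_eq)
      have meas: "measure m I \<le> measure m {D - r<..D + r}" if "I \<subseteq> {max 0 (D - r)<..D + r}" "I \<in> sets borel" for I
      proof -
        have "measure m I \<le> measure m {max 0 (D - r)<..D + r}"
          using rfin that by (intro measure_mono_fmeasurable) (auto simp: fmeasurable_def)
        also have "\<dots> = measure m {D - r<..D + r}"
          unfolding measure_def using AE_m_pos
          by (intro arg_cong[where f = enn2real] emeasure_eq_AE) (auto elim: eventually_mono)
        finally show ?thesis .
      qed
      \<comment> \<open>\<open>H b\<close> is monotone and equals \<open>1\<close> at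
        \<open>f b\<close>, so between \<open>D\<close> and \<open>f b\<close> the quantity
        \<open>\<bar>1 - H b y\<bar>\<close> is at most its value at \<open>D\<close>, whichever of
        the two levels is higher.\<close>
      have "\<bar>tail_at_level x (f b) b - tail_at_level x D b\<bar> \<le> A * E * measure m {D - r<..D + r}"
      proof (cases "D \<le> f b")
        case True
        have "\<bar>tail_at_level x (f b) b - tail_at_level x D b\<bar> \<le> A * E * measure m {D<..f b}"
        proof (rule tail_at_level_diff[OF x b(1) D True _ _ A0 E0])
          fix y assume y: "D < y" "y \<le> f b"
          then show "Q b x y \<le> A" using fbD D by (intro Qb) auto
          show "\<bar>1 - H b y\<bar> \<le> E"
            using H_ge_1[of b y] H_antimono[of D y b] HD y D b by auto
        qed
        also have "\<dots> \<le> A * E * measure m {D - r<..D + r}"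
          using A0 E0 fbD D r by (intro mult_left_mono meas) auto
        finally show ?thesis .
      next
        case False
        have "\<bar>tail_at_level x D b - tail_at_level x (f b) b\<bar> \<le> A * E * measure m {f b<..D}"
        proof (rule tail_at_level_diff[OF x b(1) fb _ _ _ A0 E0])
          fix y assume y: "f b < y" "y \<le> D"
          then show "Q b x y \<le> A" using fb by (intro Qb) auto
          show "\<bar>1 - H b y\<bar> \<le> E"
            using H_le_1[of b y] H_antimono[of y D b] HD y fb b by auto
        qed (use False in simp)
        also have "\<dots> \<le> A * E * measure m {D - r<..D + r}"
          using A0 E0 fbD fb r by (intro mult_left_mono meas) auto
        finally show ?thesis by (simp add: abs_minus_commute)
      qed
      also have "A * E * measure m {D - r<..D + r} = C * measure m {D - r<..D + r} * \<bar>b - a\<bar>"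
        by (simp add: C_def E_def)
      also have "\<dots> < e * \<bar>b - a\<bar>"
      proof (rule mult_strict_right_mono)
        have "C * measure m {D - r<..D + r} \<le> C * (e / (C + 1))"
          using r C by (intro mult_left_mono) auto
        also have "\<dots> < e" using e C by (simp add: field_simps)
        finally show "C * measure m {D - r<..D + r} < e" .
      qed (use elim in auto)
      finally show ?case using elim(3) by (simp add: dist_real_def abs_divide pos_divide_less_eq)
    qed
  qed
  then show ?thesis
    unfolding has_field_derivative_iff D_def[symmetric] by (simp add: D_def)
qed

subsection \<open>The law of the last passage time\<close>

definition passage_density :: "real \<Rightarrow> real \<Rightarrow> real" where
  "passage_density x t = - (q t x (f t) / deriv s (f t)) * H' t (f t)"

lemma tail_prob_has_derivative:
  assumes x: "0 < x" and a: "0 < a"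
  shows "((\<lambda>t. measure (P x) (tail t)) has_real_derivative - passage_density x a) (at a)"
proof -
  have fa: "0 < f a" using f(1) a by simp
  have "((\<lambda>b. (tail_at_level x (f b) b - tail_at_level x (f a) b) + tail_at_level x (f a) b) has_real_derivative 0 + level_rate x (f a) a) (at a)"
    by (intro DERIV_add tail_at_level_moving_level tail_at_level_has_derivative x a fa)
  moreover have "0 + level_rate x (f a) a = - passage_density x a"
    using H_f[of a] a x fa q_sym[of a x "f a"] by (simp add: level_rate_def passage_density_def)
  ultimately have "((\<lambda>b. tail_at_level x (f b) b) has_real_derivative - passage_density x a) (at a)" by simp
  then show ?thesis
    by (rule has_field_derivative_transform_within_open[of _ _ _ "{0<..}"]) (use a tail_prob_eq_tail_at_level[OF x] in auto)
qed

lemma passage_density_nonneg: "0 < x \<Longrightarrow> 0 < t \<Longrightarrow> 0 \<le> passage_density x t"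
  using q_nonneg[of t x "f t"] f(1)[of t] scale(3)[of "f t"] H'_nonpos[of t "f t"]
  unfolding passage_density_def by (intro mult_nonpos_nonpos) auto

lemma tail_prob_continuous: "0 < x \<Longrightarrow> continuous_on {0<..} (\<lambda>t. measure (P x) (tail t))"
  by (intro continuous_at_imp_continuous_on ballI DERIV_isCont[OF tail_prob_has_derivative]) auto

text \<open>The density is a pointwise limit of difference quotients of the continuous tail
  function.\<close>

lemma passage_density_measurable:
  assumes x: "0 < x"
  shows "(\<lambda>t. indicator {0<..} t * passage_density x t) \<in> borel_measurable borel"
proof (rule borel_measurable_LIMSEQ_real)
  let ?F = "\<lambda>t. measure (P x) (tail t)"
  let ?G = "\<lambda>n t. indicator {0<..} t *\<^sub>R (- ((?F (t + 1 / real (Suc n)) - ?F t) / (1 / real (Suc n))))"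
  show "?G n \<in> borel_measurable borel" for n
  proof (rule borel_measurable_continuous_on_indicator)
    show "continuous_on {0<..} (\<lambda>t. - ((?F (t + 1 / real (Suc n)) - ?F t) / (1 / real (Suc n))))"
      by (intro continuous_intros continuous_on_compose2[OF tail_prob_continuous[OF x]])
         (auto intro!: add_pos_pos)
  qed simp
  show "(\<lambda>n. ?G n t) \<longlonglongrightarrow> indicator {0<..} t * passage_density x t" for t
  proof (cases "0 < t")
    case True
    have "filterlim (\<lambda>n. 1 / real (Suc n)) (at 0) sequentially"
      unfolding filterlim_at by (intro conjI LIMSEQ_Suc[OF lim_1_over_n]) auto
    from filterlim_compose[OF tail_prob_has_derivative[OF x True, unfolded DERIV_def] this]
    have "(\<lambda>n. - ((?F (t + 1 / real (Suc n)) - ?F t) / (1 / real (Suc n)))) \<longlonglongrightarrow> - (- passage_density x t)"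
      by (rule tendsto_minus)
    then show ?thesis using True by simp
  qed simp
qed

text \<open>\<open>tail r\<close> also contains paths whose last contact is exactly at
  \<open>r\<close>; the shift by \<open>1 / real (Suc n)\<close> makes the inequality
  strict.\<close>

lemma last_passage_gt:
  assumes "0 \<le> r"
  shows "{\<omega> \<in> space M. ennreal r < last_passage X f \<omega>} = (\<Union>n. tail (r + 1 / real (Suc n)))"
proof (intro set_eqI iffI)
  fix \<omega> assume "\<omega> \<in> {\<omega> \<in> space M. ennreal r < last_passage X f \<omega>}"
  then obtain t where t: "\<omega> \<in> space M" "0 \<le> t" "X t \<omega> = f t" "r < t"
    using assms by (auto simp: last_passage_def less_Sup_iff ennreal_less_iff)
  then obtain n where "1 / real (Suc n) < t - r"
    using reals_Archimedean[of "t - r"] by (auto simp: inverse_eq_divide)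
  then have "r + 1 / real (Suc n) \<le> t" by simp
  then have "\<omega> \<in> tail (r + 1 / real (Suc n))" unfolding tail_def using t by blast
  then show "\<omega> \<in> (\<Union>n. tail (r + 1 / real (Suc n)))" by blast
next
  fix \<omega> assume "\<omega> \<in> (\<Union>n. tail (r + 1 / real (Suc n)))"
  then obtain n u where u: "\<omega> \<in> space M" "r + 1 / real (Suc n) \<le> u" "X u \<omega> = f u"
    by (auto simp: tail_def)
  have "r < r + 1 / real (Suc n)" by simp
  then have "r < u" using u(2) by linarith
  then show "\<omega> \<in> {\<omega> \<in> space M. ennreal r < last_passage X f \<omega>}"
    using u assms by (auto simp: last_passage_def less_Sup_iff ennreal_less_iff intro!: exI[of _ u])
qed

lemma last_passage_measurable: "last_passage X f \<in> borel_measurable M"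
proof (rule borel_measurableI_greater)
  fix y :: ennreal
  show "{\<omega> \<in> space M. y < last_passage X f \<omega>} \<in> sets M"
  proof (cases y)
    case (real r)
    have "tail (r + 1 / real (Suc n)) \<in> sets M" for n
      using real by (intro tail_measurable) simp
    then show ?thesis unfolding real(2) last_passage_gt[OF real(1)] by auto
  qed simp
qed

lemma last_passage_finite:
  assumes x: "0 < x"
  shows "AE \<omega> in P x. last_passage X f \<omega> < \<infinity>"
  using transience(2)[OF x]
proof eventually_elim
  case (elim \<omega>)
  obtain C where C: "\<And>u. 0 \<le> u \<Longrightarrow> f u \<le> C" using f_bounded by blast
  have "eventually (\<lambda>t. C < X t \<omega>) at_top" using elim by (auto simp: filterlim_at_top_dense)
  then obtain N where N: "\<And>t. N \<le> t \<Longrightarrow> C < X t \<omega>" by (auto simp: eventually_at_top_linorder)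
  have "last_passage X f \<omega> \<le> ennreal N"
    unfolding last_passage_def
  proof (rule Sup_least)
    fix z assume "z \<in> ennreal ` {t. 0 \<le> t \<and> X t \<omega> = f t}"
    then obtain t where t: "z = ennreal t" "0 \<le> t" "X t \<omega> = f t" by auto
    then have "t \<le> N" using N[of t] C[of t] by (cases "N \<le> t") auto
    then show "z \<le> ennreal N" using t by (simp add: ennreal_leI)
  qed
  then show ?case by (simp add: le_less_trans)
qed

text \<open>Continuity of the tail function at \<open>r > 0\<close> removes the difference between a
  contact after \<open>r\<close> and one at or after \<open>r\<close>.\<close>

lemma last_passage_tail_prob:
  assumes x: "0 < x" and r: "0 < r"
  shows "emeasure (P x) {\<omega> \<in> space M. ennreal r < last_passage X f \<omega>} = ennreal (measure (P x) (tail r))"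
proof -
  interpret P: prob_space "P x" by (rule prob_P[OF x])
  have "(\<lambda>n. emeasure (P x) (tail (r + 1 / real (Suc n)))) \<longlonglongrightarrow> emeasure (P x) (\<Union>n. tail (r + 1 / real (Suc n)))"
  proof (rule Lim_emeasure_incseq)
    show "range (\<lambda>n. tail (r + 1 / real (Suc n))) \<subseteq> sets (P x)"
      using tail_measurable[of "r + 1 / real (Suc _)"] r sets_P[OF x] by auto
    show "incseq (\<lambda>n. tail (r + 1 / real (Suc n)))"
      unfolding incseq_def
    proof (intro allI impI)
      fix i j :: nat assume "i \<le> j"
      then have "1 / real (Suc j) \<le> 1 / real (Suc i)" by (simp add: frac_le)
      then have "r + 1 / real (Suc j) \<le> r + 1 / real (Suc i)" by simp
      then show "tail (r + 1 / real (Suc i)) \<subseteq> tail (r + 1 / real (Suc j))"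
        unfolding tail_def using order_trans by blast
    qed
  qed
  moreover have "(\<lambda>n. emeasure (P x) (tail (r + 1 / real (Suc n)))) \<longlonglongrightarrow> ennreal (measure (P x) (tail r))"
  proof -
    have "(\<lambda>n. r + 1 / real (Suc n)) \<longlonglongrightarrow> r + 0"
      by (intro tendsto_intros LIMSEQ_Suc[OF lim_1_over_n])
    then have "(\<lambda>n. measure (P x) (tail (r + 1 / real (Suc n)))) \<longlonglongrightarrow> measure (P x) (tail r)"
      using isCont_tendsto_compose[OF DERIV_isCont[OF tail_prob_has_derivative[OF x r]], of "\<lambda>n. r + 1 / real (Suc n)"] by simp
    then show ?thesis unfolding P.emeasure_eq_measure by (rule tendsto_ennrealI)
  qed
  ultimately show ?thesis
    unfolding last_passage_gt[OF less_imp_le[OF r]] by (rule LIMSEQ_unique)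
qed

text \<open>The limit is the probability of an infinite last passage time, which is \<open>0\<close>
  because paths leave every bounded set for good while the curve stays bounded.\<close>

lemma tail_prob_tendsto_0:
  assumes x: "0 < x"
  shows "((\<lambda>t. measure (P x) (tail t)) \<longlongrightarrow> 0) at_top"
proof -
  interpret P: prob_space "P x" by (rule prob_P[OF x])
  let ?F = "\<lambda>t. measure (P x) (tail t)"
  have anti: "?F t \<le> ?F t'" if "0 \<le> t'" "t' \<le> t" for t t'
  proof (rule P.finite_measure_mono)
    show "tail t \<subseteq> tail t'" unfolding tail_def using that(2) order_trans by blast
    show "tail t' \<in> sets (P x)" using tail_measurable[OF that(1)] sets_P[OF x] by simp
  qed
  have [measurable]: "last_passage X f \<in> borel_measurable (P x)"
    using last_passage_measurable sets_P[OF x] by (simp cong: measurable_cong_sets)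
  have "(\<lambda>n. P.prob {\<omega> \<in> space (P x). ennreal (real (Suc n)) < last_passage X f \<omega>})
      \<longlonglongrightarrow> P.prob (\<Inter>n. {\<omega> \<in> space (P x). ennreal (real (Suc n)) < last_passage X f \<omega>})"
    by (rule P.finite_Lim_measure_decseq)
       (auto simp: decseq_def intro: le_less_trans[rotated] ennreal_leI)
  also have "P.prob (\<Inter>n. {\<omega> \<in> space (P x). ennreal (real (Suc n)) < last_passage X f \<omega>}) = 0"
  proof -
    have "AE \<omega> in P x. \<omega> \<notin> (\<Inter>n. {\<omega> \<in> space (P x). ennreal (real (Suc n)) < last_passage X f \<omega>})"
      using last_passage_finite[OF x]
    proof eventually_elim
      case (elim \<omega>)
      then obtain z where z: "last_passage X f \<omega> = ennreal z" "0 \<le> z"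
        by (cases "last_passage X f \<omega>") auto
      obtain n where "z \<le> real n" using real_arch_simple by blast
      then have "\<not> ennreal (real (Suc n)) < last_passage X f \<omega>"
      proof -
        have "ennreal z \<le> ennreal (real (Suc n))" by (rule ennreal_leI) (use \<open>z \<le> real n\<close> in simp)
        then show ?thesis by (simp only: not_less z(1))
      qed
      then show ?case by blast
    qed
    then have "P.prob (\<Inter>n. {\<omega> \<in> space (P x). ennreal (real (Suc n)) < last_passage X f \<omega>}) = P.prob {}"
      by (intro P.finite_measure_eq_AE) auto
    then show ?thesis by simp
  qed
  finally have lim: "(\<lambda>n. P.prob {\<omega> \<in> space (P x). ennreal (real (Suc n)) < last_passage X f \<omega>}) \<longlonglongrightarrow> 0" .
  have "P.prob {\<omega> \<in> space (P x). ennreal (real (Suc n)) < last_passage X f \<omega>} = ?F (real (Suc n))" for n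
    using last_passage_tail_prob[OF x, of "real (Suc n)"] by (simp add: measure_def space_P[OF x])
  with lim have lim: "(\<lambda>n. ?F (real (Suc n))) \<longlonglongrightarrow> 0" by simp
  show ?thesis
  proof (rule tendstoI)
    fix e :: real assume "0 < e"
    then have "eventually (\<lambda>n. ?F (real (Suc n)) < e) sequentially" using lim by (auto dest: order_tendstoD)
    then obtain n where n: "?F (real (Suc n)) < e" by (auto dest: eventually_happens)
    show "eventually (\<lambda>t. dist (?F t) 0 < e) at_top"
      using eventually_ge_at_top[of "real (Suc n)"]
    proof eventually_elim
      case (elim t)
      then show ?case using anti[of "real (Suc n)" t] n by simp
    qed
  qed
qed

text \<open>The tail function is a primitive of minus the density and vanishes at infinity, so the
  two measures agree on half-lines \<open>{r<..}\<close>, which determine them.\<close>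

lemma has_density_last_passage:
  assumes x: "0 < x"
  shows "has_density_on_positive (P x) (last_passage X f) (passage_density x)"
  unfolding has_density_on_positive_def
proof (intro conjI ballI allI impI)
  interpret P: prob_space "P x" by (rule prob_P[OF x])
  let ?L = "last_passage X f"
  show Lm: "?L \<in> borel_measurable (P x)"
    using last_passage_measurable sets_P[OF x] by (simp cong: measurable_cong_sets)
  note [measurable] = Lm
  show "set_borel_measurable borel {0<..} (passage_density x)"
    using passage_density_measurable[OF x] by (simp add: set_borel_measurable_def)
  show "0 \<le> passage_density x t" if "0 < t" for t by (rule passage_density_nonneg[OF x that])
  define g where "g t = indicator {0<..} t * passage_density x t" for t
  have [measurable]: "g \<in> borel_measurable borel"
    using passage_density_measurable[OF x] by (simp add: g_def[abs_def])
  \<comment> \<open>\<open>enn2real\<close> sends \<open>\<infinity>\<close> to \<open>0\<close>;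
    restricting to \<open>E\<close> discards both the atom at \<open>0\<close> and the value
    \<open>\<infinity>\<close> before passing to the reals.\<close>
  define E where "E = {\<omega> \<in> space (P x). 0 < ?L \<omega> \<and> ?L \<omega> < \<infinity>}"
  have [measurable]: "E \<in> sets (P x)" unfolding E_def by measurable
  define M1 where "M1 = distr (density (P x) (indicator E)) borel (\<lambda>\<omega>. enn2real (?L \<omega>))"
  define M2 where "M2 = density lborel (\<lambda>t. ennreal (g t))"
  have M1: "emeasure M1 B = emeasure (P x) {\<omega> \<in> E. enn2real (?L \<omega>) \<in> B}" if [measurable]: "B \<in> sets borel" for B
  proof -
    have S: "{\<omega> \<in> space (P x). enn2real (?L \<omega>) \<in> B} \<in> sets (P x)" by measurable
    have "emeasure M1 B = emeasure (density (P x) (indicator E)) {\<omega> \<in> space (P x). enn2real (?L \<omega>) \<in> B}"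
      unfolding M1_def by (subst emeasure_distr) (auto simp: vimage_def Int_def conj_commute)
    also have "\<dots> = (\<integral>\<^sup>+\<omega>. indicator E \<omega> * indicator {\<omega> \<in> space (P x). enn2real (?L \<omega>) \<in> B} \<omega> \<partial>P x)"
      by (rule emeasure_density[OF _ S]) measurable
    also have "\<dots> = (\<integral>\<^sup>+\<omega>. indicator {\<omega> \<in> E. enn2real (?L \<omega>) \<in> B} \<omega> \<partial>P x)"
      by (intro nn_integral_cong) (auto simp: indicator_def E_def)
    also have "\<dots> = emeasure (P x) {\<omega> \<in> E. enn2real (?L \<omega>) \<in> B}"
    proof (rule nn_integral_indicator)
      have "{\<omega> \<in> E. enn2real (?L \<omega>) \<in> B} = E \<inter> {\<omega> \<in> space (P x). enn2real (?L \<omega>) \<in> B}" by (auto simp: E_def)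
      then show "{\<omega> \<in> E. enn2real (?L \<omega>) \<in> B} \<in> sets (P x)" using S by simp
    qed
    finally show ?thesis .
  qed
  have M2: "emeasure M2 B = (\<integral>\<^sup>+t\<in>B. ennreal (g t) \<partial>lborel)" if "B \<in> sets borel" for B
    unfolding M2_def using that by (subst emeasure_density) auto
  have sets12: "sets M1 = sets borel" "sets M2 = sets borel" by (simp_all add: M1_def M2_def)
  have pos: "emeasure M1 {r<..} = emeasure M2 {r<..}" if r: "0 < r" for r
  proof -
    have "emeasure M1 {r<..} = emeasure (P x) {\<omega> \<in> E. enn2real (?L \<omega>) \<in> {r<..}}"
      by (rule M1) simp
    also have "\<dots> = emeasure (P x) {\<omega> \<in> space (P x). ennreal r < ?L \<omega>}"
    proof (rule emeasure_eq_AE)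
      show "AE \<omega> in P x. (\<omega> \<in> {\<omega> \<in> E. enn2real (?L \<omega>) \<in> {r<..}}) = (\<omega> \<in> {\<omega> \<in> space (P x). ennreal r < ?L \<omega>})"
        using last_passage_finite[OF x]
      proof eventually_elim
        case (elim \<omega>)
        then obtain z where z: "?L \<omega> = ennreal z" "0 \<le> z" by (cases "?L \<omega>") auto
        then show ?case using r by (auto simp: E_def ennreal_less_iff)
      qed
    qed (simp_all add: E_def)
    also have "\<dots> = ennreal (measure (P x) (tail r))"
      using last_passage_tail_prob[OF x r] by (simp add: space_P[OF x])
    \<comment> \<open>Limit at infinity minus value at \<open>r\<close> of the primitive, which is
      the negative of the tail function.\<close>
    also have "\<dots> = ennreal (0 - - measure (P x) (tail r))" by simp
    also have "\<dots> = (\<integral>\<^sup>+t. ennreal (g t) * indicator {r..} t \<partial>lborel)"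
    proof (rule nn_integral_FTC_atLeast[symmetric])
      show "((\<lambda>t. - measure (P x) (tail t)) has_real_derivative g t) (at t)" if "r \<le> t" for t
        using DERIV_minus[OF tail_prob_has_derivative[OF x, of t]] that r by (simp add: g_def)
      show "0 \<le> g t" if "r \<le> t" for t
        using passage_density_nonneg[OF x, of t] that r by (simp add: g_def)
      show "((\<lambda>t. - measure (P x) (tail t)) \<longlongrightarrow> 0) at_top"
        using tendsto_minus[OF tail_prob_tendsto_0[OF x]] by simp
    qed simp
    also have "\<dots> = (\<integral>\<^sup>+t\<in>{r<..}. ennreal (g t) \<partial>lborel)"
      by (rule nn_integral_cong_AE) (use AE_lborel_singleton[of r] in \<open>auto simp: indicator_def elim!: eventually_mono\<close>)
    finally show ?thesis by (simp add: M2)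
  qed
  \<comment> \<open>The tail is differentiated at positive times only. For \<open>r \<le> 0\<close>
    the half-line is exhausted from inside, as neither measure charges \<open>{..0}\<close>.\<close>
  have sup: "emeasure N {r<..} = (SUP n. emeasure N {1 / real (Suc n)<..})"
    if N: "sets N = sets borel" "emeasure N {..0} = 0" and r: "r \<le> 0" for N :: "real measure" and r
  proof -
    have "emeasure N {r<..} = emeasure N {0<..}"
    proof (rule emeasure_eq_AE)
      have "{..0} \<in> null_sets N" using N by (simp add: null_sets_def)
      from AE_not_in[OF this] show "AE t in N. (t \<in> {r<..}) = (t \<in> {0<..})"
        by eventually_elim (use r in auto)
    qed (auto simp: N)
    also have "{0<..} = (\<Union>n. {1 / real (Suc n)<..})"
    proof (intro set_eqI iffI)
      fix t :: real assume "t \<in> {0<..}"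
      then show "t \<in> (\<Union>n. {1 / real (Suc n)<..})"
        using reals_Archimedean[of t] by (auto simp: inverse_eq_divide)
    next
      fix t :: real assume "t \<in> (\<Union>n. {1 / real (Suc n)<..})"
      then obtain n where "1 / real (Suc n) < t" by auto
      moreover have "0 < 1 / real (Suc n)" by simp
      ultimately have "0 < t" by linarith
      then show "t \<in> {0<..}" by simp
    qed
    also have "emeasure N (\<Union>n. {1 / real (Suc n)<..}) = (SUP n. emeasure N {1 / real (Suc n)<..})"
    proof (rule SUP_emeasure_incseq[symmetric])
      show "incseq (\<lambda>n. {1 / real (Suc n)<..})"
        unfolding incseq_def
      proof (intro allI impI)
        fix i j :: nat assume "i \<le> j"
        then have "1 / real (Suc j) \<le> 1 / real (Suc i)" by (simp add: frac_le)
        then show "{1 / real (Suc i)<..} \<subseteq> {1 / real (Suc j)<..}" by auto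
      qed
    qed (auto simp: N)
    finally show ?thesis .
  qed
  have eq: "M1 = M2"
  proof (rule measure_eqI_lessThan[OF sets12])
    fix r :: real
    show "emeasure M1 {r<..} < \<infinity>"
      by (subst M1) (auto simp: P.emeasure_eq_measure)
    show "emeasure M1 {r<..} = emeasure M2 {r<..}"
    proof (cases "0 < r")
      case False
      have emp: "{\<omega> \<in> E. enn2real (?L \<omega>) \<in> {..0}} = {}"
      proof -
        have "0 < enn2real (?L \<omega>)" if "\<omega> \<in> E" for \<omega>
          using that by (auto simp: E_def enn2real_positive_iff)
        then show ?thesis by (auto simp: not_le)
      qed
      have z1: "emeasure M1 {..0} = 0"
        using M1[of "{..0}"] unfolding emp by simp
      have "(\<integral>\<^sup>+t\<in>{..0}. ennreal (g t) \<partial>lborel) = (\<integral>\<^sup>+t. 0 \<partial>(lborel :: real measure))"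
        by (intro nn_integral_cong) (auto simp: g_def indicator_def)
      then have z2: "emeasure M2 {..0} = 0" by (subst M2) simp_all
      have "(SUP n. emeasure M1 {1 / real (Suc n)<..}) = (SUP n. emeasure M2 {1 / real (Suc n)<..})"
        by (intro SUP_cong refl pos) simp
      then show ?thesis
        using False sup[OF sets12(1) z1, of r] sup[OF sets12(2) z2, of r] by simp
    qed (rule pos)
  qed
  fix B :: "real set" assume B: "B \<in> sets borel" "B \<subseteq> {0<..}"
  have "{\<omega> \<in> space (P x). ?L \<omega> \<in> ennreal ` B} = {\<omega> \<in> E. enn2real (?L \<omega>) \<in> B}"
  proof (intro set_eqI iffI)
    fix \<omega> assume "\<omega> \<in> {\<omega> \<in> space (P x). ?L \<omega> \<in> ennreal ` B}"
    then obtain b where b: "\<omega> \<in> space (P x)" "?L \<omega> = ennreal b" "b \<in> B" by auto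
    then have "0 < b" using B(2) by auto
    then show "\<omega> \<in> {\<omega> \<in> E. enn2real (?L \<omega>) \<in> B}" using b by (simp add: E_def)
  next
    fix \<omega> assume "\<omega> \<in> {\<omega> \<in> E. enn2real (?L \<omega>) \<in> B}"
    then have \<omega>: "\<omega> \<in> space (P x)" "?L \<omega> < \<infinity>" "enn2real (?L \<omega>) \<in> B" by (auto simp: E_def)
    then have "?L \<omega> = ennreal (enn2real (?L \<omega>))" by simp
    then show "\<omega> \<in> {\<omega> \<in> space (P x). ?L \<omega> \<in> ennreal ` B}" using \<omega> by blast
  qed
  then have "emeasure (P x) {\<omega> \<in> space (P x). ?L \<omega> \<in> ennreal ` B} = emeasure M1 B"
    using M1[OF B(1)] by simp
  also have "\<dots> = (\<integral>\<^sup>+t\<in>B. ennreal (g t) \<partial>lborel)" unfolding eq by (rule M2[OF B(1)])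
  also have "\<dots> = (\<integral>\<^sup>+t\<in>B. ennreal (passage_density x t) \<partial>lborel)"
    by (rule nn_integral_cong) (use B(2) in \<open>auto simp: g_def indicator_def\<close>)
  finally show "emeasure (P x) {\<omega> \<in> space (P x). ?L \<omega> \<in> ennreal ` B} = (\<integral>\<^sup>+t\<in>B. ennreal (passage_density x t) \<partial>lborel)" .
qed

end

lemma has_density_on_positive_cong:
  assumes "has_density_on_positive Q Z g" "\<And>t. 0 < t \<Longrightarrow> g' t = g t"
  shows "has_density_on_positive Q Z g'"
proof -
  have "(\<lambda>t. indicator {0<..} t *\<^sub>R g' t) = (\<lambda>t. indicator {0<..} t *\<^sub>R g t)"
    using assms(2) by (auto simp: fun_eq_iff indicator_def)
  then have "set_borel_measurable borel {0<..} g'"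
    using assms(1) by (simp add: has_density_on_positive_def set_borel_measurable_def)
  moreover have "(\<integral>\<^sup>+t\<in>B. ennreal (g' t) \<partial>lborel) = (\<integral>\<^sup>+t\<in>B. ennreal (g t) \<partial>lborel)" if "B \<subseteq> {0<..}" for B
    by (rule nn_integral_cong) (use assms(2) that in \<open>auto simp: indicator_def\<close>)
  ultimately show ?thesis using assms by (simp add: has_density_on_positive_def)
qed

theorem proposition18:
  fixes M :: "'w measure" and P :: "real \<Rightarrow> 'w measure" and X :: "real \<Rightarrow> 'w \<Rightarrow> real"
    and s \<rho> h h' f :: "real \<Rightarrow> real" and q :: "real \<Rightarrow> real \<Rightarrow> real \<Rightarrow> real" and x :: real
  assumes diffusion: "linear_diffusion M P X"
    and scale: "scale_function M P X s" "C2 s" "\<And>y. 0 < y \<Longrightarrow> 0 < deriv s y"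
    and rho: "set_borel_measurable borel {0<..} \<rho>" "\<And>y. 0 < y \<Longrightarrow> 0 < \<rho> y"
    and speed: "speed_measure M P X s (halfline_measure \<rho>)"
    and natural_infinity: "natural_at_infinity s (halfline_measure \<rho>)"
    and entrance_not_exit_0: "entrance_at_0 s (halfline_measure \<rho>)"
      "\<not> exit_at_0 s (halfline_measure \<rho>)"
    and transience: "transient M P X"
      "\<And>y. 0 < y \<Longrightarrow> AE \<omega> in P y. filterlim (\<lambda>t. X t \<omega>) at_top at_top"
    and density: "transition_density M P X (halfline_measure \<rho>) q"
    and smooth: "C122 q" "C12 (\<lambda>t y. q t y 0)"
    and kolmogorov: "\<And>t y z. 0 < t \<Longrightarrow> 0 < y \<Longrightarrow> 0 \<le> z \<Longrightarrow>
      generator \<rho> s (\<lambda>v. q t v z) y = deriv (\<lambda>r. q r y z) t"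
    and q_small_time: "\<And>y. 0 < y \<Longrightarrow> ((\<lambda>t. q t y 0) \<longlongrightarrow> 0) (at_right 0)"
    and q_decreasing: "\<And>t. 0 < t \<Longrightarrow> antimono_on {0<..} (\<lambda>y. q t y 0)"
    and q_vanishing: "\<And>t. 0 < t \<Longrightarrow> ((\<lambda>y. q t y 0) \<longlongrightarrow> 0) at_top"
    and h: "\<And>t. 0 \<le> t \<Longrightarrow> 0 < h t" "bounded (h ` {0..})"
      "\<And>t. 0 \<le> t \<Longrightarrow> (h has_real_derivative h' t) (at t within {0..})"
      "continuous_on {0..} h'" "bounded (h' ` {0..})"
    and f: "\<And>t. 0 \<le> t \<Longrightarrow> 0 < f t" "continuous_on {0..} f"
      "\<And>t. 0 \<le> t \<Longrightarrow> (LINT u:{0<..}|lborel. h (t + u) * q u (f t) 0) = 1"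
    and x: "0 < x"
  shows "has_density_on_positive (P x) (last_passage X f)
    (\<lambda>t. - (q t x (f t) / deriv s (f t)) *
      (LINT u:{0<..}|lborel. h (u + t) * deriv (\<lambda>y. q u y 0) (f t)))"
proof -
  interpret entrance_diffusion M P X s \<rho> q
    using assms unfolding entrance_diffusion_def entrance_diffusion_axioms_def by blast
  interpret last_passage_problem M P X s \<rho> q h h' f
    by unfold_locales (fact h f)+
  show ?thesis
  proof (rule has_density_on_positive_cong[OF has_density_last_passage[OF x]])
    fix t :: real assume "0 < t"
    then show "- (q t x (f t) / deriv s (f t)) * (LINT u:{0<..}|lborel. h (u + t) * deriv (\<lambda>y. q u y 0) (f t))
        = passage_density x t"
      using H'_eq_set_integral[of t "f t"] f(1)[of t] by (simp add: passage_density_def)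
  qed
qed

end
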